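(* In the setting described in the context, let $u,v\in C_0^\infty(U^\delta)$ and let $\chi\in C_0^\infty(U^\delta)$ equal $1$ on a neighbourhood of $\mathrm{supp}[u]\cup\mathrm{supp}[v]$. Then $$\mathcal{E}^{c,\delta}(u,v)=\frac12\int_U\chi\,d\mu^c_{\langle u,v\rangle}+\langle L^\delta(u,v),\chi\rangle+\int_{U\times U\setminus d}\sum_{i=1}^n(y_i-x_i)\Big(\frac{\partial u}{\partial y_i}(y)v(y)-\frac{\partial u}{\partial x_i}(x)v(x)\Big)I_{\{|x-y|\le\delta\}}(x,y)J(dxdy).$$
   Context: Let $U\subset\mathbb{R}^n$ be open, $m$ a positive Radon measure on $U$ with $\mathrm{supp}[m]=U$, $(\cdot,\cdot)$ the inner product of $L^2(U;m)$, $d$ the diagonal of $U\times U$. One of the following holds. Case 1: $(A,D(A))$ is the generator of a strongly continuous contraction sub-Markovian semigroup on $L^2(U;m)$, its co-generator (adjoint) $(\hat A,D(\hat A))$ satisfies $C_0^\infty(U)\subset D(A)\cap D(\hat A)$, and $\mathcal{E}(u,v):=(-Au,v)$ for $u,v\in C_0^\infty(U)$. Case 2: $(\mathcal{E},D(\mathcal{E}))$ is a semi-Dirichlet form on $L^2(U;m)$ with $C_0^\infty(U)\subset D(\mathcal{E})$ such that for every relatively compact open $O\subset U$, whenever $f_n,f\in C_0^\infty(O)$ with $f_n$ and all partial derivatives converging uniformly to $f$ and its partial derivatives, $\mathcal{E}(f,g)=\lim_n\mathcal{E}(f_n,g)$ and $\mathcal{E}(g,f)=\lim_n\mathcal{E}(g,f_n)$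 for all $g\in C_0^\infty(U)$. Let $(G_\beta)$, $(\hat G_\beta)$ be the resolvent and co-resolvent, and $\sigma_\beta,\hat\sigma_\beta$ the positive Radon measures on $U\times U$ with $(\beta G_\beta u,v)=\int u(x)v(y)\sigma_\beta(dxdy)$, $(\beta\hat G_\beta u,v)=\int u(x)v(y)\hat\sigma_\beta(dxdy)$. $J$ (positive Radon on $U\times U\setminus d$) and $K$ (positive Radon on $U$) are the unique measures with $\mathcal{E}(u,v)=\int_{U\times U\setminus d}2(u(y)-u(x))v(y)J(dxdy)+\int_U uv\,dK$ for $v\in C_0^\infty(U)$ and $u\in C_0^\infty(U)$ constant near $\mathrm{supp}[v]$. $U^\delta:=\{x\in U:\inf_{y\in\partial U}|x-y|>\delta\}$, $\delta>0$ fixed with $U^\delta\ne\emptyset$. Fix relatively compact open $\Omega_l\uparrow U$ and $\varsigma_l\downarrow0$ such that $\Gamma_l:=\{(x,y)\in\Omega_l^2:|x-y|\ge\varsigma_l\}$ is a $J$-continuity set, and $\Lambda_l:=\{(x,y)\in\Omega_l^2:|x-y|<\varsigma_l\}$. Let $\delta_k\ge\delta$, $\delta_k\to\delta$ with $J(\{|x-y|=\delta_k\})=0$. For $u,v\in C_0^\infty(U^\delta)$, $\mathcal{E}^{c,\delta}(u,v):=\lim_{k}\lim_{l}\lim_{\beta\to\infty}\beta\{\int_{\Lambda_l}(u(y)-u(x))v(y)\sigma_\beta(dxdy)+\int_{\Gamma_l}\sum_{i=1}^n(y_i-x_i)\frac{\partial u}{\partial y_i}(y)I_{\{|x-y|\le\delta_k\}}(x,y)v(y)\sigma_\beta(dxdy)\}$,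 and $\hat{\mathcal{E}}^{c,\delta}(u,v)$ is the same with $\hat\sigma_\beta$ in place of $\sigma_\beta$ (the limits exist and do not depend on the choices). For $\varphi,\phi\in C_0^\infty(U)$, $\mu^c_{\langle\varphi,\phi\rangle}$ denotes the signed Radon measure on $U$ with $\int_U g\,d\mu^c_{\langle\varphi,\phi\rangle}=\lim_{l}\lim_{\beta\to\infty}\beta\int_{\Lambda_l}(\varphi(y)-\varphi(x))(\phi(y)-\phi(x))g(y)\sigma_\beta(dxdy)$ for all $g\in C_0^\infty(U)$ (this limit exists and defines such a measure). For $u,v\in C_0^\infty(U^\delta)$, $L^\delta(u,v)$ is the linear functional on $C_0^\infty(U^\delta)$ given by $\langle L^\delta(u,v),f\rangle:=\frac12(\mathcal{E}^{c,\delta}(u,vf)-\hat{\mathcal{E}}^{c,\delta}(u,vf))$. *)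

theory Defs
  imports "HOL-Analysis.Analysis"
begin

definition pd :: "'n::finite \<Rightarrow> (real^'n \<Rightarrow> real) \<Rightarrow> real^'n \<Rightarrow> real" where
  "pd i f = (\<lambda>x. frechet_derivative f (at x) (axis i 1))"

definition smooth :: "(real^'n::finite \<Rightarrow> real) \<Rightarrow> bool" where
  "smooth f \<longleftrightarrow> (\<forall>is. foldr pd is f differentiable_on UNIV)"

definition supp :: "('a::topological_space \<Rightarrow> real) \<Rightarrow> 'a set" where
  "supp f = closure {x. f x \<noteq> 0}"

definition C0inf :: "(real^'n::finite) set \<Rightarrow> (real^'n \<Rightarrow> real) set" where
  "C0inf V = {f. smooth f \<and> compact (supp f) \<and> supp f \<subseteq> V}"

definition Udelta :: "(real^'n::finite) set \<Rightarrow> real \<Rightarrow> (real^'n) set" where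
  "Udelta U \<delta> = {x\<in>U. frontier U = {} \<or> infdist x (frontier U) > \<delta>}"

definition radon_on :: "'a::topological_space measure \<Rightarrow> 'a set \<Rightarrow> bool" where
  "radon_on M S \<longleftrightarrow> sets M = sets borel \<and> emeasure M (UNIV - S) = 0 \<and>
     (\<forall>C. compact C \<and> C \<subseteq> S \<longrightarrow> emeasure M C < \<infinity>)"

definition L2 :: "'a measure \<Rightarrow> ('a \<Rightarrow> real) \<Rightarrow> bool" where
  "L2 m f \<longleftrightarrow> f \<in> borel_measurable m \<and> integrable m (\<lambda>x. (f x)^2)"

definition ip :: "'a measure \<Rightarrow> ('a \<Rightarrow> real) \<Rightarrow> ('a \<Rightarrow> real) \<Rightarrow> real" where
  "ip m f g = (\<integral>x. f x * g x \<partial>m)"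

definition l2norm :: "'a measure \<Rightarrow> ('a \<Rightarrow> real) \<Rightarrow> real" where
  "l2norm m f = sqrt (\<integral>x. (f x)^2 \<partial>m)"

definition sub_markov_sg :: "'a measure \<Rightarrow> (real \<Rightarrow> ('a \<Rightarrow> real) \<Rightarrow> ('a \<Rightarrow> real)) \<Rightarrow> bool" where
  "sub_markov_sg m T \<longleftrightarrow>
    (\<forall>t\<ge>0. \<forall>f. L2 m f \<longrightarrow> L2 m (T t f)) \<and>
    (\<forall>t\<ge>0. \<forall>f g a b. L2 m f \<and> L2 m g \<longrightarrow>
        (AE x in m. T t (\<lambda>y. a * f y + b * g y) x = a * T t f x + b * T t g x)) \<and>
    (\<forall>t\<ge>0. \<forall>f g. L2 m f \<and> L2 m g \<and> (AE x in m. f x = g x) \<longrightarrow> (AE x in m. T t f x = T t g x)) \<and>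
    (\<forall>f. L2 m f \<longrightarrow> (AE x in m. T 0 f x = f x)) \<and>
    (\<forall>s\<ge>0. \<forall>t\<ge>0. \<forall>f. L2 m f \<longrightarrow> (AE x in m. T (s + t) f x = T s (T t f) x)) \<and>
    (\<forall>t\<ge>0. \<forall>f. L2 m f \<longrightarrow> l2norm m (T t f) \<le> l2norm m f) \<and>
    (\<forall>f. L2 m f \<longrightarrow> ((\<lambda>t. l2norm m (\<lambda>x. T t f x - f x)) \<longlongrightarrow> 0) (at_right 0)) \<and>
    (\<forall>t\<ge>0. \<forall>f. L2 m f \<and> (AE x in m. 0 \<le> f x \<and> f x \<le> 1) \<longrightarrow>
        (AE x in m. 0 \<le> T t f x \<and> T t f x \<le> 1))"

text \<open>gen m T f g: f is in D(A) and A f = g (in L^2).\<close>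
definition gen :: "'a measure \<Rightarrow> (real \<Rightarrow> ('a \<Rightarrow> real) \<Rightarrow> ('a \<Rightarrow> real)) \<Rightarrow> ('a \<Rightarrow> real) \<Rightarrow> ('a \<Rightarrow> real) \<Rightarrow> bool" where
  "gen m T f g \<longleftrightarrow> L2 m f \<and> L2 m g \<and>
     ((\<lambda>t. l2norm m (\<lambda>x. (T t f x - f x) / t - g x)) \<longlongrightarrow> 0) (at_right 0)"

text \<open>cogen m T g h: g is in D(A^*) (co-generator = adjoint of A) and A^* g = h.\<close>
definition cogen :: "'a measure \<Rightarrow> (real \<Rightarrow> ('a \<Rightarrow> real) \<Rightarrow> ('a \<Rightarrow> real)) \<Rightarrow> ('a \<Rightarrow> real) \<Rightarrow> ('a \<Rightarrow> real) \<Rightarrow> bool" where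
  "cogen m T g h \<longleftrightarrow> L2 m g \<and> L2 m h \<and> (\<forall>f f'. gen m T f f' \<longrightarrow> ip m f' g = ip m f h)"

definition case1 :: "(real^'n::finite) set \<Rightarrow> (real^'n) measure \<Rightarrow> ((real^'n \<Rightarrow> real) \<Rightarrow> (real^'n \<Rightarrow> real) \<Rightarrow> real)
    \<Rightarrow> (real \<Rightarrow> ((real^'n) \<times> (real^'n)) measure) \<Rightarrow> (real \<Rightarrow> ((real^'n) \<times> (real^'n)) measure) \<Rightarrow> bool" where
  "case1 U m E \<sigma> \<sigma>h \<longleftrightarrow> (\<exists>T. sub_markov_sg m T \<and>
     (\<forall>u\<in>C0inf U. (\<exists>g. gen m T u g) \<and> (\<exists>h. cogen m T u h)) \<and>
     (\<forall>u\<in>C0inf U. \<forall>v\<in>C0inf U. \<forall>g. gen m T u g \<longrightarrow> E u v = - ip m g v) \<and>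
     (\<forall>\<beta>>0. \<forall>u\<in>C0inf U. \<forall>v\<in>C0inf U.
        (\<forall>g g'. gen m T g g' \<and> (AE x in m. \<beta> * g x - g' x = u x) \<longrightarrow>
            (\<integral>z. u (fst z) * v (snd z) \<partial>(\<sigma> \<beta>)) = \<beta> * ip m g v) \<and>
        (\<forall>h h'. cogen m T h h' \<and> (AE x in m. \<beta> * h x - h' x = u x) \<longrightarrow>
            (\<integral>z. u (fst z) * v (snd z) \<partial>(\<sigma>h \<beta>)) = \<beta> * ip m h v)))"

definition semi_dirichlet :: "'a measure \<Rightarrow> ('a \<Rightarrow> real) set \<Rightarrow> (('a \<Rightarrow> real) \<Rightarrow> ('a \<Rightarrow> real) \<Rightarrow> real) \<Rightarrow> bool" where
  "semi_dirichlet m D E \<longleftrightarrow>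
    D \<subseteq> {f. L2 m f} \<and>
    (\<forall>f\<in>D. \<forall>g\<in>D. \<forall>a b. (\<lambda>x. a * f x + b * g x) \<in> D) \<and>
    (\<forall>f. L2 m f \<longrightarrow> (\<forall>e>0. \<exists>g\<in>D. l2norm m (\<lambda>x. f x - g x) < e)) \<and>
    (\<forall>f\<in>D. \<forall>g. L2 m g \<and> (AE x in m. f x = g x) \<longrightarrow> g \<in> D \<and> (\<forall>w\<in>D. E g w = E f w \<and> E w g = E w f)) \<and>
    (\<forall>f\<in>D. \<forall>g\<in>D. \<forall>w\<in>D. \<forall>a b.
        E (\<lambda>x. a * f x + b * g x) w = a * E f w + b * E g w \<and>
        E w (\<lambda>x. a * f x + b * g x) = a * E w f + b * E w g) \<and>
    (\<forall>u\<in>D. E u u \<ge> 0) \<and>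
    (\<exists>C. \<forall>u\<in>D. \<forall>v\<in>D. \<bar>E u v + ip m u v\<bar> \<le> C * sqrt (E u u + ip m u u) * sqrt (E v v + ip m v v)) \<and>
    (\<forall>s. (\<forall>k. s k \<in> D) \<and>
         (\<forall>e>0. \<exists>N. \<forall>i\<ge>N. \<forall>j\<ge>N. E (\<lambda>x. s i x - s j x) (\<lambda>x. s i x - s j x)
                                  + ip m (\<lambda>x. s i x - s j x) (\<lambda>x. s i x - s j x) < e)
       \<longrightarrow> (\<exists>u\<in>D. (\<lambda>k. E (\<lambda>x. s k x - u x) (\<lambda>x. s k x - u x)
                          + ip m (\<lambda>x. s k x - u x) (\<lambda>x. s k x - u x)) \<longlonglongrightarrow> 0)) \<and>
    (\<forall>u\<in>D. (\<lambda>x. min (max (u x) 0) 1) \<in> D \<and>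
        E (\<lambda>x. u x + min (max (u x) 0) 1) (\<lambda>x. u x - min (max (u x) 0) 1) \<ge> 0)"

definition case2 :: "(real^'n::finite) set \<Rightarrow> (real^'n) measure \<Rightarrow> ((real^'n \<Rightarrow> real) \<Rightarrow> (real^'n \<Rightarrow> real) \<Rightarrow> real)
    \<Rightarrow> (real \<Rightarrow> ((real^'n) \<times> (real^'n)) measure) \<Rightarrow> (real \<Rightarrow> ((real^'n) \<times> (real^'n)) measure) \<Rightarrow> bool" where
  "case2 U m E \<sigma> \<sigma>h \<longleftrightarrow> (\<exists>D. semi_dirichlet m D E \<and> C0inf U \<subseteq> D \<and>
     (\<forall>V. open V \<and> compact (closure V) \<and> closure V \<subseteq> U \<longrightarrow>
        (\<forall>fs f. (\<forall>k. fs k \<in> C0inf V) \<and> f \<in> C0inf V \<and>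
             (\<forall>is. uniform_limit UNIV (\<lambda>k. foldr pd is (fs k)) (foldr pd is f) sequentially) \<longrightarrow>
           (\<forall>g\<in>C0inf U. (\<lambda>k. E (fs k) g) \<longlonglongrightarrow> E f g \<and> (\<lambda>k. E g (fs k)) \<longlonglongrightarrow> E g f))) \<and>
     (\<forall>\<beta>>0. \<forall>u\<in>C0inf U. \<forall>v\<in>C0inf U.
        (\<forall>g. g \<in> D \<and> (\<forall>w\<in>D. E g w + \<beta> * ip m g w = ip m u w) \<longrightarrow>
            (\<integral>z. u (fst z) * v (snd z) \<partial>(\<sigma> \<beta>)) = \<beta> * ip m g v) \<and>
        (\<forall>h. h \<in> D \<and> (\<forall>w\<in>D. E w h + \<beta> * ip m w h = ip m w u) \<longrightarrow>
            (\<integral>z. u (fst z) * v (snd z) \<partial>(\<sigma>h \<beta>)) = \<beta> * ip m h v)))"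

definition Gam :: "(nat \<Rightarrow> (real^'n::finite) set) \<Rightarrow> (nat \<Rightarrow> real) \<Rightarrow> nat \<Rightarrow> ((real^'n) \<times> (real^'n)) set" where
  "Gam \<Omega> \<zeta> l = {(x, y). x \<in> \<Omega> l \<and> y \<in> \<Omega> l \<and> dist x y \<ge> \<zeta> l}"

definition Lam :: "(nat \<Rightarrow> (real^'n::finite) set) \<Rightarrow> (nat \<Rightarrow> real) \<Rightarrow> nat \<Rightarrow> ((real^'n) \<times> (real^'n)) set" where
  "Lam \<Omega> \<zeta> l = {(x, y). x \<in> \<Omega> l \<and> y \<in> \<Omega> l \<and> dist x y < \<zeta> l}"

text \<open>E^{c,delta}(u,v) (with sigma) resp. its hat version (with sigma-hat).\<close>
definition Ec :: "(real \<Rightarrow> ((real^'n::finite) \<times> (real^'n)) measure) \<Rightarrow> (nat \<Rightarrow> (real^'n) set) \<Rightarrow> (nat \<Rightarrow> real)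
    \<Rightarrow> (nat \<Rightarrow> real) \<Rightarrow> (real^'n \<Rightarrow> real) \<Rightarrow> (real^'n \<Rightarrow> real) \<Rightarrow> real" where
  "Ec \<sigma> \<Omega> \<zeta> dk u v = lim (\<lambda>k. lim (\<lambda>l. Lim at_top (\<lambda>\<beta>::real. \<beta> *
      ((\<integral>z. indicator (Lam \<Omega> \<zeta> l) z * (u (snd z) - u (fst z)) * v (snd z) \<partial>(\<sigma> \<beta>)) +
       (\<integral>z. indicator (Gam \<Omega> \<zeta> l) z *
             (\<Sum>i\<in>UNIV. (snd z $ i - fst z $ i) * pd i u (snd z)) *
             indicator {w. dist (fst w) (snd w) \<le> dk k} z * v (snd z) \<partial>(\<sigma> \<beta>))))))"

text \<open>muc_int sigma Omega varsigma phi psi g is the integral of g against mu^c_<phi,psi>.\<close>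
definition muc_int :: "(real \<Rightarrow> ((real^'n::finite) \<times> (real^'n)) measure) \<Rightarrow> (nat \<Rightarrow> (real^'n) set) \<Rightarrow> (nat \<Rightarrow> real)
    \<Rightarrow> (real^'n \<Rightarrow> real) \<Rightarrow> (real^'n \<Rightarrow> real) \<Rightarrow> (real^'n \<Rightarrow> real) \<Rightarrow> real" where
  "muc_int \<sigma> \<Omega> \<zeta> \<phi> \<psi> g = lim (\<lambda>l. Lim at_top (\<lambda>\<beta>::real. \<beta> *
      (\<integral>z. indicator (Lam \<Omega> \<zeta> l) z * (\<phi> (snd z) - \<phi> (fst z)) * (\<psi> (snd z) - \<psi> (fst z)) * g (snd z) \<partial>(\<sigma> \<beta>))))"

definition Ldelta :: "(real \<Rightarrow> ((real^'n::finite) \<times> (real^'n)) measure) \<Rightarrow> (real \<Rightarrow> ((real^'n) \<times> (real^'n)) measure)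
    \<Rightarrow> (nat \<Rightarrow> (real^'n) set) \<Rightarrow> (nat \<Rightarrow> real) \<Rightarrow> (nat \<Rightarrow> real)
    \<Rightarrow> (real^'n \<Rightarrow> real) \<Rightarrow> (real^'n \<Rightarrow> real) \<Rightarrow> (real^'n \<Rightarrow> real) \<Rightarrow> real" where
  "Ldelta \<sigma> \<sigma>h \<Omega> \<zeta> dk u v f =
     (Ec \<sigma> \<Omega> \<zeta> dk u (\<lambda>x. v x * f x) - Ec \<sigma>h \<Omega> \<zeta> dk u (\<lambda>x. v x * f x)) / 2"

end

theory Submission
  imports Defs
begin

text \<open>
  The resolvent kernels satisfy \<open>\<beta> ((u, v) - \<integral> u(x) v(y) d\<sigma>\<^sub>\<beta>) \<rightarrow> E u v\<close>, and \<open>\<sigma>h\<close> acts on tensors as the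
  transpose of \<open>\<sigma>\<close>. In the form case the resolvents come from Lax--Milgram and the limit from the fact
  that \<open>\<beta> G\<^sub>\<beta> u - u\<close> stays bounded in the form norm and tends to 0 in \<open>L\<^sup>2\<close>; in the semigroup case
  the resolvents are Laplace transforms of the semigroup, defined weakly through the Riesz theorem.

  For \<open>u\<close>, \<open>v\<close> with disjoint supports this says \<open>\<integral> u(x) v(y) \<beta> d\<sigma>\<^sub>\<beta> \<rightarrow> 2 \<integral> u(x) v(y) dJ\<close>, so by Stone--Weierstrass
  \<open>\<beta> \<sigma>\<^sub>\<beta>\<close> converges vaguely to \<open>2 J\<close> off the diagonal. Choose \<open>w \<in> C\<^sub>0\<^sup>\<infinity>(U)\<close> equal to 1 on a
  neighbourhood of the supports of \<open>u\<close> and \<open>v\<close> of width larger than \<open>\<delta>\<close>. Integrals of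
  \<open>(u(y) - u(x)) v(y) w(x)\<close> and \<open>(u(y) - u(x)) (v(y) - v(x)) w(x) w(y)\<close> against \<open>\<beta> \<sigma>\<^sub>\<beta>\<close> converge
  to combinations of values of \<open>E\<close>; applied to the coordinate functions, the second shows that
  \<open>|x - y|\<^sup>2\<close> is locally \<open>J\<close>-integrable. Subtracting the part off the diagonal and letting the
  truncations vanish gives
  \<open>E\<^sup>c(u, v) = E(u, v) - E(w, uv) - 2 \<integral> [(u(y) - u(x)) w(x) - (y - x) \<nabla>u(y) 1\<^bsub>|x - y| \<le> \<delta>\<^esub>] v(y) dJ\<close>,
  a similar formula for \<open>\<mu>\<^sup>c\<close>, and the transposed one for the co-form. Since \<open>v \<chi> = v\<close>, the claim
  is that \<open>E\<^sup>c(u, v)\<close> and its co-version add up to the \<open>\<mu>\<^sup>c\<close>-term plus twice the \<open>J\<close>-integral,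
  which is then a pointwise identity of the integrands.
\<close>

section \<open>Smooth functions\<close>

text \<open>Near the diagonal the scaled kernels cannot be compared with \<open>J\<close>: part of
  their limit there is the diffusion part, and \<open>J\<close> may have infinite mass. Each
  integral is therefore evaluated whole, across the diagonal, and only its part at distance at least
  \<open>\<zeta> l\<close> is removed by comparison with \<open>J\<close>. This works for finite
  sums of products f(x) g(y) with compactly supported factors. The function u(y) v(y) alone is not
  one; the factor w(x) makes it one. The margin by which the width of w exceeds \<delta> is needed
  since the thresholds \<open>dk k\<close> approach \<delta> from above. The values of
  \<open>E\<close> in the two forms are those in the diffusion measure, so they cancel and only
  integrals against \<open>J\<close> remain. \<open>lim\<close> and \<open>Lim\<close> are total, so
  each limit has to be shown to exist before its value can be used. Apart from being Radon, the
  kernels are known only through integrals of products of test functions; the locales ask for no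
  more, so that one argument serves \<sigma> with \<open>J\<close> and \<sigma>h with the image of
  \<open>J\<close> under \<open>prod.swap\<close>.\<close>

lemma smooth_imp_differentiable: "smooth f \<Longrightarrow> f differentiable (at x)"
  unfolding smooth_def differentiable_on_def by (metis UNIV_I foldr.simps(1) id_apply)

lemma smooth_pd: "smooth f \<Longrightarrow> smooth (pd i f)"
  unfolding smooth_def
proof
  fix "is" assume "\<forall>is. foldr pd is f differentiable_on UNIV"
  from this[rule_format, of "is @ [i]"] show "foldr pd is (pd i f) differentiable_on UNIV"
    by simp
qed

lemma smooth_imp_continuous_on: "smooth f \<Longrightarrow> continuous_on A f"
  by (meson continuous_at_imp_continuous_on differentiable_imp_continuous_within smooth_imp_differentiable)

lemma smooth_has_derivative: "smooth f \<Longrightarrow> (f has_derivative frechet_derivative f (at x)) (at x)"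
  using frechet_derivative_works smooth_imp_differentiable by blast

lemma pd_eqI: "(f has_derivative f') (at x) \<Longrightarrow> pd i f x = f' (axis i 1)"
  unfolding pd_def using frechet_derivative_at by metis

text \<open>Finite nonempty sums of members of a class. They serve as the invariant for iterated
  derivatives, where the product rule leaves a class of products but not the class of their sums,
  and later as the span of tensor products with disjoint supports.\<close>

inductive sums_of :: "(('a \<Rightarrow> real) \<Rightarrow> bool) \<Rightarrow> ('a \<Rightarrow> real) \<Rightarrow> bool" for P where
  base: "P f \<Longrightarrow> sums_of P f"
| add: "sums_of P f \<Longrightarrow> sums_of P g \<Longrightarrow> sums_of P (\<lambda>x. f x + g x)"

lemma pd_add:
  assumes "f differentiable (at x)" "g differentiable (at x)"
  shows "pd i (\<lambda>x. f x + g x) x = pd i f x + pd i g x"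
proof -
  have "((\<lambda>x. f x + g x) has_derivative
      (\<lambda>h. frechet_derivative f (at x) h + frechet_derivative g (at x) h)) (at x)"
    using assms by (intro has_derivative_add) (auto simp: frechet_derivative_works)
  from pd_eqI[OF this] show ?thesis by (simp add: pd_def)
qed

lemma pd_mult:
  assumes "f differentiable (at x)" "g differentiable (at x)"
  shows "pd i (\<lambda>x. f x * g x) x = f x * pd i g x + pd i f x * g x"
proof -
  have "((\<lambda>x. f x * g x) has_derivative
      (\<lambda>h. f x * frechet_derivative g (at x) h + frechet_derivative f (at x) h * g x)) (at x)"
    using assms by (intro has_derivative_mult) (auto simp: frechet_derivative_works)
  from pd_eqI[OF this] show ?thesis by (simp add: pd_def)
qed

text \<open>\<open>smooth\<close> speaks about all iterated partial derivatives at once, so it is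
  proved by an invariant of \<open>pd\<close>. A class of products is not invariant, since
  differentiation produces two terms; the class of its finite sums is.\<close>

lemma smooth_if_sums_of:
  assumes diff: "\<And>f x. P f \<Longrightarrow> f differentiable (at x)"
    and pd: "\<And>f i. P f \<Longrightarrow> sums_of P (pd i f)"
    and f: "sums_of P f"
  shows "smooth f"
proof -
  have d: "g differentiable (at x)" if "sums_of P g" for g x
    using that by (induction) (auto intro: diff)
  have p: "sums_of P (pd i g)" if "sums_of P g" for g i
    using that
  proof induction
    case (add f g)
    then have "pd i (\<lambda>x. f x + g x) = (\<lambda>x. pd i f x + pd i g x)"
      by (auto simp: fun_eq_iff d intro!: pd_add)
    then show ?case using add sums_of.add by metis
  qed (rule pd)
  have "sums_of P (foldr pd is f)" for "is"
    by (induction "is") (auto intro: p f)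
  then show ?thesis
    unfolding smooth_def differentiable_on_def using d by (meson differentiable_at_withinI)
qed

lemma smooth_add: "smooth f \<Longrightarrow> smooth g \<Longrightarrow> smooth (\<lambda>x. f x + g x)"
  by (rule smooth_if_sums_of[where P=smooth])
     (auto intro: smooth_imp_differentiable smooth_pd sums_of.intros)

lemma smooth_const: "smooth (\<lambda>x. c)"
proof (rule smooth_if_sums_of[where P="\<lambda>f. \<exists>c. f = (\<lambda>x. c)"])
  fix f :: "real^'a \<Rightarrow> real" and i assume "\<exists>c. f = (\<lambda>x. c)"
  then have "pd i f = (\<lambda>x. 0)" by (auto simp: pd_def)
  then show "sums_of (\<lambda>f. \<exists>c. f = (\<lambda>x. c)) (pd i f)" by (auto intro: sums_of.intros)
qed (auto intro: sums_of.intros)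

lemma smooth_linear:
  assumes "bounded_linear f" shows "smooth f"
proof (rule smooth_if_sums_of[where P="\<lambda>g. g = f \<or> smooth g"])
  fix g i assume g: "g = f \<or> smooth g"
  have "pd i f = (\<lambda>x. f (axis i 1))"
    using assms by (auto simp: fun_eq_iff intro!: pd_eqI bounded_linear_imp_has_derivative)
  then show "sums_of (\<lambda>g. g = f \<or> smooth g) (pd i g)"
    using g by (auto intro!: sums_of.base simp: smooth_const smooth_pd)
next
  fix g x assume "g = f \<or> smooth g"
  then show "g differentiable at x"
    using assms by (auto intro: smooth_imp_differentiable bounded_linear_imp_differentiable)
qed (auto intro: sums_of.base)

lemma smooth_mult:
  assumes "smooth f" "smooth g" shows "smooth (\<lambda>x. f x * g x)"
proof -
  let ?P = "\<lambda>h. \<exists>f g. smooth f \<and> smooth g \<and> h = (\<lambda>x. f x * g x)"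
  show ?thesis
  proof (rule smooth_if_sums_of[where P="?P"])
    fix h x assume "?P h"
    then obtain f g where "smooth f" "smooth g" "h = (\<lambda>x. f x * g x)" by blast
    then show "h differentiable (at x)"
      by (metis differentiable_mult smooth_imp_differentiable)
  next
    fix h i assume "?P h"
    then obtain f g where fg: "smooth f" "smooth g" "h = (\<lambda>x. f x * g x)" by blast
    then have "pd i h = (\<lambda>x. f x * pd i g x + pd i f x * g x)"
      using pd_mult[OF smooth_imp_differentiable smooth_imp_differentiable] by (intro ext) simp
    moreover have "sums_of ?P (\<lambda>x. f x * pd i g x + pd i f x * g x)"
      using fg smooth_pd by (intro sums_of.add; intro sums_of.base) blast+
    ultimately show "sums_of ?P (pd i h)" by simp
  qed (use assms in \<open>blast intro: sums_of.base\<close>)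
qed

lemma smooth_diff: "smooth f \<Longrightarrow> smooth g \<Longrightarrow> smooth (\<lambda>x. f x - g x)"
  using smooth_add[of f "\<lambda>x. -1 * g x"] smooth_mult[OF smooth_const, of g "-1"] by simp

lemma smooth_sum: "(\<And>i. i \<in> I \<Longrightarrow> smooth (f i)) \<Longrightarrow> smooth (\<lambda>x. \<Sum>i\<in>I. f i x)"
  by (induction I rule: infinite_finite_induct) (auto intro: smooth_const smooth_add)

lemma smooth_prod: "(\<And>i. i \<in> I \<Longrightarrow> smooth (f i)) \<Longrightarrow> smooth (\<lambda>x. \<Prod>i\<in>I. f i x)"
  by (induction I rule: infinite_finite_induct) (auto intro: smooth_const smooth_mult)

lemma smooth_component: "smooth (\<lambda>x. x $ i)"
  by (intro smooth_linear bounded_linear_vec_nth)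

text \<open>The recursion covers both the powers of the reciprocal and the functions
  \<open>t \<mapsto> exp (-1/t) / t ^ k\<close>.\<close>
lemma smooth_compose_recursive:
  fixes \<phi> :: "nat \<Rightarrow> real \<Rightarrow> real"
  assumes f: "smooth f"
    and \<phi>: "\<And>k x. (\<phi> k has_real_derivative c k * \<phi> (k+1) (f x) + d k * \<phi> (k+2) (f x)) (at (f x))"
  shows "smooth (\<lambda>x. \<phi> k (f x))"
proof -
  let ?P = "\<lambda>h. \<exists>a k. smooth a \<and> h = (\<lambda>x. a x * \<phi> k (f x))"
  have comp: "((\<lambda>x. \<phi> k (f x)) has_derivative
     (\<lambda>h. (c k * \<phi> (k+1) (f x) + d k * \<phi> (k+2) (f x)) * frechet_derivative f (at x) h)) (at x)" for k x
    using has_derivative_compose[OF smooth_has_derivative[OF f]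
        \<phi>[of k x, unfolded has_field_derivative_def]] by simp
  have dc: "(\<lambda>x. \<phi> k (f x)) differentiable (at x)" for k x
    using comp differentiable_def by blast
  have "smooth (\<lambda>x. 1 * \<phi> k (f x))"
  proof (rule smooth_if_sums_of[where P="?P"])
    fix h x assume "?P h"
    then obtain a k where "smooth a" "h = (\<lambda>x. a x * \<phi> k (f x))" by blast
    then show "h differentiable (at x)"
      using differentiable_mult[OF smooth_imp_differentiable dc] by simp
  next
    fix h i assume "?P h"
    then obtain a k where a: "smooth a" "h = (\<lambda>x. a x * \<phi> k (f x))" by blast
    have "pd i h = (\<lambda>x. pd i a x * \<phi> k (f x) +
      (a x * (c k * pd i f x) * \<phi> (k+1) (f x) + a x * (d k * pd i f x) * \<phi> (k+2) (f x)))"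
    proof
      fix x
      have "pd i h x = a x * pd i (\<lambda>x. \<phi> k (f x)) x + pd i a x * \<phi> k (f x)"
        unfolding a using a by (intro pd_mult dc smooth_imp_differentiable)
      also have "pd i (\<lambda>x. \<phi> k (f x)) x = (c k * \<phi> (k+1) (f x) + d k * \<phi> (k+2) (f x)) * pd i f x"
        using pd_eqI[OF comp, where i=i] by (simp add: pd_def)
      finally show "pd i h x = pd i a x * \<phi> k (f x) +
       (a x * (c k * pd i f x) * \<phi> (k+1) (f x) + a x * (d k * pd i f x) * \<phi> (k+2) (f x))"
        by (simp add: algebra_simps)
    qed
    moreover have "sums_of ?P (\<lambda>x. pd i a x * \<phi> k (f x) +
      (a x * (c k * pd i f x) * \<phi> (k+1) (f x) + a x * (d k * pd i f x) * \<phi> (k+2) (f x)))"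
    proof (intro sums_of.add; intro sums_of.base)
      have "smooth (pd i a)" "smooth (\<lambda>x. a x * (c k * pd i f x))" "smooth (\<lambda>x. a x * (d k * pd i f x))"
        using a f by (auto intro!: smooth_mult smooth_const smooth_pd)
      then show "?P (\<lambda>x. pd i a x * \<phi> k (f x))"
        "?P (\<lambda>x. a x * (c k * pd i f x) * \<phi> (k+1) (f x))"
        "?P (\<lambda>x. a x * (d k * pd i f x) * \<phi> (k+2) (f x))" by blast+
    qed
    ultimately show "sums_of ?P (pd i h)" by simp
  next
    show "sums_of ?P (\<lambda>x. 1 * \<phi> k (f x))"
      using smooth_const by (intro sums_of.base) blast
  qed
  then show ?thesis by simp
qed

lemma smooth_inverse:
  assumes "smooth f" "\<And>x. f x > 0" shows "smooth (\<lambda>x. inverse (f x))"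
proof -
  have "smooth (\<lambda>x. inverse (f x) ^ (0 + 1))"
  proof (rule smooth_compose_recursive[where \<phi>="\<lambda>k t. inverse t ^ (k + 1)" and k=0 and c="\<lambda>k. - real (k + 1)" and d="\<lambda>k. 0"])
    fix k x
    show "((\<lambda>t. inverse t ^ (k + 1)) has_real_derivative
       - real (k + 1) * inverse (f x) ^ (k + 1 + 1) + 0 * inverse (f x) ^ (k + 2 + 1)) (at (f x))"
      using assms(2)[of x]
      by (auto intro!: derivative_eq_intros simp: field_simps power2_eq_square simp del: power_Suc)
         (auto simp: field_simps)
  qed fact
  then show ?thesis by simp
qed

section \<open>Flat functions and smooth cutoffs\<close>

definition flat_exp :: "nat \<Rightarrow> real \<Rightarrow> real" where
  "flat_exp k t = (if t > 0 then exp (- (1 / t)) / t ^ k else 0)"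

text \<open>For t > 0 the single term of index k + 2 of the exponential series bounds
  \<open>exp (1 / t)\<close> from below. Of the two powers of t gained, one is used up by the
  difference quotient at 0 and the other still tends to 0.\<close>

lemma flat_exp_le: "\<bar>flat_exp k t\<bar> \<le> fact (k + 2) * t\<^sup>2"
proof (cases "t > 0")
  case True
  have "(1 / t) ^ (k + 2) / fact (k + 2) \<le> (\<Sum>n. inverse (fact n) * (1 / t) ^ n)"
    using True sum_le_suminf[OF summable_exp, of "{k + 2}" "1 / t"]
    by (simp add: divide_inverse_commute)
  also have "\<dots> = exp (1 / t)"
    by (simp add: exp_def)
  finally have "(1 / t) ^ (k + 2) \<le> exp (1 / t) * fact (k + 2)"
    by (subst (asm) pos_divide_le_eq) auto
  then have "inverse (exp (1 / t)) * (1 / t) ^ (k + 2) \<le> inverse (exp (1 / t)) * (exp (1 / t) * fact (k + 2))"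
    by (intro mult_left_mono) auto
  then have "inverse (exp (1 / t)) * (1 / t) ^ (k + 2) \<le> fact (k + 2)"
    by (simp only: mult.assoc[symmetric] left_inverse[OF exp_not_eq_zero] mult_1)
  then have "(inverse (exp (1 / t)) * (1 / t) ^ (k + 2)) * t\<^sup>2 \<le> fact (k + 2) * t\<^sup>2"
    by (rule mult_right_mono) simp
  moreover have "(inverse (exp (1 / t)) * (1 / t) ^ (k + 2)) * t\<^sup>2 = flat_exp k t"
    using True by (simp add: flat_exp_def exp_minus power_add power2_eq_square power_one_over divide_simps)
  moreover have "flat_exp k t \<ge> 0" by (simp add: flat_exp_def)
  ultimately show ?thesis by linarith
qed (simp add: flat_exp_def)

lemma flat_exp_derivative:
  "(flat_exp k has_real_derivative - real k * flat_exp (k + 1) t + 1 * flat_exp (k + 2) t) (at t)"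
proof (cases t "0::real" rule: linorder_cases)
  case less
  have "((\<lambda>t. 0) has_real_derivative 0) (at t)" by simp
  then have "(flat_exp k has_real_derivative 0) (at t)"
    by (rule DERIV_cong_ev[THEN iffD1, rotated -1])
       (use eventually_nhds_in_open[of "{..<0}" t] less in \<open>auto simp: flat_exp_def elim!: eventually_mono\<close>)
  then show ?thesis using less by (simp add: flat_exp_def)
next
  case equal
  have "((\<lambda>h. flat_exp k h / h) \<longlongrightarrow> 0) (at 0)"
  proof (rule Lim_null_comparison)
    show "\<forall>\<^sub>F h in at 0. norm (flat_exp k h / h) \<le> fact (k + 2) * \<bar>h\<bar>"
      using flat_exp_le[of k]
      by (auto intro!: eventuallyI simp: eventually_at_filter divide_le_eq power2_eq_square abs_mult
            mult.assoc)
    have "((\<lambda>h::real. fact (k + 2) * \<bar>h\<bar>) \<longlongrightarrow> fact (k + 2) * \<bar>0\<bar>) (at 0)"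
      by (intro tendsto_intros)
    then show "((\<lambda>h::real. fact (k + 2) * \<bar>h\<bar>) \<longlongrightarrow> 0) (at 0)" by simp
  qed
  then show ?thesis using equal by (simp add: DERIV_def flat_exp_def)
next
  case greater
  have "((\<lambda>t. exp (- (1 / t)) / t ^ k) has_real_derivative
      - real k * (exp (- (1 / t)) / t ^ (k + 1)) + 1 * (exp (- (1 / t)) / t ^ (k + 2))) (at t)"
  proof -
    have "real k * t ^ (k - 1) * t = real k * t ^ k" by (cases k) auto
    then show ?thesis using greater
      by (auto intro!: derivative_eq_intros simp: field_simps power2_eq_square power_add)
  qed
  then have "(flat_exp k has_real_derivative
      - real k * (exp (- (1 / t)) / t ^ (k + 1)) + 1 * (exp (- (1 / t)) / t ^ (k + 2))) (at t)"
    by (rule DERIV_cong_ev[THEN iffD1, rotated -1])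
       (use eventually_nhds_in_open[of "{0<..}" t] greater in \<open>auto simp: flat_exp_def elim!: eventually_mono\<close>)
  then show ?thesis using greater by (simp add: flat_exp_def)
qed

lemma smooth_flat_exp: "smooth f \<Longrightarrow> smooth (\<lambda>x. flat_exp k (f x))"
  by (rule smooth_compose_recursive[where c="\<lambda>k. - real k" and d="\<lambda>k. 1"])
     (auto intro: flat_exp_derivative[simplified])

lemma C0infI: "smooth f \<Longrightarrow> compact K \<Longrightarrow> K \<subseteq> V \<Longrightarrow> {x. f x \<noteq> 0} \<subseteq> K \<Longrightarrow> f \<in> C0inf V"
  unfolding C0inf_def supp_def
  by (metis (no_types, lifting) bounded_subset closure_minimal compact_eq_bounded_closed closed_closure
      mem_Collect_eq subset_trans)

lemma C0inf_smooth: "f \<in> C0inf V \<Longrightarrow> smooth f"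
  by (simp add: C0inf_def)

lemma supp_superset: "f x \<noteq> 0 \<Longrightarrow> x \<in> supp f"
  using closure_subset[of "{x. f x \<noteq> 0}"] by (auto simp: supp_def)

lemma C0inf_mult_right: "f \<in> C0inf V \<Longrightarrow> smooth g \<Longrightarrow> (\<lambda>x. f x * g x) \<in> C0inf V"
  by (rule C0infI[where K="supp f"]) (auto simp: smooth_mult C0inf_def supp_superset)

lemma C0inf_mult_left: "f \<in> C0inf V \<Longrightarrow> smooth g \<Longrightarrow> (\<lambda>x. g x * f x) \<in> C0inf V"
  using C0inf_mult_right[of f V g] by (simp add: mult.commute)

lemma C0inf_mono: "V \<subseteq> W \<Longrightarrow> C0inf V \<subseteq> C0inf W"
  by (auto simp: C0inf_def)

text \<open>With q the squared distance to a, A is positive where q < 4 r^2 and B where q > r^2.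
  These regions cover the space, so A + B is positive everywhere and A / (A + B) is smooth.\<close>

lemma smooth_plateau:
  fixes a :: "real^'n::finite"
  assumes "r > 0"
  obtains f where "smooth f" "\<And>x. 0 \<le> f x" "\<And>x. f x \<le> 1"
    "\<And>x. dist a x \<le> r \<Longrightarrow> f x = 1" "\<And>x. dist a x \<ge> 2 * r \<Longrightarrow> f x = 0"
proof -
  define q where "q = (\<lambda>x. \<Sum>i\<in>UNIV. (x $ i - a $ i) * (x $ i - a $ i))"
  have q: "q x = (dist a x)\<^sup>2" for x
    unfolding dist_norm power2_norm_eq_inner inner_vec_def q_def by (auto intro!: sum.cong simp: algebra_simps)
  define A where "A = (\<lambda>x. flat_exp 0 (4 * r\<^sup>2 - q x))"
  define B where "B = (\<lambda>x. flat_exp 0 (q x - r\<^sup>2))"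
  have "smooth q" unfolding q_def
    by (intro smooth_sum smooth_mult smooth_diff smooth_component smooth_const)
  then have s: "smooth A" "smooth B" unfolding A_def B_def
    by (auto intro!: smooth_flat_exp smooth_diff smooth_const)
  have pos: "A x \<ge> 0" "B x \<ge> 0" for x by (auto simp: A_def B_def flat_exp_def)
  have "A x > 0" if "q x < 4 * r\<^sup>2" for x using that by (auto simp: A_def flat_exp_def)
  moreover have "B x > 0" if "q x \<ge> 4 * r\<^sup>2" for x
  proof -
    have "r\<^sup>2 > 0" using assms by simp
    then have "q x > r\<^sup>2" using that by linarith
    then show ?thesis by (simp add: B_def flat_exp_def)
  qed
  ultimately have AB: "A x + B x > 0" for x
    using pos[of x] by (meson add_nonneg_pos add_pos_nonneg not_le)
  show thesis
  proof
    show "smooth (\<lambda>x. A x * inverse (A x + B x))"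
      using s AB by (intro smooth_mult smooth_inverse smooth_add)
    show "0 \<le> A x * inverse (A x + B x)" "A x * inverse (A x + B x) \<le> 1" for x
      using pos[of x] AB[of x] by (auto simp: field_simps)
    show "A x * inverse (A x + B x) = 1" if "dist a x \<le> r" for x
    proof -
      have "q x \<le> r\<^sup>2" unfolding q using that by (intro power_mono) auto
      then have "B x = 0" by (auto simp: B_def flat_exp_def)
      then show ?thesis using AB[of x] by simp
    qed
    show "A x * inverse (A x + B x) = 0" if "dist a x \<ge> 2 * r" for x
    proof -
      have "q x \<ge> (2 * r)\<^sup>2" unfolding q using that assms by (intro power_mono) auto
      then show ?thesis by (auto simp: A_def flat_exp_def)
    qed
  qed
qed

text \<open>A finite cover by balls suffices: one minus the product of the factors
  \<open>1 - f a\<close> is 1 as soon as one plateau function is 1, is 0 where all of them vanish,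
  and stays in [0, 1] without normalisation.\<close>

lemma smooth_cutoff:
  fixes K :: "(real^'n::finite) set"
  assumes "compact K" "open V" "K \<subseteq> V"
  obtains w N where "w \<in> C0inf V" "open N" "K \<subseteq> N" "\<And>x. x \<in> N \<Longrightarrow> w x = 1"
    "\<And>x. 0 \<le> w x" "\<And>x. w x \<le> 1"
proof -
  have "\<exists>r>0. cball a (2 * r) \<subseteq> V" if aK: "a \<in> K" for a
  proof -
    obtain e where "e > 0" "cball a e \<subseteq> V" using assms aK open_contains_cball by blast
    then show ?thesis by (intro exI[of _ "e / 2"]) auto
  qed
  then have "\<forall>a\<in>K. \<exists>r. r > 0 \<and> cball a (2 * r) \<subseteq> V" by blast
  from bchoice[OF this] obtain r where
    r: "\<And>a. a \<in> K \<Longrightarrow> r a > 0" "\<And>a. a \<in> K \<Longrightarrow> cball a (2 * r a) \<subseteq> V"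
    by blast
  have "\<forall>a\<in>K. \<exists>f. smooth f \<and> (\<forall>x. 0 \<le> f x \<and> f x \<le> 1 \<and> (dist a x \<le> r a \<longrightarrow> f x = 1) \<and>
      (dist a x \<ge> 2 * r a \<longrightarrow> f x = 0))"
  proof
    fix a assume "a \<in> K"
    obtain f where "smooth f" "\<And>x. 0 \<le> f x" "\<And>x. f x \<le> 1"
      "\<And>x. dist a x \<le> r a \<Longrightarrow> f x = 1" "\<And>x. dist a x \<ge> 2 * r a \<Longrightarrow> f x = 0"
      by (rule smooth_plateau[OF r(1)[OF \<open>a \<in> K\<close>], of a]) (rule that)
    then show "\<exists>f. smooth f \<and> (\<forall>x. 0 \<le> f x \<and> f x \<le> 1 \<and>
      (dist a x \<le> r a \<longrightarrow> f x = 1) \<and> (dist a x \<ge> 2 * r a \<longrightarrow> f x = 0))"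
      by blast
  qed
  then obtain f where f: "\<And>a. a \<in> K \<Longrightarrow> smooth (f a)" "\<And>a x. a \<in> K \<Longrightarrow> 0 \<le> f a x \<and> f a x \<le> 1"
    "\<And>a x. a \<in> K \<Longrightarrow> dist a x \<le> r a \<Longrightarrow> f a x = 1"
    "\<And>a x. a \<in> K \<Longrightarrow> dist a x \<ge> 2 * r a \<Longrightarrow> f a x = 0"
    by metis
  have "K \<subseteq> (\<Union>a\<in>K. ball a (r a))" using r by force
  then obtain F where F: "F \<subseteq> K" "finite F" "K \<subseteq> (\<Union>a\<in>F. ball a (r a))"
    using compactE_image[OF assms(1), of K "\<lambda>a. ball a (r a)"] by auto
  define w where "w = (\<lambda>x. 1 - (\<Prod>a\<in>F. 1 - f a x))"
  have Fk: "a \<in> K" if "a \<in> F" for a using that F by auto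
  show thesis
  proof
    have z: "w x = 0" if "x \<notin> (\<Union>a\<in>F. cball a (2 * r a))" for x
    proof -
      have "(\<Prod>a\<in>F. 1 - f a x) = (\<Prod>a\<in>F. 1)"
        using that by (intro prod.cong) (auto intro!: f(4) Fk)
      then show ?thesis by (simp add: w_def)
    qed
    show "w \<in> C0inf V"
    proof (rule C0infI[where K="\<Union>a\<in>F. cball a (2 * r a)"])
      show "smooth w" unfolding w_def
        by (intro smooth_diff smooth_prod smooth_const f Fk)
      show "(\<Union>a\<in>F. cball a (2 * r a)) \<subseteq> V" using r Fk by blast
      show "{x. w x \<noteq> 0} \<subseteq> (\<Union>a\<in>F. cball a (2 * r a))" using z by blast
    qed (use F in auto)
    show "open (\<Union>a\<in>F. ball a (r a))" by auto
    show "K \<subseteq> (\<Union>a\<in>F. ball a (r a))" by fact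
    show "w x = 1" if x: "x \<in> (\<Union>a\<in>F. ball a (r a))" for x
    proof -
      obtain a where "a \<in> F" "dist a x < r a" using x by auto
      then have "(\<Prod>a\<in>F. 1 - f a x) = 0" using F f(3)[of a x] by (auto intro!: prod_zero Fk)
      then show ?thesis by (simp add: w_def)
    qed
    have "0 \<le> (\<Prod>a\<in>F. 1 - f a x)" "(\<Prod>a\<in>F. 1 - f a x) \<le> 1" for x
      using f(2)[OF Fk, of _ x] by (auto intro!: prod_nonneg prod_le_1)
    then show "0 \<le> w x" "w x \<le> 1" for x by (auto simp: w_def)
  qed
qed

section \<open>Vague convergence away from the diagonal\<close>

lemma radon_on_integrable:
  fixes F :: "'a::t2_space \<Rightarrow> real"
  assumes "radon_on M S" "F \<in> borel_measurable borel" "\<And>z. \<bar>F z\<bar> \<le> C"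
    "compact K" "K \<subseteq> S" "{z. F z \<noteq> 0} \<subseteq> K"
  shows "integrable M F"
proof (rule integrableI_bounded_set[where A=K and B=C])
  have s: "sets M = sets borel" using assms by (simp add: radon_on_def)
  show "K \<in> sets M" using s borel_closed[OF compact_imp_closed[OF assms(4)]] by simp
  show "F \<in> borel_measurable M" using s assms measurable_cong_sets by blast
  show "emeasure M K < \<infinity>" using assms by (auto simp: radon_on_def)
qed (use assms in auto)

lemma radon_on_integrable_continuous:
  fixes F :: "'a::t2_space \<Rightarrow> real"
  assumes "radon_on M S" "continuous_on UNIV F" "compact K" "K \<subseteq> S" "{z. F z \<noteq> 0} \<subseteq> K"
  shows "integrable M F"
proof -
  have "bounded (F ` K)"
    using assms by (intro compact_imp_bounded compact_continuous_image) (auto intro: continuous_on_subset)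
  then obtain C where C: "\<And>z. z \<in> K \<Longrightarrow> \<bar>F z\<bar> \<le> C" "C > 0"
    by (auto simp: bounded_pos)
  then have "\<bar>F z\<bar> \<le> C" for z using assms(5) by (cases "F z = 0") auto
  then show ?thesis
    using assms by (intro radon_on_integrable[where C=C]) (auto intro: borel_measurable_continuous_onI)
qed

section \<open>The span of tensor products with disjoint supports\<close>

definition disjoint_tensor :: "(real^'n::finite) set \<Rightarrow> ((real^'n) \<times> (real^'n) \<Rightarrow> real) \<Rightarrow> bool" where
  "disjoint_tensor U F \<longleftrightarrow> (\<exists>f\<in>C0inf U. \<exists>g\<in>C0inf U. supp f \<inter> supp g = {} \<and>
     F = (\<lambda>z. f (fst z) * g (snd z)))"

lemma disjoint_tensorI:
  "f \<in> C0inf U \<Longrightarrow> g \<in> C0inf U \<Longrightarrow> supp f \<inter> supp g = {} \<Longrightarrow>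
    disjoint_tensor U (\<lambda>z. f (fst z) * g (snd z))"
  by (auto simp: disjoint_tensor_def)

lemma disjoint_tensor_zero: "disjoint_tensor U (\<lambda>z. 0)"
proof -
  have "(\<lambda>x. 0) \<in> C0inf U" by (rule C0infI[where K="{}"]) (auto simp: smooth_const)
  moreover have "supp (\<lambda>x. 0) = {}" by (simp add: supp_def)
  ultimately show ?thesis using disjoint_tensorI[of "\<lambda>x. 0" U "\<lambda>x. 0"] by simp
qed

lemma continuous_on_tensor:
  "smooth f \<Longrightarrow> smooth g \<Longrightarrow> continuous_on A (\<lambda>z. f (fst z) * g (snd z))"
  by (intro continuous_on_mult continuous_on_compose2[OF smooth_imp_continuous_on[of _ UNIV]]
      continuous_intros) auto

lemma sums_of_tensor_continuous:
  "sums_of (disjoint_tensor U) F \<Longrightarrow> continuous_on UNIV F"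
  by (induction rule: sums_of.induct)
     (auto simp: disjoint_tensor_def C0inf_def intro!: continuous_on_add continuous_on_tensor)

lemma sums_of_tensor_support:
  assumes "sums_of (disjoint_tensor U) F"
  shows "\<exists>K. compact K \<and> K \<subseteq> U \<times> U - {(x, y). x = y} \<and> {z. F z \<noteq> 0} \<subseteq> K"
  using assms
proof (induction)
  case (base F)
  then obtain f g where fg: "f \<in> C0inf U" "g \<in> C0inf U" "supp f \<inter> supp g = {}"
    "F = (\<lambda>z. f (fst z) * g (snd z))"
    by (auto simp: disjoint_tensor_def)
  then show ?case
    by (intro exI[of _ "supp f \<times> supp g"])
       (auto simp: C0inf_def intro!: compact_Times supp_superset)
next
  case (add F G)
  then obtain K L where "compact K" "K \<subseteq> U \<times> U - {(x, y). x = y}" "{z. F z \<noteq> 0} \<subseteq> K"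
    "compact L" "L \<subseteq> U \<times> U - {(x, y). x = y}" "{z. G z \<noteq> 0} \<subseteq> L"
    by blast
  then show ?case by (intro exI[of _ "K \<union> L"]) fastforce
qed

lemma sums_of_tensor_sum:
  assumes "finite I" "\<And>i. i \<in> I \<Longrightarrow> sums_of (disjoint_tensor U) (F i)"
  shows "sums_of (disjoint_tensor U) (\<lambda>z. \<Sum>i\<in>I. F i z)"
  using assms by (induction I) (auto intro: sums_of.intros disjoint_tensor_zero)

lemma supp_mult_subset: "supp (\<lambda>x. a x * f x) \<subseteq> supp f"
  unfolding supp_def by (intro closure_mono) auto

text \<open>A linear function on the product space splits into a function of x plus a function of y.
  Each summand is absorbed by one factor of the tensor, and this does not enlarge the support of
  that factor.\<close>

lemma sums_of_tensor_linear:
  fixes F :: "(real^'n::finite) \<times> (real^'n) \<Rightarrow> real"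
  assumes "bounded_linear p" "sums_of (disjoint_tensor U) F"
  shows "sums_of (disjoint_tensor U) (\<lambda>z. p z * F z)"
  using assms(2)
proof (induction)
  case (base F)
  then obtain f g where fg: "f \<in> C0inf U" "g \<in> C0inf U" "supp f \<inter> supp g = {}"
    "F = (\<lambda>z. f (fst z) * g (snd z))"
    by (auto simp: disjoint_tensor_def)
  define a where "a = (\<lambda>x. p (x, 0))"
  define b where "b = (\<lambda>y. p (0, y))"
  have "bounded_linear (\<lambda>x::real^'n. (x, 0::real^'n))" "bounded_linear (\<lambda>y::real^'n. (0::real^'n, y))"
    by (auto intro!: bounded_linear_Pair bounded_linear_ident bounded_linear_zero)
  then have "smooth a" "smooth b" unfolding a_def b_def
    using bounded_linear_compose[OF assms(1)] by (auto intro!: smooth_linear)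
  then have ab: "(\<lambda>x. a x * f x) \<in> C0inf U" "(\<lambda>y. b y * g y) \<in> C0inf U"
    using fg by (auto intro: C0inf_mult_left)
  have split: "p z = a (fst z) + b (snd z)" for z
    using linear_add[OF bounded_linear.linear[OF assms(1)], of "(fst z, 0)" "(0, snd z)"] by (simp add: a_def b_def)
  have "(\<lambda>z. p z * F z) = (\<lambda>z. a (fst z) * f (fst z) * g (snd z) + f (fst z) * (b (snd z) * g (snd z)))"
    by (auto simp: fg split algebra_simps)
  moreover have "supp (\<lambda>x. a x * f x) \<inter> supp g = {}" "supp f \<inter> supp (\<lambda>y. b y * g y) = {}"
    using fg(3) supp_mult_subset[of a f] supp_mult_subset[of b g] by blast+
  moreover have "disjoint_tensor U (\<lambda>z. a (fst z) * f (fst z) * g (snd z))"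
    using disjoint_tensorI[OF ab(1) fg(2)] calculation by simp
  moreover have "disjoint_tensor U (\<lambda>z. f (fst z) * (b (snd z) * g (snd z)))"
    using disjoint_tensorI[OF fg(1) ab(2)] calculation by simp
  ultimately show ?case
    by (simp only:) (intro sums_of.add sums_of.base)
next
  case (add F G)
  then show ?case using sums_of.add by (simp add: distrib_left)
qed

lemma sums_of_tensor_cmult:
  assumes "sums_of (disjoint_tensor U) F"
  shows "sums_of (disjoint_tensor U) (\<lambda>z. c * F z)"
  using assms
proof (induction)
  case (base F)
  then obtain f g where fg: "f \<in> C0inf U" "g \<in> C0inf U" "supp f \<inter> supp g = {}"
    "F = (\<lambda>z. f (fst z) * g (snd z))"
    by (auto simp: disjoint_tensor_def)
  have "(\<lambda>x. c * f x) \<in> C0inf U" using fg by (intro C0inf_mult_left smooth_const)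
  moreover have "supp (\<lambda>x. c * f x) \<inter> supp g = {}" using fg supp_mult_subset[of "\<lambda>x. c" f] by blast
  ultimately have "disjoint_tensor U (\<lambda>z. c * f (fst z) * g (snd z))"
    using disjoint_tensorI[of "\<lambda>x. c * f x" U g] fg by simp
  from sums_of.base[of "disjoint_tensor U", OF this] show ?case
    by (simp add: fg mult.assoc)
next
  case (add F G)
  then show ?case using sums_of.add by (simp add: distrib_left)
qed

text \<open>The span is a module over the polynomials in both variables. Stone--Weierstrass can thus
  be applied to a multiplier, while the tensors keep the support compact and off the
  diagonal.\<close>

lemma sums_of_tensor_polynomial:
  fixes F :: "(real^'n::finite) \<times> (real^'n) \<Rightarrow> real"
  assumes "real_polynomial_function p" "sums_of (disjoint_tensor U) F"
  shows "sums_of (disjoint_tensor U) (\<lambda>z. p z * F z)"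
  using assms
proof (induction arbitrary: F)
  case (add f g)
  from sums_of.add[OF add.IH(1)[OF add.prems] add.IH(2)[OF add.prems]] show ?case
    by (simp add: distrib_right)
next
  case (mult f g)
  then show ?case by (simp add: mult.assoc)
qed (auto intro: sums_of_tensor_linear sums_of_tensor_cmult)

text \<open>The coordinates of a point off the diagonal have disjoint neighbourhoods, so near this
  point some tensor is 1; finitely many such tensors cover K. Their sum is only bounded below on K,
  which is enough for dividing by it.\<close>

lemma sums_of_tensor_cover:
  fixes K :: "((real^'n::finite) \<times> (real^'n)) set"
  assumes "open U" "compact K" "K \<subseteq> U \<times> U - {(x, y). x = y}"
  obtains \<Phi> where "sums_of (disjoint_tensor U) \<Phi>" "\<And>z. \<Phi> z \<ge> 0" "\<And>z. z \<in> K \<Longrightarrow> \<Phi> z \<ge> 1"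
proof -
  have "\<forall>c\<in>K. \<exists>FN. disjoint_tensor U (fst FN) \<and> (\<forall>z. fst FN z \<ge> 0) \<and> open (snd FN) \<and> c \<in> snd FN
      \<and> (\<forall>z\<in>snd FN. fst FN z = 1)"
  proof
    fix c assume c: "c \<in> K"
    obtain a b where ab: "c = (a, b)" by force
    have U: "a \<in> U" "b \<in> U" "a \<noteq> b" using c ab assms by auto
    \<comment> \<open>Two balls whose radius is a third of the distance of their centres are
      disjoint.\<close>
    define r where "r = dist a b / 3"
    have r: "r > 0" using U by (simp add: r_def)
    obtain f N where f: "f \<in> C0inf (U \<inter> ball a r)" "open N" "{a} \<subseteq> N" "\<And>x. x \<in> N \<Longrightarrow> f x = 1" "\<And>x. 0 \<le> f x"
      by (rule smooth_cutoff[of "{a}" "U \<inter> ball a r"]) (use U r assms in auto)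
    obtain g M where g: "g \<in> C0inf (U \<inter> ball b r)" "open M" "{b} \<subseteq> M" "\<And>x. x \<in> M \<Longrightarrow> g x = 1" "\<And>x. 0 \<le> g x"
      by (rule smooth_cutoff[of "{b}" "U \<inter> ball b r"]) (use U r assms in auto)
    have "supp f \<subseteq> ball a r" "supp g \<subseteq> ball b r" using f g by (auto simp: C0inf_def)
    moreover have "ball a r \<inter> ball b r = {}"
    proof -
      have False if "dist a x < r" "dist b x < r" for x
        using that dist_triangle2[of a b x] r unfolding r_def by linarith
      then show ?thesis by auto
    qed
    ultimately have "supp f \<inter> supp g = {}" by blast
    moreover have "f \<in> C0inf U" "g \<in> C0inf U" using f g by (auto simp: C0inf_def)
    ultimately have "disjoint_tensor U (\<lambda>z. f (fst z) * g (snd z))" by (intro disjoint_tensorI)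
    then show "\<exists>FN. disjoint_tensor U (fst FN) \<and> (\<forall>z. fst FN z \<ge> 0) \<and> open (snd FN) \<and> c \<in> snd FN
      \<and> (\<forall>z\<in>snd FN. fst FN z = 1)"
      using f g ab by (intro exI[of _ "(\<lambda>z. f (fst z) * g (snd z), N \<times> M)"]) (auto intro: open_Times)
  qed
  from bchoice[OF this] obtain h where h: "\<And>c. c \<in> K \<Longrightarrow> disjoint_tensor U (fst (h c))"
    "\<And>c z. c \<in> K \<Longrightarrow> fst (h c) z \<ge> 0" "\<And>c. c \<in> K \<Longrightarrow> open (snd (h c))" "\<And>c. c \<in> K \<Longrightarrow> c \<in> snd (h c)"
    "\<And>c z. c \<in> K \<Longrightarrow> z \<in> snd (h c) \<Longrightarrow> fst (h c) z = 1" by blast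
  have "K \<subseteq> (\<Union>c\<in>K. snd (h c))" using h by blast
  then obtain C where C: "C \<subseteq> K" "finite C" "K \<subseteq> (\<Union>c\<in>C. snd (h c))"
    using compactE_image[OF assms(2), of K "\<lambda>c. snd (h c)"] h(3) by metis
  show thesis
  proof (rule that)
    show "sums_of (disjoint_tensor U) (\<lambda>z. \<Sum>c\<in>C. fst (h c) z)"
      using C by (intro sums_of_tensor_sum sums_of.base h) blast+
    show "(\<Sum>c\<in>C. fst (h c) z) \<ge> 0" for z using C by (intro sum_nonneg h) blast
    show "(\<Sum>c\<in>C. fst (h c) z) \<ge> 1" if z: "z \<in> K" for z
    proof -
      obtain c where c: "c \<in> C" "z \<in> snd (h c)" using C z by blast
      then have "1 = fst (h c) z" using h(5)[of c z] C by force
      also have "\<dots> \<le> (\<Sum>c\<in>C. fst (h c) z)" using C c by (intro member_le_sum h) blast+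
      finally show ?thesis .
    qed
  qed
qed

text \<open>\<open>e\<close> is tied to the kernels by \<open>form_limit\<close> and to
  \<open>J\<close> by \<open>form_disjoint\<close>. It will be \<open>E\<close> with
  \<open>J\<close>, and \<open>E\<close> with exchanged arguments together with the image of
  \<open>J\<close> under \<open>prod.swap\<close>.\<close>

locale approximating_kernels =
  fixes U :: "(real^'n::finite) set" and m :: "(real^'n) measure"
    and \<sigma> :: "real \<Rightarrow> ((real^'n) \<times> (real^'n)) measure" and J :: "((real^'n) \<times> (real^'n)) measure"
    and e :: "(real^'n \<Rightarrow> real) \<Rightarrow> (real^'n \<Rightarrow> real) \<Rightarrow> real"
  assumes U_open: "open U"
    and \<sigma>_radon: "\<And>\<beta>. \<beta> > 0 \<Longrightarrow> radon_on (\<sigma> \<beta>) (U \<times> U)"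
    and J_radon: "radon_on J (U \<times> U - {(x, y). x = y})"
    and form_limit: "\<And>f g. f \<in> C0inf U \<Longrightarrow> g \<in> C0inf U \<Longrightarrow>
      ((\<lambda>\<beta>. \<beta> * (ip m f g - (\<integral>z. f (fst z) * g (snd z) \<partial>\<sigma> \<beta>))) \<longlongrightarrow> e f g) at_top"
    and form_disjoint: "\<And>f g. f \<in> C0inf U \<Longrightarrow> g \<in> C0inf U \<Longrightarrow> supp f \<inter> supp g = {} \<Longrightarrow>
      e f g = - 2 * (\<integral>z. f (fst z) * g (snd z) \<partial>J)"
begin

text \<open>Integrability is part of the notion because the Bochner integral of a non-integrable
  function is 0, which would spoil additivity. The factor 2 is the one in
  \<open>form_disjoint\<close>.\<close>

definition vconv :: "((real^'n) \<times> (real^'n) \<Rightarrow> real) \<Rightarrow> bool" where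
  "vconv F \<longleftrightarrow> (\<forall>\<beta>>0. integrable (\<sigma> \<beta>) F) \<and> integrable J F \<and>
    ((\<lambda>\<beta>. \<beta> * (\<integral>z. F z \<partial>\<sigma> \<beta>)) \<longlongrightarrow> 2 * (\<integral>z. F z \<partial>J)) at_top"

lemma sets_\<sigma>: "\<beta> > 0 \<Longrightarrow> sets (\<sigma> \<beta>) = sets borel" and sets_J: "sets J = sets borel"
  using \<sigma>_radon J_radon by (auto simp: radon_on_def)

lemma integrable_\<sigma>_continuous:
  fixes F :: "(real^'n) \<times> (real^'n) \<Rightarrow> real"
  shows "\<beta> > 0 \<Longrightarrow> continuous_on UNIV F \<Longrightarrow> compact K \<Longrightarrow> K \<subseteq> U \<times> U \<Longrightarrow> {z. F z \<noteq> 0} \<subseteq> K \<Longrightarrow> integrable (\<sigma> \<beta>) F"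
  by (rule radon_on_integrable_continuous[OF \<sigma>_radon])

lemma vconv_add:
  assumes "vconv F" "vconv G" shows "vconv (\<lambda>z. F z + G z)"
proof -
  have "((\<lambda>\<beta>. \<beta> * (\<integral>z. F z \<partial>\<sigma> \<beta>) + \<beta> * (\<integral>z. G z \<partial>\<sigma> \<beta>)) \<longlongrightarrow> 2 * (\<integral>z. F z \<partial>J) + 2 * (\<integral>z. G z \<partial>J)) at_top"
    using assms by (intro tendsto_add) (auto simp: vconv_def)
  moreover have "\<forall>\<^sub>F \<beta> in at_top. \<beta> * (\<integral>z. F z \<partial>\<sigma> \<beta>) + \<beta> * (\<integral>z. G z \<partial>\<sigma> \<beta>) = \<beta> * (\<integral>z. F z + G z \<partial>\<sigma> \<beta>)"
    using eventually_gt_at_top[of 0]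
    by eventually_elim (use assms in \<open>auto simp: vconv_def distrib_left\<close>)
  ultimately have "((\<lambda>\<beta>. \<beta> * (\<integral>z. F z + G z \<partial>\<sigma> \<beta>)) \<longlongrightarrow> 2 * (\<integral>z. F z \<partial>J) + 2 * (\<integral>z. G z \<partial>J)) at_top"
    by (rule Lim_transform_eventually)
  then show ?thesis using assms by (auto simp: vconv_def distrib_left)
qed

lemma vconv_cmult:
  assumes "vconv F" shows "vconv (\<lambda>z. c * F z)"
proof -
  have "((\<lambda>\<beta>. c * (\<beta> * (\<integral>z. F z \<partial>\<sigma> \<beta>))) \<longlongrightarrow> c * (2 * (\<integral>z. F z \<partial>J))) at_top"
    using assms by (intro tendsto_mult_left) (simp add: vconv_def)
  then have "((\<lambda>\<beta>. \<beta> * (\<integral>z. c * F z \<partial>\<sigma> \<beta>)) \<longlongrightarrow> 2 * (\<integral>z. c * F z \<partial>J)) at_top"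
    by (simp only: integral_mult_right_zero mult.left_commute)
  then show ?thesis using assms by (simp add: vconv_def)
qed

lemma vconv_tensor:
  assumes "disjoint_tensor U F" shows "vconv F"
proof -
  obtain f g where fg: "f \<in> C0inf U" "g \<in> C0inf U" "supp f \<inter> supp g = {}"
    "F = (\<lambda>z. f (fst z) * g (snd z))"
    using assms by (auto simp: disjoint_tensor_def)
  obtain K where K: "compact K" "K \<subseteq> U \<times> U - {(x, y). x = y}" "{z. F z \<noteq> 0} \<subseteq> K"
    using sums_of_tensor_support[OF sums_of.base, of U F] assms by blast
  have cF: "continuous_on UNIV F" using assms sums_of_tensor_continuous sums_of.base by blast
  have "f x * g x = 0" for x using fg(3) supp_superset[of f x] supp_superset[of g x] by fastforce
  then have "ip m f g = 0" unfolding ip_def by (simp only: integral_zero)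
  then have "((\<lambda>\<beta>. - (\<beta> * (0 - (\<integral>z. F z \<partial>\<sigma> \<beta>)))) \<longlongrightarrow> - (- 2 * (\<integral>z. F z \<partial>J))) at_top"
    using form_limit[OF fg(1,2)] form_disjoint[OF fg(1-3)] fg(4) by (intro tendsto_minus) simp
  moreover have "integrable J F" using K cF by (intro radon_on_integrable_continuous[OF J_radon])
  moreover have "integrable (\<sigma> \<beta>) F" if "\<beta> > 0" for \<beta>
    using K cF that by (intro integrable_\<sigma>_continuous) auto
  ultimately show ?thesis by (simp add: vconv_def)
qed

lemma vconv_sums_of_tensor: "sums_of (disjoint_tensor U) F \<Longrightarrow> vconv F"
  by (induction rule: sums_of.induct) (auto intro: vconv_tensor vconv_add)

text \<open>The error bound D is itself a function with a known limit. A small integral of D against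
  \<open>J\<close> therefore controls the error for all large \<beta>, and no separate bound on the
  kernels, uniform in \<beta>, has to be found.\<close>

lemma vconv_approx:
  assumes F: "F \<in> borel_measurable borel"
    and approx: "\<And>\<epsilon>. \<epsilon> > 0 \<Longrightarrow> \<exists>G D. vconv G \<and> vconv D \<and> (\<forall>z. \<bar>F z - G z\<bar> \<le> D z) \<and> (\<integral>z. D z \<partial>J) \<le> \<epsilon>"
  shows "vconv F"
proof -
  have int: "integrable M F" if "integrable M G" "integrable M D" "\<forall>z. \<bar>F z - G z\<bar> \<le> D z" "sets M = sets borel"
    for M G D
  proof (rule Bochner_Integration.integrable_bound)
    show "integrable M (\<lambda>z. \<bar>G z\<bar> + D z)" using that by auto
    show "F \<in> borel_measurable M" using F that measurable_cong_sets by blast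
    show "AE z in M. norm (F z) \<le> norm (\<bar>G z\<bar> + D z)"
    proof (rule AE_I2)
      fix z have "\<bar>F z - G z\<bar> \<le> D z" using that by blast
      then show "norm (F z) \<le> norm (\<bar>G z\<bar> + D z)" by auto
    qed
  qed
  have le: "\<bar>(\<integral>z. F z \<partial>M) - (\<integral>z. G z \<partial>M)\<bar> \<le> (\<integral>z. D z \<partial>M)"
    if "integrable M G" "integrable M D" "\<forall>z. \<bar>F z - G z\<bar> \<le> D z" "sets M = sets borel" for M G D
  proof -
    have "\<bar>\<integral>z. F z - G z \<partial>M\<bar> \<le> (\<integral>z. D z \<partial>M)"
      using int[OF that] that by (intro integral_abs_bound[THEN order_trans] integral_mono) auto
    then show ?thesis using int[OF that] that by simp
  qed
  obtain G D where GD: "vconv G" "vconv D" "\<forall>z. \<bar>F z - G z\<bar> \<le> D z" using approx[of 1] by auto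
  have "integrable (\<sigma> \<beta>) F" if "\<beta> > 0" for \<beta>
    using int[of "\<sigma> \<beta>" G D] that GD sets_\<sigma> by (auto simp: vconv_def)
  moreover have "integrable J F" using int[of J G D] GD sets_J by (auto simp: vconv_def)
  moreover have "((\<lambda>\<beta>. \<beta> * (\<integral>z. F z \<partial>\<sigma> \<beta>)) \<longlongrightarrow> 2 * (\<integral>z. F z \<partial>J)) at_top"
  proof (rule tendstoI)
    \<comment> \<open>The errors add up to less than \<epsilon>: \<epsilon>/4 for G, then 2
      \<epsilon>/8 + \<epsilon>/4 for D under the scaled kernel, and 2 \<epsilon>/8 for D under
      \<open>J\<close>.\<close>
    fix \<epsilon> :: real assume "\<epsilon> > 0"
    then obtain G D where GD: "vconv G" "vconv D" "\<forall>z. \<bar>F z - G z\<bar> \<le> D z" "(\<integral>z. D z \<partial>J) \<le> \<epsilon> / 8"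
      using approx[of "\<epsilon> / 8"] by auto
    have "\<forall>\<^sub>F \<beta> in at_top. dist (\<beta> * (\<integral>z. G z \<partial>\<sigma> \<beta>)) (2 * (\<integral>z. G z \<partial>J)) < \<epsilon> / 4"
      "\<forall>\<^sub>F \<beta> in at_top. dist (\<beta> * (\<integral>z. D z \<partial>\<sigma> \<beta>)) (2 * (\<integral>z. D z \<partial>J)) < \<epsilon> / 4"
      using GD(1,2)[unfolded vconv_def] \<open>\<epsilon> > 0\<close> by (intro tendstoD; simp)+
    then show "\<forall>\<^sub>F \<beta> in at_top. dist (\<beta> * (\<integral>z. F z \<partial>\<sigma> \<beta>)) (2 * (\<integral>z. F z \<partial>J)) < \<epsilon>"
      using eventually_gt_at_top[of 0]
    proof eventually_elim
      case (elim \<beta>)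
      have 1: "\<bar>(\<integral>z. F z \<partial>\<sigma> \<beta>) - (\<integral>z. G z \<partial>\<sigma> \<beta>)\<bar> \<le> (\<integral>z. D z \<partial>\<sigma> \<beta>)"
        using GD elim sets_\<sigma> by (intro le) (auto simp: vconv_def)
      have 2: "\<bar>(\<integral>z. F z \<partial>J) - (\<integral>z. G z \<partial>J)\<bar> \<le> (\<integral>z. D z \<partial>J)"
        using GD elim sets_J by (intro le) (auto simp: vconv_def)
      have "\<beta> * \<bar>(\<integral>z. F z \<partial>\<sigma> \<beta>) - (\<integral>z. G z \<partial>\<sigma> \<beta>)\<bar> \<le> \<beta> * (\<integral>z. D z \<partial>\<sigma> \<beta>)"
        using 1 elim by (intro mult_left_mono) auto
      moreover have "\<beta> * \<bar>(\<integral>z. F z \<partial>\<sigma> \<beta>) - (\<integral>z. G z \<partial>\<sigma> \<beta>)\<bar> = \<bar>\<beta> * (\<integral>z. F z \<partial>\<sigma> \<beta>) - \<beta> * (\<integral>z. G z \<partial>\<sigma> \<beta>)\<bar>"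
        using elim by (simp add: abs_mult_pos' flip: right_diff_distrib)
      ultimately show ?case using 2 elim GD(4) unfolding dist_real_def by linarith
    qed
  qed
  ultimately show ?thesis by (simp add: vconv_def)
qed

text \<open>F is written as H times a localiser \<Phi>. A polynomial that approximates H to within
  \<eta> on the compact set L carrying \<Phi> leaves the error \<eta> \<Phi>, which is again in the
  span. An approximation on K alone would say nothing about the part of \<Phi> outside K.\<close>

lemma vconv_continuous:
  assumes F: "continuous_on UNIV F" and K: "compact K" "K \<subseteq> U \<times> U - {(x, y). x = y}" "{z. F z \<noteq> 0} \<subseteq> K"
  shows "vconv F"
proof (rule vconv_approx)
  show "F \<in> borel_measurable borel" using F by (rule borel_measurable_continuous_onI)
  fix \<epsilon> :: real assume "\<epsilon> > 0"
  obtain \<Phi> where \<Phi>: "sums_of (disjoint_tensor U) \<Phi>" "\<And>z. \<Phi> z \<ge> 0" "\<And>z. z \<in> K \<Longrightarrow> \<Phi> z \<ge> 1"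
    using sums_of_tensor_cover[OF U_open K(1,2)] by metis
  obtain L where L: "compact L" "L \<subseteq> U \<times> U - {(x, y). x = y}" "{z. \<Phi> z \<noteq> 0} \<subseteq> L"
    using sums_of_tensor_support[OF \<Phi>(1)] by auto
  \<comment> \<open>The maximum makes H continuous everywhere. On K the denominator equals \<Phi>,
    and off K the function F vanishes, so F = H \<Phi> in either case.\<close>
  define H where "H = (\<lambda>z. F z / max (\<Phi> z) 1)"
  have "continuous_on UNIV H" unfolding H_def
    using F sums_of_tensor_continuous[OF \<Phi>(1)] by (intro continuous_intros) (auto simp: max_def)
  then have "continuous_on L H" by (rule continuous_on_subset) auto
  have FH: "F z = H z * \<Phi> z" for z
  proof (cases "z \<in> K")
    case True
    then have "\<Phi> z \<ge> 1" by (rule \<Phi>)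
    then show ?thesis by (simp add: H_def max_def)
  next
    case False
    then have "F z = 0" using K by auto
    then show ?thesis by (simp add: H_def)
  qed
  define A where "A = (\<integral>z. \<Phi> z \<partial>J)"
  have A: "A \<ge> 0" unfolding A_def using \<Phi> by simp
  define \<eta> where "\<eta> = \<epsilon> / (A + 1)"
  have \<eta>: "\<eta> > 0" "\<eta> * A \<le> \<epsilon>" using A \<open>\<epsilon> > 0\<close> by (auto simp: \<eta>_def field_simps)
  obtain h where h: "real_polynomial_function h" "\<And>z. z \<in> L \<Longrightarrow> \<bar>H z - h z\<bar> < \<eta>"
    using Stone_Weierstrass_real_polynomial_function[OF L(1) \<open>continuous_on L H\<close> \<eta>(1)] by metis
  show "\<exists>G D. vconv G \<and> vconv D \<and> (\<forall>z. \<bar>F z - G z\<bar> \<le> D z) \<and> (\<integral>z. D z \<partial>J) \<le> \<epsilon>"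
  proof (intro exI conjI allI)
    show "vconv (\<lambda>z. h z * \<Phi> z)" by (intro vconv_sums_of_tensor sums_of_tensor_polynomial h \<Phi>)
    show "vconv (\<lambda>z. \<eta> * \<Phi> z)" by (intro vconv_cmult vconv_sums_of_tensor \<Phi>)
    show "\<bar>F z - h z * \<Phi> z\<bar> \<le> \<eta> * \<Phi> z" for z
    proof (cases "z \<in> L")
      case True
      have "\<bar>F z - h z * \<Phi> z\<bar> = \<bar>H z - h z\<bar> * \<Phi> z"
        using \<Phi>(2)[of z] by (simp add: FH abs_mult flip: left_diff_distrib)
      then show ?thesis using h(2)[OF True] \<Phi>(2)[of z] by (simp add: mult_right_mono)
    next
      case False
      then have "\<Phi> z = 0" using L by auto
      then show ?thesis by (simp add: FH)
    qed
    show "(\<integral>z. \<eta> * \<Phi> z \<partial>J) \<le> \<epsilon>" using \<eta> by (simp add: A_def)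
  qed
qed

text \<open>S is prescribed only up to the level set, so strict and weak inequalities are covered at
  once. Continuous ramps enclose its indicator, and their gap shrinks to the level set, where F
  vanishes up to a null set of \<open>J\<close>.\<close>

lemma vconv_threshold:
  assumes F: "continuous_on UNIV F" and K: "compact K" "K \<subseteq> U \<times> U - {(x, y). x = y}" "{z. F z \<noteq> 0} \<subseteq> K"
    and S: "S \<in> sets borel" "{z. dist (fst z) (snd z) > a} \<subseteq> S" "S \<subseteq> {z. dist (fst z) (snd z) \<ge> a}"
    and null: "emeasure J {z. dist (fst z) (snd z) = a \<and> F z \<noteq> 0} = 0"
  shows "vconv (\<lambda>z. indicator S z * F z)"
proof (rule vconv_approx)
  show "(\<lambda>z. indicator S z * F z) \<in> borel_measurable borel"
    using F S by (intro borel_measurable_times borel_measurable_indicator borel_measurable_continuous_onI)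
  \<comment> \<open>For n > 0, \<open>\<psi> n\<close> rises from 0 to 1 between the distances a -
    1/n and a, and \<open>\<theta> n\<close> between a and a + 1/n. The indicator of S lies between
    them.\<close>
  define \<psi> where "\<psi> = (\<lambda>(n::nat) (z::(real^'n) \<times> (real^'n)). min 1 (max 0 (n * (dist (fst z) (snd z) - a) + 1)))"
  define \<theta> where "\<theta> = (\<lambda>(n::nat) (z::(real^'n) \<times> (real^'n)). min 1 (max 0 (n * (dist (fst z) (snd z) - a))))"
  define D where "D = (\<lambda>n z. (\<psi> n z - \<theta> n z) * \<bar>F z\<bar>)"
  have c: "continuous_on UNIV (\<psi> n)" "continuous_on UNIV (\<theta> n)" for n
    unfolding \<psi>_def \<theta>_def by (intro continuous_intros)+
  have v: "vconv (\<lambda>z. \<psi> n z * F z)" "vconv (D n)" for n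
    using K unfolding D_def
    by (auto intro!: vconv_continuous[where K=K] continuous_intros F c)
  have ind: "\<theta> n z \<le> indicator S z" "indicator S z \<le> \<psi> n z" for n z
  proof -
    show "\<theta> n z \<le> indicator S z"
    proof (cases "z \<in> S")
      case False
      then have "dist (fst z) (snd z) \<le> a" using S(2) by force
      then have "real n * (dist (fst z) (snd z) - a) \<le> 0" by (simp add: mult_nonneg_nonpos)
      then show ?thesis by (simp add: \<theta>_def)
    qed (simp add: \<theta>_def)
    show "indicator S z \<le> \<psi> n z"
    proof (cases "z \<in> S")
      case True
      then have "real n * (dist (fst z) (snd z) - a) \<ge> 0" using S(3) by auto
      then show ?thesis using True by (simp add: \<psi>_def)
    qed (simp add: \<psi>_def)
  qed
  have \<psi>\<theta>: "0 \<le> \<psi> n z - \<theta> n z" "\<psi> n z - \<theta> n z \<le> 1" for n z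
    by (auto simp: \<psi>_def \<theta>_def)
  have "(\<lambda>n. \<integral>z. D n z \<partial>J) \<longlonglongrightarrow> (\<integral>z. indicator {z. dist (fst z) (snd z) = a} z * \<bar>F z\<bar> \<partial>J)"
  proof (rule integral_dominated_convergence[where w="\<lambda>z. \<bar>F z\<bar>"])
    show "integrable J (\<lambda>z. \<bar>F z\<bar>)"
      using vconv_continuous[OF F K] by (auto simp: vconv_def)
    have "(\<lambda>z. indicator {z. dist (fst z) (snd z) = a} z * \<bar>F z\<bar>) \<in> borel_measurable borel"
      by (intro borel_measurable_times borel_measurable_indicator borel_measurable_continuous_onI
          continuous_intros F borel_closed closed_Collect_eq)
    then show "(\<lambda>z. indicator {z. dist (fst z) (snd z) = a} z * \<bar>F z\<bar>) \<in> borel_measurable J"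
      using sets_J measurable_cong_sets by blast
    show "D n \<in> borel_measurable J" for n using v by (auto simp: vconv_def)
    show "AE z in J. norm (D n z) \<le> \<bar>F z\<bar>" for n
      using \<psi>\<theta>[of n] by (auto simp: D_def abs_mult intro!: AE_I2 mult_left_le_one_le)
    show "AE z in J. (\<lambda>n. D n z) \<longlonglongrightarrow> indicator {z. dist (fst z) (snd z) = a} z * \<bar>F z\<bar>"
    proof (rule AE_I2)
      fix z :: "(real^'n) \<times> (real^'n)"
      define t where "t = dist (fst z) (snd z) - a"
      have "\<forall>\<^sub>F n in sequentially. \<psi> n z - \<theta> n z = indicator {z. dist (fst z) (snd z) = a} z"
      proof (cases "t = 0")
        case True
        then show ?thesis by (auto simp: \<psi>_def \<theta>_def t_def)
      next
        case False
        have "\<forall>\<^sub>F n in sequentially. real n \<ge> 1 / \<bar>t\<bar>"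
          by (rule eventually_ge_at_top[THEN eventually_compose_filterlim, OF filterlim_real_sequentially])
        then show ?thesis
        proof eventually_elim
          case (elim n)
          then have nt: "real n * \<bar>t\<bar> \<ge> 1" using False by (simp add: field_simps)
          show ?case
          proof (cases "t > 0")
            case True
            then show ?thesis using nt by (simp add: \<psi>_def \<theta>_def t_def)
          next
            case False
            then have "real n * t \<le> - 1" using nt by (simp add: abs_if split: if_splits)
            then show ?thesis using \<open>t \<noteq> 0\<close> by (simp add: \<psi>_def \<theta>_def t_def)
          qed
        qed
      qed
      then have "\<forall>\<^sub>F n in sequentially. indicator {z. dist (fst z) (snd z) = a} z * \<bar>F z\<bar> = D n z"
        by eventually_elim (simp add: D_def)
      then show "(\<lambda>n. D n z) \<longlonglongrightarrow> indicator {z. dist (fst z) (snd z) = a} z * \<bar>F z\<bar>"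
        by (rule Lim_transform_eventually[OF tendsto_const])
    qed
  qed
  moreover have "(\<integral>z. indicator {z. dist (fst z) (snd z) = a} z * \<bar>F z\<bar> \<partial>J) = 0"
  proof -
    have "open {z. F z \<noteq> 0}" using open_Collect_neq[OF F continuous_on_const] by simp
    then have "{z. F z \<noteq> 0} \<in> sets borel" by simp
    moreover have "closed {z::(real^'n) \<times> (real^'n). dist (fst z) (snd z) = a}"
      by (intro closed_Collect_eq continuous_intros)
    ultimately have "{z. dist (fst z) (snd z) = a} \<inter> {z. F z \<noteq> 0} \<in> sets borel" by auto
    then have "{z. dist (fst z) (snd z) = a \<and> F z \<noteq> 0} \<in> null_sets J"
      using null sets_J by (auto simp: Collect_conj_eq)
    from AE_not_in[OF this] have "AE z in J. indicator {z. dist (fst z) (snd z) = a} z * \<bar>F z\<bar> = 0"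
      by eventually_elim (auto simp: indicator_def)
    then show ?thesis by (rule integral_eq_zero_AE)
  qed
  ultimately have lim: "(\<lambda>n. \<integral>z. D n z \<partial>J) \<longlonglongrightarrow> 0" by simp
  fix \<epsilon> :: real assume "\<epsilon> > 0"
  then have "\<forall>\<^sub>F n in sequentially. (\<integral>z. D n z \<partial>J) < \<epsilon>" by (rule order_tendstoD(2)[OF lim])
  then obtain n where n: "(\<integral>z. D n z \<partial>J) < \<epsilon>" by (auto simp: eventually_sequentially)
  show "\<exists>G D. vconv G \<and> vconv D \<and> (\<forall>z. \<bar>indicator S z * F z - G z\<bar> \<le> D z) \<and> (\<integral>z. D z \<partial>J) \<le> \<epsilon>"
  proof (intro exI conjI allI)
    show "vconv (\<lambda>z. \<psi> n z * F z)" "vconv (D n)" by (rule v)+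
    show "(\<integral>z. D n z \<partial>J) \<le> \<epsilon>" using n by simp
    show "\<bar>indicator S z * F z - \<psi> n z * F z\<bar> \<le> D n z" for z
      unfolding D_def left_diff_distrib[symmetric] abs_mult
      using ind[where n=n and z=z] by (intro mult_right_mono) auto
  qed
qed

end

section \<open>Quadratic estimates\<close>

lemma smooth_has_derivative_pd:
  assumes "smooth f"
  shows "(f has_derivative (\<lambda>h. \<Sum>i\<in>UNIV. h $ i * pd i f x)) (at x)"
proof -
  have d: "(f has_derivative frechet_derivative f (at x)) (at x)"
    using assms by (rule smooth_has_derivative)
  have lin: "linear (frechet_derivative f (at x))" using d by (rule has_derivative_linear)
  have "frechet_derivative f (at x) h = (\<Sum>i\<in>UNIV. h $ i * pd i f x)" for h
  proof -
    have "frechet_derivative f (at x) h = frechet_derivative f (at x) (\<Sum>i\<in>UNIV. h $ i *s axis i 1)"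
      by (simp add: basis_expansion)
    also have "\<dots> = (\<Sum>i\<in>UNIV. h $ i * pd i f x)"
      by (simp add: linear_sum[OF lin] scalar_mult_eq_scaleR linear_cmul[OF lin] pd_def)
    finally show ?thesis .
  qed
  then have "frechet_derivative f (at x) = (\<lambda>h. \<Sum>i\<in>UNIV. h $ i * pd i f x)" by (rule ext)
  then show ?thesis using d by simp
qed

lemma pd_eq_0_outside_supp:
  assumes "x \<notin> supp f" shows "pd i f x = 0"
proof -
  have "((\<lambda>x. 0) has_derivative (\<lambda>h. 0)) (at x)" by simp
  then have "(f has_derivative (\<lambda>h. 0)) (at x)"
    by (rule has_derivative_transform_within_open[where s="- supp f"])
       (use assms supp_superset[of f] in \<open>auto simp: supp_def\<close>)
  from pd_eqI[OF this] show ?thesis .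
qed

lemma C0inf_pd: "f \<in> C0inf V \<Longrightarrow> pd i f \<in> C0inf V"
  by (rule C0infI[where K="supp f"]) (use pd_eq_0_outside_supp in \<open>auto simp: C0inf_def smooth_pd\<close>)

lemma C0inf_bounded:
  assumes "f \<in> C0inf V" obtains C where "C > 0" "\<And>x. \<bar>f x\<bar> \<le> C"
proof -
  have "bounded (f ` supp f)" using assms
    by (intro compact_imp_bounded compact_continuous_image smooth_imp_continuous_on) (auto simp: C0inf_def)
  then obtain C where C: "C > 0" "\<And>x. x \<in> supp f \<Longrightarrow> \<bar>f x\<bar> \<le> C"
    by (auto simp: bounded_pos)
  then have "\<bar>f x\<bar> \<le> C" for x using supp_superset[of f x] by (cases "f x = 0") auto
  then show thesis using C that by blast
qed

lemma gradient_sum_le: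
  fixes h :: "real^'n::finite"
  assumes "\<And>i. \<bar>c i\<bar> \<le> C"
  shows "norm (\<Sum>i\<in>UNIV. h $ i * c i) \<le> real CARD('n) * C * norm h"
proof -
  have "norm (\<Sum>i\<in>UNIV. h $ i * c i) \<le> (\<Sum>i\<in>(UNIV :: 'n set). norm h * C)"
    using assms by (intro sum_norm_le) (auto simp: abs_mult intro!: mult_mono component_le_norm_cart)
  then show ?thesis by (simp add: algebra_simps)
qed

lemma C0inf_lipschitz:
  fixes f :: "real^'n::finite \<Rightarrow> real"
  assumes "f \<in> C0inf V" obtains M where "M > 0" "\<And>x y. \<bar>f y - f x\<bar> \<le> M * dist x y"
proof -
  have "\<forall>i. \<exists>C. C > 0 \<and> (\<forall>x. \<bar>pd i f x\<bar> \<le> C)" using C0inf_bounded[OF C0inf_pd[OF assms]] by metis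
  then obtain C where C: "\<And>i. C i > 0" "\<And>i x. \<bar>pd i f x\<bar> \<le> C i" by metis
  define B where "B = (\<Sum>i\<in>UNIV. C i)"
  have CB: "C i \<le> B" for i unfolding B_def using C(1) by (intro member_le_sum) (auto simp: less_imp_le)
  \<comment> \<open>Index types are not empty, so \<open>undefined\<close> is an index and its
    constant is positive.\<close>
  have B: "B > 0" using C(1)[of undefined] CB[of undefined] by linarith
  show thesis
  proof
    show "real CARD('n) * B > 0" using B by simp
    fix x y
    have "norm (f y - f x) \<le> real CARD('n) * B * norm (y - x)"
    proof (rule differentiable_bound[where S=UNIV and f'="\<lambda>x h. \<Sum>i\<in>UNIV. h $ i * pd i f x"])
      show "(f has_derivative (\<lambda>h. \<Sum>i\<in>UNIV. h $ i * pd i f x)) (at x within UNIV)" for x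
        using smooth_has_derivative_pd[OF C0inf_smooth[OF assms]] by simp
      show "onorm (\<lambda>h. \<Sum>i\<in>UNIV. h $ i * pd i f x) \<le> real CARD('n) * B" for x
        using C(2) CB by (intro onorm_le gradient_sum_le) (meson order_trans)
    qed auto
    then show "\<bar>f y - f x\<bar> \<le> real CARD('n) * B * dist x y" by (simp add: dist_norm norm_minus_commute)
  qed
qed

text \<open>The base point is y because the drift term of \<open>Ec\<close> takes the gradient
  there. The mean value inequality is applied to f minus its linear part at y: on the ball of radius
  \<open>dist x y\<close> the gradient of this function is of the order of the radius, since the
  partial derivatives are Lipschitz.\<close>

lemma C0inf_taylor:
  fixes f :: "real^'n::finite \<Rightarrow> real"
  assumes "f \<in> C0inf V"
  obtains M where "M > 0"
    "\<And>x y. \<bar>f y - f x - (\<Sum>i\<in>UNIV. (y $ i - x $ i) * pd i f y)\<bar> \<le> M * (dist x y)\<^sup>2"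
proof -
  have "\<forall>i. \<exists>C. C > 0 \<and> (\<forall>x y. \<bar>pd i f y - pd i f x\<bar> \<le> C * dist x y)"
    using C0inf_lipschitz[OF C0inf_pd[OF assms]] by metis
  then obtain C where C: "\<And>i. C i > 0" "\<And>i x y. \<bar>pd i f y - pd i f x\<bar> \<le> C i * dist x y" by metis
  define B where "B = (\<Sum>i\<in>UNIV. C i)"
  have CB: "C i \<le> B" for i unfolding B_def using C(1) by (intro member_le_sum) (auto simp: less_imp_le)
  have B: "B > 0" using C(1)[of undefined] CB[of undefined] by linarith
  show thesis
  proof
    show "real CARD('n) * B > 0" using B by simp
    fix x y
    define g where "g = (\<lambda>z. f z - (\<Sum>i\<in>UNIV. z $ i * pd i f y))"
    have "norm (g y - g x) \<le> real CARD('n) * (B * dist x y) * norm (y - x)"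
    proof (rule differentiable_bound[where S="cball y (dist x y)"
          and f'="\<lambda>z h. \<Sum>i\<in>UNIV. h $ i * (pd i f z - pd i f y)"])
      fix z assume z: "z \<in> cball y (dist x y)"
      have "((\<lambda>z. \<Sum>i\<in>UNIV. z $ i * pd i f y) has_derivative (\<lambda>h. \<Sum>i\<in>UNIV. h $ i * pd i f y)) (at z)"
        by (intro bounded_linear_imp_has_derivative bounded_linear_sum bounded_linear_mult_const
            bounded_linear_vec_nth)
      then have "(g has_derivative (\<lambda>h. (\<Sum>i\<in>UNIV. h $ i * pd i f z) - (\<Sum>i\<in>UNIV. h $ i * pd i f y))) (at z)"
        unfolding g_def by (intro has_derivative_diff smooth_has_derivative_pd C0inf_smooth[OF assms])
      then show "(g has_derivative (\<lambda>h. \<Sum>i\<in>UNIV. h $ i * (pd i f z - pd i f y))) (at z within cball y (dist x y))"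
        by (auto simp: right_diff_distrib sum_subtractf intro: has_derivative_at_withinI)
      have "\<bar>pd i f z - pd i f y\<bar> \<le> B * dist x y" for i
      proof -
        have "C i * dist y z \<le> B * dist x y"
          using CB[of i] z B by (intro mult_mono) auto
        then show ?thesis using C(2)[where x=y and y=z and i=i] by linarith
      qed
      then show "onorm (\<lambda>h. \<Sum>i\<in>UNIV. h $ i * (pd i f z - pd i f y)) \<le> real CARD('n) * (B * dist x y)"
        by (intro onorm_le gradient_sum_le)
    qed (auto simp: dist_commute)
    moreover have "g y - g x = f y - f x - (\<Sum>i\<in>UNIV. (y $ i - x $ i) * pd i f y)"
      by (simp add: g_def left_diff_distrib sum_subtractf)
    ultimately show "\<bar>f y - f x - (\<Sum>i\<in>UNIV. (y $ i - x $ i) * pd i f y)\<bar> \<le> real CARD('n) * B * (dist x y)\<^sup>2"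
      by (simp add: power2_eq_square dist_norm norm_minus_commute mult.assoc)
  qed
qed

lemma dist_power2_vec: "(dist x y)\<^sup>2 = (\<Sum>i\<in>UNIV. (x $ i - y $ i)\<^sup>2)" for x y :: "real^'n::finite"
  unfolding dist_norm power2_norm_eq_inner inner_vec_def by (simp add: power2_eq_square)

section \<open>Integrals across the diagonal and local integrability of the squared distance\<close>

context approximating_kernels
begin

text \<open>\<open>c\<close> is the limit of the integrals themselves and \<open>L\<close> the
  first-order correction. Combinations with \<open>c = 0\<close> are those whose integrals converge
  after multiplication by \<beta>.\<close>

definition tlim :: "((real^'n) \<times> (real^'n) \<Rightarrow> real) \<Rightarrow> real \<Rightarrow> real \<Rightarrow> bool" where
  "tlim F c L \<longleftrightarrow> (\<forall>\<beta>>0. integrable (\<sigma> \<beta>) F) \<and> ((\<lambda>\<beta>. \<beta> * (c - (\<integral>z. F z \<partial>\<sigma> \<beta>))) \<longlongrightarrow> L) at_top"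

lemma tlim_tensor:
  assumes "f \<in> C0inf U" "g \<in> C0inf U"
  shows "tlim (\<lambda>z. f (fst z) * g (snd z)) (ip m f g) (e f g)"
proof -
  have "integrable (\<sigma> \<beta>) (\<lambda>z. f (fst z) * g (snd z))" if "\<beta> > 0" for \<beta>
    using assms that
    by (intro integrable_\<sigma>_continuous[where K="supp f \<times> supp g"] continuous_on_tensor compact_Times)
       (auto simp: C0inf_def supp_superset)
  then show ?thesis using form_limit[OF assms] by (simp add: tlim_def)
qed

lemma tlim_add:
  assumes "tlim F c L" "tlim G d M" shows "tlim (\<lambda>z. F z + G z) (c + d) (L + M)"
proof -
  have "((\<lambda>\<beta>. \<beta> * (c - (\<integral>z. F z \<partial>\<sigma> \<beta>)) + \<beta> * (d - (\<integral>z. G z \<partial>\<sigma> \<beta>))) \<longlongrightarrow> L + M) at_top"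
    using assms unfolding tlim_def by (intro tendsto_add) auto
  moreover have "\<forall>\<^sub>F \<beta> in at_top. \<beta> * (c - (\<integral>z. F z \<partial>\<sigma> \<beta>)) + \<beta> * (d - (\<integral>z. G z \<partial>\<sigma> \<beta>)) =
      \<beta> * (c + d - (\<integral>z. F z + G z \<partial>\<sigma> \<beta>))"
    using eventually_gt_at_top[of 0]
    by eventually_elim (use assms in \<open>auto simp: tlim_def algebra_simps\<close>)
  ultimately have "((\<lambda>\<beta>. \<beta> * (c + d - (\<integral>z. F z + G z \<partial>\<sigma> \<beta>))) \<longlongrightarrow> L + M) at_top"
    by (rule Lim_transform_eventually)
  then show ?thesis using assms by (auto simp: tlim_def)
qed

lemma tlim_cmult:
  assumes "tlim F c L" shows "tlim (\<lambda>z. a * F z) (a * c) (a * L)"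
proof -
  have "((\<lambda>\<beta>. a * (\<beta> * (c - (\<integral>z. F z \<partial>\<sigma> \<beta>)))) \<longlongrightarrow> a * L) at_top"
    using assms by (intro tendsto_mult_left) (simp add: tlim_def)
  moreover have "(\<lambda>\<beta>. a * (\<beta> * (c - (\<integral>z. F z \<partial>\<sigma> \<beta>)))) = (\<lambda>\<beta>. \<beta> * (a * c - (\<integral>z. a * F z \<partial>\<sigma> \<beta>)))"
    by (simp add: algebra_simps)
  ultimately show ?thesis using assms by (simp add: tlim_def)
qed

lemma tlim_diff:
  assumes "tlim F c L" "tlim G d M" shows "tlim (\<lambda>z. F z - G z) (c - d) (L - M)"
  using tlim_add[OF assms(1) tlim_cmult[OF assms(2), of "-1"]] by simp

lemma tlim_sum:
  assumes "finite I" "\<And>i. i \<in> I \<Longrightarrow> tlim (F i) (c i) (L i)"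
  shows "tlim (\<lambda>z. \<Sum>i\<in>I. F i z) (\<Sum>i\<in>I. c i) (\<Sum>i\<in>I. L i)"
  using assms
proof (induction I)
  case empty
  then show ?case by (simp add: tlim_def)
next
  case (insert i I)
  then show ?case using tlim_add[of "F i" "c i" "L i" "\<lambda>z. \<Sum>i\<in>I. F i z"] by simp
qed

lemma tlim_0: "tlim F 0 L \<Longrightarrow> ((\<lambda>\<beta>. \<beta> * (\<integral>z. F z \<partial>\<sigma> \<beta>)) \<longlongrightarrow> - L) at_top"
  unfolding tlim_def using tendsto_minus[of "\<lambda>\<beta>. \<beta> * (0 - (\<integral>z. F z \<partial>\<sigma> \<beta>))" L at_top] by simp

text \<open>The squared distance times w(x) w(y) is a combination of products of w,
  \<open>X i\<close> and \<open>Y i\<close> whose \<open>ip\<close> terms cancel, so its scaled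
  integrals converge to -L. Truncations off the diagonal converge to twice their integrals against
  \<open>J\<close>, which are thus bounded by -L, and monotone convergence applies.\<close>

lemma integrable_J_dist_power2:
  assumes w: "w \<in> C0inf U" "\<And>x. 0 \<le> w x"
  shows "integrable J (\<lambda>z. (dist (fst z) (snd z))\<^sup>2 * (w (fst z) * w (snd z)))"
proof -
  define Q where "Q = (\<lambda>z. (dist (fst z) (snd z))\<^sup>2 * (w (fst z) * w (snd z)))"
  have Q0: "Q z \<ge> 0" for z unfolding Q_def using w by (intro mult_nonneg_nonneg) auto
  have wc: "continuous_on A w" for A using w by (intro smooth_imp_continuous_on) (rule C0inf_smooth)
  have wwc: "continuous_on UNIV (\<lambda>z. w (fst z) * w (snd z))"
    using w by (intro continuous_on_tensor) (auto simp: C0inf_def)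
  have Qc: "continuous_on UNIV Q" unfolding Q_def by (intro continuous_intros wwc)
  define X where "X = (\<lambda>i x. x $ i * w x)"
  define Y where "Y = (\<lambda>i x. x $ i * X i x)"
  have X: "X i \<in> C0inf U" for i unfolding X_def by (intro C0inf_mult_left w smooth_component)
  have Y: "Y i \<in> C0inf U" for i unfolding Y_def by (intro C0inf_mult_left X smooth_component)
  define L where "L = (\<Sum>i\<in>UNIV. e w (Y i) + e (Y i) w - 2 * e (X i) (X i))"
  have "tlim (\<lambda>z. \<Sum>i\<in>UNIV. w (fst z) * Y i (snd z) + Y i (fst z) * w (snd z) - 2 * (X i (fst z) * X i (snd z)))
     (\<Sum>i\<in>UNIV. ip m w (Y i) + ip m (Y i) w - 2 * ip m (X i) (X i)) L"
    unfolding L_def by (intro tlim_sum tlim_diff tlim_add tlim_cmult tlim_tensor w X Y) auto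
  moreover have "(\<Sum>i\<in>UNIV. ip m w (Y i) + ip m (Y i) w - 2 * ip m (X i) (X i)) = 0"
    by (intro sum.neutral) (simp add: ip_def X_def Y_def mult_ac)
  moreover have "(\<lambda>z. \<Sum>i\<in>UNIV. w (fst z) * Y i (snd z) + Y i (fst z) * w (snd z) - 2 * (X i (fst z) * X i (snd z))) = Q"
    unfolding Q_def dist_power2_vec sum_distrib_right
    by (intro ext sum.cong) (auto simp: X_def Y_def power2_eq_square algebra_simps)
  ultimately have tQ: "tlim Q 0 L" by simp
  \<comment> \<open>For n > 0, \<open>c n\<close> is 0 up to distance 1/n and 1 from distance 2/n
    on; the truncations avoid the diagonal and increase with n.\<close>
  define c where "c = (\<lambda>(n::nat) (z::(real^'n) \<times> (real^'n)). min 1 (max 0 (n * dist (fst z) (snd z) - 1)))"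
  have cc: "continuous_on UNIV (c n)" for n unfolding c_def by (intro continuous_intros)
  have c01: "0 \<le> c n z" "c n z \<le> 1" for n z by (auto simp: c_def)
  define F where "F = (\<lambda>n z. c n z * Q z)"
  have vF: "vconv (F n)" for n
  proof (rule vconv_continuous[where K="(supp w \<times> supp w) \<inter> {z. n * dist (fst z) (snd z) \<ge> 1}"])
    show "continuous_on UNIV (F n)" unfolding F_def by (intro continuous_intros cc Qc)
    have "closed {z::(real^'n) \<times> (real^'n). n * dist (fst z) (snd z) \<ge> 1}"
      by (intro closed_Collect_le continuous_intros)
    then show "compact (supp w \<times> supp w \<inter> {z. n * dist (fst z) (snd z) \<ge> 1})"
      using w by (intro compact_Int_closed compact_Times) (auto simp: C0inf_def)
    show "supp w \<times> supp w \<inter> {z. n * dist (fst z) (snd z) \<ge> 1} \<subseteq> U \<times> U - {(x, y). x = y}"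
      using w by (auto simp: C0inf_def)
    show "{z. F n z \<noteq> 0} \<subseteq> supp w \<times> supp w \<inter> {z. n * dist (fst z) (snd z) \<ge> 1}"
      by (auto simp: F_def Q_def c_def intro!: supp_superset)
  qed
  have bound: "2 * (\<integral>z. F n z \<partial>J) \<le> - L" for n
  proof (rule tendsto_le[OF _ tlim_0[OF tQ]])
    show "((\<lambda>\<beta>. \<beta> * (\<integral>z. F n z \<partial>\<sigma> \<beta>)) \<longlongrightarrow> 2 * (\<integral>z. F n z \<partial>J)) at_top"
      using vF by (simp add: vconv_def)
    show "\<forall>\<^sub>F \<beta> in at_top. \<beta> * (\<integral>z. F n z \<partial>\<sigma> \<beta>) \<le> \<beta> * (\<integral>z. Q z \<partial>\<sigma> \<beta>)"
      using eventually_gt_at_top[of 0]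
    proof eventually_elim
      case (elim \<beta>)
      have "(\<integral>z. F n z \<partial>\<sigma> \<beta>) \<le> (\<integral>z. Q z \<partial>\<sigma> \<beta>)"
        using elim vF tQ c01 Q0
        by (intro integral_mono) (auto simp: vconv_def tlim_def F_def intro!: mult_left_le_one_le)
      then show ?case using elim by simp
    qed
  qed simp
  have mono: "F n z \<le> F k z" if "n \<le> k" for n k z
  proof -
    have "real n * dist (fst z) (snd z) \<le> real k * dist (fst z) (snd z)"
      using that by (intro mult_right_mono) auto
    then have "c n z \<le> c k z" by (auto simp: c_def)
    then show ?thesis unfolding F_def using Q0 by (intro mult_right_mono)
  qed
  have "incseq (\<lambda>n. \<integral>z. F n z \<partial>J)"
    using vF mono by (intro incseq_SucI integral_mono) (auto simp: vconv_def)
  moreover have "(\<integral>z. F n z \<partial>J) \<le> - L / 2" for n using bound[of n] by simp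
  ultimately obtain l where l: "(\<lambda>n. \<integral>z. F n z \<partial>J) \<longlonglongrightarrow> l"
    using incseq_convergent by blast
  have "integrable J Q"
  proof (rule integrable_monotone_convergence[OF _ _ _ l])
    show "integrable J (F n)" for n using vF by (simp add: vconv_def)
    show "AE z in J. mono (\<lambda>n. F n z)" using mono by (auto simp: mono_def)
    show "AE z in J. (\<lambda>n. F n z) \<longlonglongrightarrow> Q z"
    proof (rule AE_I2)
      fix z
      show "(\<lambda>n. F n z) \<longlonglongrightarrow> Q z"
      proof (cases "dist (fst z) (snd z) = 0")
        case True
        then show ?thesis by (simp add: F_def Q_def)
      next
        case False
        have "\<forall>\<^sub>F n in sequentially. real n \<ge> 2 / dist (fst z) (snd z)"
          by (rule eventually_ge_at_top[THEN eventually_compose_filterlim, OF filterlim_real_sequentially])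
        then have "\<forall>\<^sub>F n in sequentially. Q z = F n z"
        proof eventually_elim
          case (elim n)
          have "dist (fst z) (snd z) > 0" using False zero_le_dist[of "fst z" "snd z"] by linarith
          then have "real n * dist (fst z) (snd z) \<ge> 2" using elim by (simp add: pos_divide_le_eq)
          then have "c n z = 1" by (simp add: c_def)
          then show ?case by (simp add: F_def)
        qed
        then show ?thesis by (rule Lim_transform_eventually[OF tendsto_const])
      qed
    qed
    have "Q \<in> borel_measurable borel" using Qc by (rule borel_measurable_continuous_onI)
    then show "Q \<in> borel_measurable J" using sets_J measurable_cong_sets by blast
  qed
  then show ?thesis unfolding Q_def .
qed

lemma integrable_J_quadratic:
  assumes "compact C1" "C1 \<subseteq> U"
  shows "integrable J (\<lambda>z. indicator (C1 \<times> C1) z * (dist (fst z) (snd z))\<^sup>2)"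
proof -
  obtain w N where w: "w \<in> C0inf U" "open N" "C1 \<subseteq> N" "\<And>x. x \<in> N \<Longrightarrow> w x = 1" "\<And>x. 0 \<le> w x"
    using smooth_cutoff[OF assms(1) U_open assms(2)] by metis
  show ?thesis
  proof (rule Bochner_Integration.integrable_bound[OF integrable_J_dist_power2[OF w(1,5)]])
    have "C1 \<times> C1 \<in> sets borel" using assms by (intro borel_closed compact_imp_closed compact_Times)
    then have "(\<lambda>z. indicator (C1 \<times> C1) z * (dist (fst z) (snd z))\<^sup>2) \<in> borel_measurable borel"
      by (intro borel_measurable_times borel_measurable_indicator borel_measurable_continuous_onI continuous_intros)
    then show "(\<lambda>z. indicator (C1 \<times> C1) z * (dist (fst z) (snd z))\<^sup>2) \<in> borel_measurable J"
      using sets_J measurable_cong_sets by blast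
    show "AE z in J. norm (indicator (C1 \<times> C1) z * (dist (fst z) (snd z))\<^sup>2) \<le>
        norm ((dist (fst z) (snd z))\<^sup>2 * (w (fst z) * w (snd z)))"
    proof (rule AE_I2)
      fix z
      show "norm (indicator (C1 \<times> C1) z * (dist (fst z) (snd z))\<^sup>2) \<le>
        norm ((dist (fst z) (snd z))\<^sup>2 * (w (fst z) * w (snd z)))"
      proof (cases "z \<in> C1 \<times> C1")
        case True
        then have "w (fst z) = 1" "w (snd z) = 1" using w(3) by (auto intro!: w(4))
        then show ?thesis using True by simp
      qed simp
    qed
  qed
qed

lemma integrable_J_quadratic_bound:
  assumes "compact C1" "C1 \<subseteq> U" "F \<in> borel_measurable borel"
    "\<And>z. \<bar>F z\<bar> \<le> C * (indicator (C1 \<times> C1) z * (dist (fst z) (snd z))\<^sup>2)"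
  shows "integrable J F"
proof (rule Bochner_Integration.integrable_bound)
  show "integrable J (\<lambda>z. C * (indicator (C1 \<times> C1) z * (dist (fst z) (snd z))\<^sup>2))"
    by (intro integrable_mult_right integrable_J_quadratic assms)
  show "F \<in> borel_measurable J" using assms sets_J measurable_cong_sets by blast
  show "AE z in J. norm (F z) \<le> norm (C * (indicator (C1 \<times> C1) z * (dist (fst z) (snd z))\<^sup>2))"
    using order_trans[OF assms(4) abs_ge_self] by (intro AE_I2) (simp only: real_norm_def)
qed

text \<open>F may live on the diagonal, but S comes no closer to it than a. A ramp that is 1 from
  distance a on and 0 up to distance a / 2 can be multiplied in without changing the product with
  the indicator.\<close>

lemma vconv_threshold_pos:
  assumes F: "continuous_on UNIV F" and K: "compact K" "K \<subseteq> U \<times> U" "{z. F z \<noteq> 0} \<subseteq> K"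
    and S: "S \<in> sets borel" "{z. dist (fst z) (snd z) > a} \<subseteq> S" "S \<subseteq> {z. dist (fst z) (snd z) \<ge> a}"
    and null: "emeasure J {z. dist (fst z) (snd z) = a \<and> F z \<noteq> 0} = 0" and "a > 0"
  shows "vconv (\<lambda>z. indicator S z * F z)"
proof -
  define c where "c = (\<lambda>(z::(real^'n) \<times> (real^'n)). min 1 (max 0 (2 * dist (fst z) (snd z) / a - 1)))"
  have cc: "continuous_on UNIV c" unfolding c_def using \<open>a > 0\<close> by (intro continuous_intros) auto
  have c1: "c z = 1" if "dist (fst z) (snd z) \<ge> a" for z
    using that \<open>a > 0\<close> by (simp add: c_def field_simps)
  have "vconv (\<lambda>z. indicator S z * (c z * F z))"
  proof (rule vconv_threshold[where K="K \<inter> {z. dist (fst z) (snd z) \<ge> a / 2}" and a=a])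
    show "continuous_on UNIV (\<lambda>z. c z * F z)" by (intro continuous_intros cc F)
    have "closed {z::(real^'n) \<times> (real^'n). dist (fst z) (snd z) \<ge> a / 2}"
      by (intro closed_Collect_le continuous_intros)
    then show "compact (K \<inter> {z. dist (fst z) (snd z) \<ge> a / 2})"
      using K by (intro compact_Int_closed)
    show "K \<inter> {z. dist (fst z) (snd z) \<ge> a / 2} \<subseteq> U \<times> U - {(x, y). x = y}" using K \<open>a > 0\<close> by auto
    show "{z. c z * F z \<noteq> 0} \<subseteq> K \<inter> {z. dist (fst z) (snd z) \<ge> a / 2}"
    proof
      fix z assume z: "z \<in> {z. c z * F z \<noteq> 0}"
      then have "c z \<noteq> 0" by auto
      then have "2 * dist (fst z) (snd z) / a - 1 > 0" by (rule contrapos_np) (simp add: c_def)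
      then have "dist (fst z) (snd z) \<ge> a / 2" using \<open>a > 0\<close> by (simp add: field_simps)
      then show "z \<in> K \<inter> {z. dist (fst z) (snd z) \<ge> a / 2}" using z K by auto
    qed
    have "{z. dist (fst z) (snd z) = a \<and> c z * F z \<noteq> 0} = {z. dist (fst z) (snd z) = a \<and> F z \<noteq> 0}"
      using c1 by (intro Collect_cong) (metis mult_1 order_refl)
    then show "emeasure J {z. dist (fst z) (snd z) = a \<and> c z * F z \<noteq> 0} = 0" using null by simp
  qed (use S in auto)
  moreover have "(\<lambda>z. indicator S z * (c z * F z)) = (\<lambda>z. indicator S z * F z)"
    using S(3) c1 by (auto simp: fun_eq_iff indicator_def)
  ultimately show ?thesis by simp
qed

end

section \<open>The iterated limits\<close>

text \<open>On the compact set S the distance to the frontier attains its minimum, which exceeds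
  \<delta>; half of the excess is the margin. A closed ball around a point of S that left U would be
  a connected set meeting the frontier too close to its centre.\<close>

lemma Udelta_neighbourhood:
  fixes U :: "(real^'n::finite) set"
  assumes "open U" "compact S" "S \<subseteq> Udelta U \<delta>" "\<delta> > 0"
  obtains \<epsilon> K where "\<epsilon> > 0" "compact K" "K \<subseteq> U" "\<And>x y. y \<in> S \<Longrightarrow> dist x y \<le> \<delta> + \<epsilon> \<Longrightarrow> x \<in> K"
proof -
  have "\<exists>\<epsilon>>0. \<forall>y\<in>S. frontier U = {} \<or> infdist y (frontier U) > \<delta> + \<epsilon>"
  proof (cases "S = {} \<or> frontier U = {}")
    case False
    have "continuous_on S (\<lambda>y. infdist y (frontier U))" by (intro continuous_intros)
    then obtain y0 where y0: "y0 \<in> S" "\<And>y. y \<in> S \<Longrightarrow> infdist y0 (frontier U) \<le> infdist y (frontier U)"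
      using continuous_attains_inf[OF assms(2), of "\<lambda>y. infdist y (frontier U)"] False by blast
    have "infdist y0 (frontier U) > \<delta>" using y0 assms(3) False by (auto simp: Udelta_def)
    then have "\<delta> + (infdist y0 (frontier U) - \<delta>) / 2 < infdist y (frontier U)" if "y \<in> S" for y
      using y0(2)[OF that] by argo
    then show ?thesis
      using \<open>infdist y0 (frontier U) > \<delta>\<close> by (intro exI[of _ "(infdist y0 (frontier U) - \<delta>) / 2"]) auto
  \<comment> \<open>With S empty or without a frontier any positive margin will do.\<close>
  qed (auto intro: exI[of _ 1])
  then obtain \<epsilon> where \<epsilon>: "\<epsilon> > 0" "\<And>y. y \<in> S \<Longrightarrow> frontier U = {} \<or> infdist y (frontier U) > \<delta> + \<epsilon>"
    by blast
  define K where "K = {a + b | a b. a \<in> S \<and> b \<in> cball 0 (\<delta> + \<epsilon>)}"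
  have "compact K" unfolding K_def by (intro compact_sums assms) auto
  have inK: "x \<in> K" if "y \<in> S" "dist x y \<le> \<delta> + \<epsilon>" for x y
  proof -
    have "x = y + (x - y)" "x - y \<in> cball 0 (\<delta> + \<epsilon>)" using that by (auto simp: dist_norm norm_minus_commute)
    then show ?thesis unfolding K_def using that(1) by blast
  qed
  have "K \<subseteq> U"
  proof
    fix x assume "x \<in> K"
    then obtain y b where y: "y \<in> S" "x = y + b" "norm b \<le> \<delta> + \<epsilon>" unfolding K_def by auto
    show "x \<in> U"
    proof (rule ccontr)
      assume "x \<notin> U"
      have "y \<in> U" using y assms(3) by (auto simp: Udelta_def)
      have "x \<in> cball y (\<delta> + \<epsilon>)" "y \<in> cball y (\<delta> + \<epsilon>)" using y \<epsilon> assms by (auto simp: dist_norm)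
      then have "cball y (\<delta> + \<epsilon>) \<inter> U \<noteq> {}" "cball y (\<delta> + \<epsilon>) - U \<noteq> {}" using \<open>x \<notin> U\<close> \<open>y \<in> U\<close> by blast+
      then obtain p where p: "p \<in> cball y (\<delta> + \<epsilon>)" "p \<in> frontier U"
        using connected_Int_frontier[OF connected_cball] by blast
      then have "infdist y (frontier U) > \<delta> + \<epsilon>" using \<epsilon>(2)[OF y(1)] by blast
      moreover have "infdist y (frontier U) \<le> dist y p" using p by (intro infdist_le)
      ultimately show False using p by simp
    qed
  qed
  then show thesis using that \<epsilon>(1) \<open>compact K\<close> inK by blast
qed

lemma Udelta_subset: "Udelta U \<delta> \<subseteq> U"
  by (auto simp: Udelta_def)

section \<open>Truncation along the exhaustion\<close>

locale exhausted_kernels = approximating_kernels U m \<sigma> J e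
  for U :: "(real^'n::finite) set" and m \<sigma> J e +
  fixes \<Omega> :: "nat \<Rightarrow> (real^'n) set" and \<zeta> dk :: "nat \<Rightarrow> real" and \<delta> :: real
  assumes \<Omega>_open: "\<And>l. open (\<Omega> l)"
    and \<Omega>_mono: "incseq \<Omega>"
    and \<Omega>_Un: "(\<Union>l. \<Omega> l) = U"
    and \<zeta>_pos: "\<And>l. \<zeta> l > 0"
    and \<zeta>_lim: "\<zeta> \<longlonglongrightarrow> 0"
    and \<zeta>_null: "\<And>l. emeasure J {z. fst z \<in> \<Omega> l \<and> snd z \<in> \<Omega> l \<and> dist (fst z) (snd z) = \<zeta> l} = 0"
    and dk_ge: "\<And>k. dk k \<ge> \<delta>"
    and dk_lim: "dk \<longlonglongrightarrow> \<delta>"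
    and dk_null: "\<And>k. emeasure J {z. dist (fst z) (snd z) = dk k} = 0"
    and \<delta>_pos: "\<delta> > 0"
begin

lemma eventually_subset_\<Omega>:
  assumes "compact K" "K \<subseteq> U" shows "\<forall>\<^sub>F l in sequentially. K \<subseteq> \<Omega> l"
proof -
  obtain C where C: "finite C" "K \<subseteq> (\<Union>l\<in>C. \<Omega> l)"
    using compactE_image[OF assms(1), of UNIV \<Omega>] \<Omega>_open assms(2)[folded \<Omega>_Un] by auto
  obtain N where N: "\<forall>l\<in>C. l \<le> N" using C(1) unfolding finite_nat_set_iff_bounded_le by blast
  have "K \<subseteq> \<Omega> l" if l: "l \<ge> N" for l
  proof -
    have "\<Omega> j \<subseteq> \<Omega> l" if "j \<in> C" for j
      using N that l by (intro incseqD[OF \<Omega>_mono]) auto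
    then show ?thesis using C(2) by blast
  qed
  then show ?thesis by (auto simp: eventually_sequentially)
qed

lemma eventually_\<zeta>_less: "\<eta> > 0 \<Longrightarrow> \<forall>\<^sub>F l in sequentially. \<zeta> l < \<eta>"
  using \<zeta>_lim by (rule order_tendstoD)

lemma dist_sets: "{z. dist (fst z) (snd z) \<ge> a} \<in> sets (borel :: ((real^'n) \<times> (real^'n)) measure)"
  "{z. dist (fst z) (snd z) > a} \<in> sets (borel :: ((real^'n) \<times> (real^'n)) measure)"
  "{z. dist (fst z) (snd z) \<le> a} \<in> sets (borel :: ((real^'n) \<times> (real^'n)) measure)"
  by (intro borel_closed borel_open closed_Collect_le open_Collect_less continuous_intros)+

text \<open>\<open>\<zeta>_null\<close> covers the level set only inside the square of
  \<open>\<Omega> l\<close>, because it stems from the boundary of \<open>Gam\<close>. The last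
  hypothesis keeps the part of the level set that F sees inside this square.\<close>

lemma vconv_\<zeta>:
  assumes "continuous_on UNIV F" "compact K" "K \<subseteq> U \<times> U" "{z. F z \<noteq> 0} \<subseteq> K"
    and "\<And>z. F z \<noteq> 0 \<Longrightarrow> dist (fst z) (snd z) = \<zeta> l \<Longrightarrow> fst z \<in> \<Omega> l \<and> snd z \<in> \<Omega> l"
  shows "vconv (\<lambda>z. indicator {z. dist (fst z) (snd z) \<ge> \<zeta> l} z * F z)"
proof (rule vconv_threshold_pos[OF assms(1-4), where a="\<zeta> l"])
  have "open (\<Omega> l \<times> \<Omega> l)" by (intro open_Times \<Omega>_open)
  moreover have "closed {z::(real^'n) \<times> (real^'n). dist (fst z) (snd z) = \<zeta> l}"
    by (intro closed_Collect_eq continuous_intros)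
  ultimately have "(\<Omega> l \<times> \<Omega> l) \<inter> {z. dist (fst z) (snd z) = \<zeta> l} \<in> sets borel" by auto
  moreover have "(\<Omega> l \<times> \<Omega> l) \<inter> {z. dist (fst z) (snd z) = \<zeta> l} =
      {z. fst z \<in> \<Omega> l \<and> snd z \<in> \<Omega> l \<and> dist (fst z) (snd z) = \<zeta> l}" by auto
  ultimately have "emeasure J {z. dist (fst z) (snd z) = \<zeta> l \<and> F z \<noteq> 0} \<le>
     emeasure J {z. fst z \<in> \<Omega> l \<and> snd z \<in> \<Omega> l \<and> dist (fst z) (snd z) = \<zeta> l}"
    using assms(5) sets_J by (intro emeasure_mono) auto
  then show "emeasure J {z. dist (fst z) (snd z) = \<zeta> l \<and> F z \<noteq> 0} = 0" using \<zeta>_null by simp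
qed (use dist_sets \<zeta>_pos in auto)

text \<open>The complement of the condition in \<open>Ec\<close> is used so that the set stays away
  from the diagonal. The band from \<open>\<zeta> l\<close> to \<open>dk k\<close> is then a
  difference of two threshold sets.\<close>

lemma vconv_dk:
  assumes "continuous_on UNIV F" "compact K" "K \<subseteq> U \<times> U" "{z. F z \<noteq> 0} \<subseteq> K"
  shows "vconv (\<lambda>z. indicator {z. dist (fst z) (snd z) > dk k} z * F z)"
proof (rule vconv_threshold_pos[OF assms, where a="dk k"])
  have "closed {z::(real^'n) \<times> (real^'n). dist (fst z) (snd z) = dk k}"
    by (intro closed_Collect_eq continuous_intros)
  then have "emeasure J {z. dist (fst z) (snd z) = dk k \<and> F z \<noteq> 0} \<le>
     emeasure J {z. dist (fst z) (snd z) = dk k}"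
    using sets_J by (intro emeasure_mono) auto
  then show "emeasure J {z. dist (fst z) (snd z) = dk k \<and> F z \<noteq> 0} = 0" using dk_null by simp
  show "dk k > 0" using dk_ge[of k] \<delta>_pos by simp
qed (use dist_sets in auto)

lemma J_integral_truncation_tendsto:
  fixes F :: "(real^'n) \<times> (real^'n) \<Rightarrow> real"
  assumes "integrable J F" "\<And>z. fst z = snd z \<Longrightarrow> F z = 0"
  shows "(\<lambda>l. \<integral>z. indicator {z. dist (fst z) (snd z) \<ge> \<zeta> l} z * F z \<partial>J) \<longlonglongrightarrow> (\<integral>z. F z \<partial>J)"
proof (rule integral_dominated_convergence[where w="\<lambda>z. \<bar>F z\<bar>"])
  show "(\<lambda>z. indicator {z. dist (fst z) (snd z) \<ge> \<zeta> l} z * F z) \<in> borel_measurable J" for l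
    using assms(1) dist_sets sets_J by (intro borel_measurable_times borel_measurable_indicator) auto
  show "AE z in J. (\<lambda>l. indicator {z. dist (fst z) (snd z) \<ge> \<zeta> l} z * F z) \<longlonglongrightarrow> F z"
  proof (rule AE_I2)
    fix z
    show "(\<lambda>l. indicator {z. dist (fst z) (snd z) \<ge> \<zeta> l} z * F z) \<longlonglongrightarrow> F z"
    proof (cases "fst z = snd z")
      case True
      then show ?thesis using assms(2) by simp
    next
      case False
      then have "\<forall>\<^sub>F l in sequentially. \<zeta> l < dist (fst z) (snd z)" by (intro eventually_\<zeta>_less) simp
      then have "\<forall>\<^sub>F l in sequentially. F z = indicator {z. dist (fst z) (snd z) \<ge> \<zeta> l} z * F z"
        by eventually_elim simp
      then show ?thesis by (rule Lim_transform_eventually[OF tendsto_const])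
    qed
  qed
qed (use assms in \<open>auto simp: abs_mult indicator_def\<close>)

text \<open>Since \<open>w * u = u\<close>, the integrand is a difference of two tensors with the
  same zeroth-order limit, the L2 pairing of u and v. These limits cancel and the corrections
  remain.\<close>

lemma tensor_difference_limit:
  assumes "u \<in> C0inf U" "v \<in> C0inf U" "w \<in> C0inf U" "\<And>x. w x * u x = u x"
  shows "tlim (\<lambda>z. (u (snd z) - u (fst z)) * v (snd z) * w (fst z)) 0 (e w (\<lambda>x. u x * v x) - e u v)"
proof -
  have uv: "(\<lambda>x. u x * v x) \<in> C0inf U" using assms by (intro C0inf_mult_right C0inf_smooth)
  have "tlim (\<lambda>z. w (fst z) * (u (snd z) * v (snd z)) - u (fst z) * v (snd z))
      (ip m w (\<lambda>x. u x * v x) - ip m u v) (e w (\<lambda>x. u x * v x) - e u v)"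
    by (intro tlim_diff tlim_tensor[of w "\<lambda>x. u x * v x"] tlim_tensor assms uv)
  moreover have "w x * (u x * v x) = u x * v x" for x
    using assms(4)[of x] by (simp add: mult.assoc[symmetric])
  then have "ip m w (\<lambda>x. u x * v x) - ip m u v = 0"
    unfolding ip_def by (simp only: diff_self)
  moreover have "(\<lambda>z. w (fst z) * (u (snd z) * v (snd z)) - u (fst z) * v (snd z)) =
      (\<lambda>z. (u (snd z) - u (fst z)) * v (snd z) * w (fst z))"
  proof
    fix z :: "(real^'n) \<times> (real^'n)"
    have "w (fst z) * u (fst z) = u (fst z)" by (rule assms)
    then show "w (fst z) * (u (snd z) * v (snd z)) - u (fst z) * v (snd z) =
      (u (snd z) - u (fst z)) * v (snd z) * w (fst z)"
      by (metis (no_types, opaque_lifting) left_diff_distrib mult.assoc mult.commute)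
  qed
  ultimately show ?thesis by simp
qed

lemma tensor_product_difference_limit:
  assumes "u \<in> C0inf U" "v \<in> C0inf U" "w \<in> C0inf U" "\<And>x. w x * u x = u x" "\<And>x. w x * v x = v x"
  shows "tlim (\<lambda>z. (u (snd z) - u (fst z)) * (v (snd z) - v (fst z)) * w (fst z) * w (snd z)) 0
    (e w (\<lambda>x. u x * v x) + e (\<lambda>x. u x * v x) w - e v u - e u v)"
proof -
  have uv: "(\<lambda>x. u x * v x) \<in> C0inf U" using assms by (intro C0inf_mult_right C0inf_smooth)
  have "tlim (\<lambda>z. w (fst z) * (u (snd z) * v (snd z)) + u (fst z) * v (fst z) * w (snd z)
        - v (fst z) * u (snd z) - u (fst z) * v (snd z))
      (ip m w (\<lambda>x. u x * v x) + ip m (\<lambda>x. u x * v x) w - ip m v u - ip m u v)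
      (e w (\<lambda>x. u x * v x) + e (\<lambda>x. u x * v x) w - e v u - e u v)"
    by (intro tlim_diff tlim_add tlim_tensor[of w "\<lambda>x. u x * v x"] tlim_tensor[of "\<lambda>x. u x * v x" w]
        tlim_tensor assms uv)
  moreover have "w x * (u x * v x) = u x * v x" for x
    using assms(4)[of x] by (simp add: mult.assoc[symmetric])
  then have "ip m w (\<lambda>x. u x * v x) + ip m (\<lambda>x. u x * v x) w - ip m v u - ip m u v = 0"
    unfolding ip_def mult.commute[of _ "w _"] mult.commute[of "v _"] by (simp only: add_diff_cancel_right' diff_self)
  moreover have "(\<lambda>z. w (fst z) * (u (snd z) * v (snd z)) + u (fst z) * v (fst z) * w (snd z)
        - v (fst z) * u (snd z) - u (fst z) * v (snd z)) =
      (\<lambda>z. (u (snd z) - u (fst z)) * (v (snd z) - v (fst z)) * w (fst z) * w (snd z))"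
  proof
    fix z :: "(real^'n) \<times> (real^'n)"
    have expand: "b * (u' * v') + u * v * b' - v * u' - u * v' = (u' - u) * (v' - v) * b * b'"
      if "b * u = u" "b' * u' = u'" "b * v = v" "b' * v' = v'" for b b' u u' v v' :: real
    proof -
      have "(u' - u) * (v' - v) * b * b' = b * (b' * u') * v' - (b * v) * (b' * u') - (b * u) * (b' * v') + (b * u) * v * b'"
        by (simp add: algebra_simps)
      then show ?thesis unfolding that by (simp add: mult.assoc)
    qed
    have "w (fst z) * u (fst z) = u (fst z)" "w (snd z) * u (snd z) = u (snd z)"
      "w (fst z) * v (fst z) = v (fst z)" "w (snd z) * v (snd z) = v (snd z)" by (rule assms)+
    then show "w (fst z) * (u (snd z) * v (snd z)) + u (fst z) * v (fst z) * w (snd z)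
        - v (fst z) * u (snd z) - u (fst z) * v (snd z) =
      (u (snd z) - u (fst z)) * (v (snd z) - v (fst z)) * w (fst z) * w (snd z)"
      by (rule expand)
  qed
  ultimately show ?thesis by simp
qed

text \<open>For large l the integrand over \<open>Lam\<close> is F without its part at distance at
  least \<open>\<zeta> l\<close>. All of F is evaluated by \<open>e\<close> and the removed part by
  \<open>J\<close>; since F is integrable against \<open>J\<close>, the truncation disappears as l
  grows.\<close>

theorem muc_int_eq:
  assumes u: "u \<in> C0inf U" and v: "v \<in> C0inf U" and w: "w \<in> C0inf U"
    and \<epsilon>: "\<epsilon> > 0" "\<And>x y. y \<in> supp u \<union> supp v \<Longrightarrow> dist x y \<le> \<delta> + \<epsilon> \<Longrightarrow> w x = 1"
    and chi: "open N" "supp u \<union> supp v \<subseteq> N" "\<And>x. x \<in> N \<Longrightarrow> chi x = 1"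
  shows "integrable J (\<lambda>z. (u (snd z) - u (fst z)) * (v (snd z) - v (fst z)) * w (fst z) * w (snd z))"
    and "muc_int \<sigma> \<Omega> \<zeta> u v chi = e u v + e v u - e w (\<lambda>x. u x * v x) - e (\<lambda>x. u x * v x) w
    - 2 * (\<integral>z. (u (snd z) - u (fst z)) * (v (snd z) - v (fst z)) * w (fst z) * w (snd z) \<partial>J)"
proof -
  define S where "S = supp u \<union> supp v"
  define F where "F = (\<lambda>z. (u (snd z) - u (fst z)) * (v (snd z) - v (fst z)) * w (fst z) * w (snd z))"
  define X where "X = e w (\<lambda>x. u x * v x) + e (\<lambda>x. u x * v x) w - e v u - e u v"
  have cS: "compact S" unfolding S_def using u v by (auto simp: C0inf_def)
  have w1: "w x = 1" if "dist x y \<le> \<delta>" "y \<in> S" for x y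
    using \<epsilon> that unfolding S_def by (intro \<epsilon>(2)[of y]) auto
  have w1S: "w x = 1" if "x \<in> S" for x using w1[of x x] that \<delta>_pos by simp
  have wu: "w x * u x = u x" for x using w1S[of x] supp_superset[of u x] by (cases "u x = 0") (auto simp: S_def)
  have wv: "w x * v x = v x" for x using w1S[of x] supp_superset[of v x] by (cases "v x = 0") (auto simp: S_def)
  have tF: "tlim F 0 X" unfolding F_def X_def by (rule tensor_product_difference_limit[OF u v w wu wv])
  \<comment> \<open>If u differs at two points, one of them lies in a support, but not necessarily
    the second, at which \<open>chi\<close> is evaluated. Within distance \<eta> of the supports
    \<open>chi\<close> is still 1, so for \<open>\<zeta> l < \<eta>\<close> this makes no
    difference.\<close>
  obtain \<eta> where \<eta>: "\<eta> > 0" "\<And>x y. y \<in> S \<Longrightarrow> dist x y < \<eta> \<Longrightarrow> x \<in> N"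
  proof -
    obtain \<eta> where "\<eta> > 0" "(\<Union>x\<in>S. cball x \<eta>) \<subseteq> N"
      using compact_subset_open_imp_cball_epsilon_subset[OF cS chi(1)] chi(2) unfolding S_def by blast
    then show thesis using that[of \<eta>] by (auto simp: subset_eq dist_commute)
  qed
  have cF: "continuous_on UNIV F" unfolding F_def using u v w
    by (intro continuous_intros continuous_on_compose2[OF smooth_imp_continuous_on[of _ UNIV]]) (auto simp: C0inf_def)
  have K: "compact (supp w \<times> supp w)" "supp w \<times> supp w \<subseteq> U \<times> U" "{z. F z \<noteq> 0} \<subseteq> supp w \<times> supp w"
    using w by (auto simp: C0inf_def F_def intro!: compact_Times supp_superset)
  have near: "fst z \<in> supp w \<and> snd z \<in> supp w \<and> w (fst z) = 1 \<and> w (snd z) = 1 \<and> (dist (fst z) (snd z) < \<eta> \<longrightarrow> chi (snd z) = 1)"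
    if z: "u (snd z) \<noteq> u (fst z)" "dist (fst z) (snd z) \<le> \<delta>" for z
  proof -
    have "u (fst z) \<noteq> 0 \<or> u (snd z) \<noteq> 0" using z by auto
    then have "fst z \<in> S \<or> snd z \<in> S" using supp_superset[of u] by (auto simp: S_def)
    then obtain y where y: "y \<in> S" "y = fst z \<or> y = snd z" by blast
    then have d: "dist (fst z) y \<le> dist (fst z) (snd z)" "dist (snd z) y \<le> dist (fst z) (snd z)"
      by (auto simp: dist_commute)
    have "w (fst z) = 1" "w (snd z) = 1" using w1[OF _ y(1)] d z(2) by (meson order_trans)+
    moreover have "chi (snd z) = 1" if "dist (fst z) (snd z) < \<eta>"
      using that d by (intro chi(3) \<eta>(2)[OF y(1)]) auto
    ultimately show ?thesis by (auto intro: supp_superset)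
  qed
  \<comment> \<open>Both difference factors are Lipschitz, so F is of the order of the squared
    distance.\<close>
  have iF: "integrable J F"
  proof -
    obtain A where A: "A > 0" "\<And>x y. \<bar>u y - u x\<bar> \<le> A * dist x y" using C0inf_lipschitz[OF u] by metis
    obtain B where B: "B > 0" "\<And>x y. \<bar>v y - v x\<bar> \<le> B * dist x y" using C0inf_lipschitz[OF v] by metis
    obtain D where D: "D > 0" "\<And>x. \<bar>w x\<bar> \<le> D" using C0inf_bounded[OF w] by metis
    show ?thesis
    proof (rule integrable_J_quadratic_bound[where C="A * B * D * D" and ?C1.0="supp w"])
      show "F \<in> borel_measurable borel" using cF by (rule borel_measurable_continuous_onI)
      fix z
      show "\<bar>F z\<bar> \<le> A * B * D * D * (indicator (supp w \<times> supp w) z * (dist (fst z) (snd z))\<^sup>2)"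
      proof (cases "F z = 0")
        case True
        then show ?thesis using A B D by simp
      next
        case False
        then have i: "indicator (supp w \<times> supp w) z = (1::real)" using K by auto
        have "\<bar>F z\<bar> \<le> (A * dist (fst z) (snd z)) * (B * dist (fst z) (snd z)) * D * D"
          unfolding F_def abs_mult using A B D by (intro mult_mono mult_nonneg_nonneg) auto
        then show ?thesis by (simp add: i power2_eq_square mult_ac)
      qed
    qed (use w in \<open>auto simp: C0inf_def\<close>)
  qed
  then show "integrable J (\<lambda>z. (u (snd z) - u (fst z)) * (v (snd z) - v (fst z)) * w (fst z) * w (snd z))"
    by (simp only: F_def)
  have "\<forall>\<^sub>F l in sequentially. supp w \<subseteq> \<Omega> l \<and> \<zeta> l < \<delta> \<and> \<zeta> l < \<eta>"
    using w eventually_\<zeta>_less \<delta>_pos \<eta> by (intro eventually_conj eventually_subset_\<Omega>) (auto simp: C0inf_def)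
  then have "\<forall>\<^sub>F l in sequentially. - X - 2 * (\<integral>z. indicator {z. dist (fst z) (snd z) \<ge> \<zeta> l} z * F z \<partial>J) =
     Lim at_top (\<lambda>\<beta>. \<beta> * (\<integral>z. indicator (Lam \<Omega> \<zeta> l) z * (u (snd z) - u (fst z)) * (v (snd z) - v (fst z)) * chi (snd z) \<partial>(\<sigma> \<beta>)))"
  proof eventually_elim
    case (elim l)
    define I where "I = (\<lambda>z::(real^'n) \<times> (real^'n). indicator {z. dist (fst z) (snd z) \<ge> \<zeta> l} z :: real)"
    have vI: "vconv (\<lambda>z. I z * F z)" unfolding I_def
    proof (rule vconv_\<zeta>[OF cF K])
      fix z assume "F z \<noteq> 0" "dist (fst z) (snd z) = \<zeta> l"
      then have "fst z \<in> supp w \<and> snd z \<in> supp w" using elim by (intro conjI) (use near[of z] in \<open>auto simp: F_def\<close>)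
      then show "fst z \<in> \<Omega> l \<and> snd z \<in> \<Omega> l" using elim by blast
    qed
    have eq: "indicator (Lam \<Omega> \<zeta> l) z * (u (snd z) - u (fst z)) * (v (snd z) - v (fst z)) * chi (snd z) = F z - I z * F z" for z
    proof (cases "dist (fst z) (snd z) \<ge> \<zeta> l \<or> u (snd z) = u (fst z)")
      case True
      then show ?thesis by (auto simp: I_def F_def Lam_def indicator_def)
    next
      case False
      then have z: "fst z \<in> supp w" "snd z \<in> supp w" "w (fst z) = 1" "w (snd z) = 1" "chi (snd z) = 1"
        using near[of z] elim by auto
      then have "z \<in> Lam \<Omega> \<zeta> l" using False elim by (auto simp: Lam_def case_prod_unfold)
      then show ?thesis using False z by (simp add: I_def F_def)
    qed
    have "((\<lambda>\<beta>. \<beta> * (\<integral>z. F z \<partial>\<sigma> \<beta>) - \<beta> * (\<integral>z. I z * F z \<partial>\<sigma> \<beta>)) \<longlongrightarrow> - X - 2 * (\<integral>z. I z * F z \<partial>J)) at_top"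
      using vI by (intro tendsto_diff tlim_0 tF) (simp add: vconv_def)
    moreover have "\<forall>\<^sub>F \<beta> in at_top. \<beta> * (\<integral>z. F z \<partial>\<sigma> \<beta>) - \<beta> * (\<integral>z. I z * F z \<partial>\<sigma> \<beta>) = \<beta> * (\<integral>z. F z - I z * F z \<partial>\<sigma> \<beta>)"
      using eventually_gt_at_top[of 0]
    proof eventually_elim
      case (elim \<beta>)
      then have "integrable (\<sigma> \<beta>) F" "integrable (\<sigma> \<beta>) (\<lambda>z. I z * F z)"
        using tF vI by (auto simp: tlim_def vconv_def)
      then show ?case by (simp add: right_diff_distrib)
    qed
    ultimately have "((\<lambda>\<beta>. \<beta> * (\<integral>z. F z - I z * F z \<partial>\<sigma> \<beta>)) \<longlongrightarrow> - X - 2 * (\<integral>z. I z * F z \<partial>J)) at_top"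
      by (rule Lim_transform_eventually)
    then show ?case unfolding eq by (simp add: I_def tendsto_Lim)
  qed
  moreover have "(\<lambda>l. - X - 2 * (\<integral>z. indicator {z. dist (fst z) (snd z) \<ge> \<zeta> l} z * F z \<partial>J)) \<longlonglongrightarrow> - X - 2 * (\<integral>z. F z \<partial>J)"
    by (intro tendsto_intros J_integral_truncation_tendsto iF) (simp add: F_def)
  ultimately have "muc_int \<sigma> \<Omega> \<zeta> u v chi = - X - 2 * (\<integral>z. F z \<partial>J)"
    unfolding muc_int_def by (intro limI) (rule Lim_transform_eventually)
  then show "muc_int \<sigma> \<Omega> \<zeta> u v chi = e u v + e v u - e w (\<lambda>x. u x * v x) - e (\<lambda>x. u x * v x) w
    - 2 * (\<integral>z. (u (snd z) - u (fst z)) * (v (snd z) - v (fst z)) * w (fst z) * w (snd z) \<partial>J)"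
    by (simp add: X_def F_def)
qed

text \<open>\<open>H a\<close> is the compensated jump integrand. The \<open>Lam\<close> part is F
  without its far part, the \<open>Gam\<close> part is the drift term P at distances from
  \<open>\<zeta> l\<close> to \<open>dk k\<close>. The whole of F is evaluated by \<open>e\<close>;
  the other pieces combine to -2 times the integral of \<open>H (dk k)\<close> against
  \<open>J\<close> over distances at least \<open>\<zeta> l\<close>.\<close>

theorem Ec_eq:
  assumes u: "u \<in> C0inf U" and v: "v \<in> C0inf U" and w: "w \<in> C0inf U"
    and \<epsilon>: "\<epsilon> > 0" "\<And>x y. y \<in> supp u \<union> supp v \<Longrightarrow> dist x y \<le> \<delta> + \<epsilon> \<Longrightarrow> w x = 1"
  defines "H \<equiv> \<lambda>a z. ((u (snd z) - u (fst z)) - (\<Sum>i\<in>UNIV. (snd z $ i - fst z $ i) * pd i u (snd z)) *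
     indicator {z. dist (fst z) (snd z) \<le> a} z) * v (snd z) * w (fst z)"
  shows "integrable J (H \<delta>)"
    and "Ec \<sigma> \<Omega> \<zeta> dk u v = e u v - e w (\<lambda>x. u x * v x) - 2 * (\<integral>z. H \<delta> z \<partial>J)"
proof -
  define S where "S = supp u \<union> supp v"
  define F where "F = (\<lambda>z. (u (snd z) - u (fst z)) * v (snd z) * w (fst z))"
  define D where "D = (\<lambda>z::(real^'n) \<times> (real^'n). \<Sum>i\<in>UNIV. (snd z $ i - fst z $ i) * pd i u (snd z))"
  define P where "P = (\<lambda>z. D z * v (snd z) * w (fst z))"
  define X where "X = e w (\<lambda>x. u x * v x) - e u v"
  have w1: "w x = 1" if "dist x y \<le> \<delta> + \<epsilon>" "y \<in> S" for x y
    using that unfolding S_def by (intro \<epsilon>(2)[of y]) auto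
  have w1S: "w x = 1" if "x \<in> S" for x using w1[of x x] that \<delta>_pos \<epsilon> by simp
  have wu: "w x * u x = u x" for x using w1S[of x] supp_superset[of u x] by (cases "u x = 0") (auto simp: S_def)
  have tF: "tlim F 0 X" unfolding F_def X_def by (rule tensor_difference_limit[OF u v w wu])
  have cont: "continuous_on UNIV (\<lambda>z. f (snd z))" "continuous_on UNIV (\<lambda>z. f (fst z))" if "smooth f"
    for f :: "real^'n \<Rightarrow> real"
    by (intro continuous_on_compose2[OF smooth_imp_continuous_on[OF that, of UNIV]] continuous_intros; simp)+
  have su: "smooth u" "smooth v" "smooth w" "\<And>i. smooth (pd i u)" using u v w by (auto simp: C0inf_def smooth_pd)
  have cD: "continuous_on UNIV D" unfolding D_def by (intro continuous_intros cont su)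
  have cF: "continuous_on UNIV F" unfolding F_def by (intro continuous_intros cont su)
  have cP: "continuous_on UNIV P" unfolding P_def by (intro continuous_intros cont su cD)
  have K: "compact (supp w \<times> supp v)" "supp w \<times> supp v \<subseteq> U \<times> U" "{z. F z \<noteq> 0} \<subseteq> supp w \<times> supp v"
     "{z. P z \<noteq> 0} \<subseteq> supp w \<times> supp v"
    using w v by (auto simp: C0inf_def F_def P_def intro!: compact_Times supp_superset)
  have near: "fst z \<in> supp w \<and> snd z \<in> supp w \<and> w (fst z) = 1"
    if z: "v (snd z) \<noteq> 0" "dist (fst z) (snd z) \<le> \<delta> + \<epsilon>" for z
  proof -
    have "snd z \<in> S" using z supp_superset[of v "snd z"] by (auto simp: S_def)
    then have "w (fst z) = 1" "w (snd z) = 1" using w1 w1S z by auto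
    then show ?thesis by (auto intro: supp_superset)
  qed
  have H_eq: "H a z = F z - P z * indicator {z. dist (fst z) (snd z) \<le> a} z" for a z
    by (simp add: H_def F_def P_def D_def algebra_simps)
  have mH: "H a \<in> borel_measurable borel" for a
    unfolding H_eq[abs_def] using dist_sets
    by (intro borel_measurable_diff borel_measurable_times borel_measurable_indicator borel_measurable_continuous_onI cF cP)
  define C1 where "C1 = supp w \<union> supp v"
  have C1: "compact C1" "C1 \<subseteq> U" using v w by (auto simp: C1_def C0inf_def)
  \<comment> \<open>Up to distance a Taylor's formula gives the quadratic bound. Beyond a the drift
    term is absent, but the distance d is at least \<delta>, so the Lipschitz bound L d is at most
    (L / \<delta>) d^2. The constant serves all a between \<delta> and \<delta> +
    \<epsilon>.\<close>
  obtain C where C: "\<And>a z. \<delta> \<le> a \<Longrightarrow> a \<le> \<delta> + \<epsilon> \<Longrightarrow> \<bar>H a z\<bar> \<le> C * (indicator (C1 \<times> C1) z * (dist (fst z) (snd z))\<^sup>2)"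
  proof -
    obtain A where A: "A > 0" "\<And>x y. \<bar>u y - u x - (\<Sum>i\<in>UNIV. (y $ i - x $ i) * pd i u y)\<bar> \<le> A * (dist x y)\<^sup>2"
      by (rule C0inf_taylor[OF u]) (rule that)
    obtain B where B: "B > 0" "\<And>x. \<bar>v x\<bar> \<le> B" using C0inf_bounded[OF v] by metis
    obtain W where W: "W > 0" "\<And>x. \<bar>w x\<bar> \<le> W" using C0inf_bounded[OF w] by metis
    obtain L where L: "L > 0" "\<And>x y. \<bar>u y - u x\<bar> \<le> L * dist x y" using C0inf_lipschitz[OF u] by metis
    have "\<bar>H a z\<bar> \<le> ((A + L / \<delta>) * B * W) * (indicator (C1 \<times> C1) z * (dist (fst z) (snd z))\<^sup>2)"
      if a: "\<delta> \<le> a" "a \<le> \<delta> + \<epsilon>" for a z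
    proof (cases "v (snd z) * w (fst z) = 0")
      case True
      have "(A + L / \<delta>) * B * W \<ge> 0" using A B W L \<delta>_pos by simp
      moreover have "H a z = 0" using True by (auto simp: H_def)
      ultimately show ?thesis by simp
    next
      case False
      define d where "d = dist (fst z) (snd z)"
      have i: "indicator (C1 \<times> C1) z = (1::real)"
        using False supp_superset[of v "snd z"] supp_superset[of w "fst z"]  by (cases z) (auto simp: C1_def)
      have "\<bar>(u (snd z) - u (fst z)) - D z * indicator {z. dist (fst z) (snd z) \<le> a} z\<bar> \<le> (A + L / \<delta>) * d\<^sup>2"
      proof (cases "d \<le> a")
        case True
        have "A * d\<^sup>2 \<le> (A + L / \<delta>) * d\<^sup>2" using L \<delta>_pos by (intro mult_right_mono) auto
        then show ?thesis using True A(2)[of "snd z" "fst z"] by (simp add: d_def D_def)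
      next
        case False
        then have "d \<ge> \<delta>" using a by simp
        have "L * d * \<delta> \<le> L * d * d" using L \<open>d \<ge> \<delta>\<close> by (intro mult_left_mono) (auto simp: d_def)
        then have "L * d \<le> L / \<delta> * d\<^sup>2" using \<delta>_pos by (simp add: field_simps power2_eq_square)
        also have "\<dots> \<le> (A + L / \<delta>) * d\<^sup>2" using A by (intro mult_right_mono) auto
        finally show ?thesis using False L(2)[of "snd z" "fst z"] by (simp add: d_def)
      qed
      then have "\<bar>H a z\<bar> \<le> (A + L / \<delta>) * d\<^sup>2 * B * W"
        unfolding H_def abs_mult D_def[symmetric] using A B W L \<delta>_pos
        by (intro mult_mono mult_nonneg_nonneg) (auto simp: D_def)
      then show ?thesis by (simp add: i d_def mult_ac)
    qed
    then show thesis by (rule that)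
  qed
  have iH: "integrable J (H a)" if "\<delta> \<le> a" "a \<le> \<delta> + \<epsilon>" for a
    using C1 mH C[OF that] by (rule integrable_J_quadratic_bound)
  show "integrable J (H \<delta>)" using iH \<epsilon> by simp
  define Y where "Y = (\<lambda>k l \<beta>. \<beta> *
      ((\<integral>z. indicator (Lam \<Omega> \<zeta> l) z * (u (snd z) - u (fst z)) * v (snd z) \<partial>(\<sigma> \<beta>)) +
       (\<integral>z. indicator (Gam \<Omega> \<zeta> l) z * (\<Sum>i\<in>UNIV. (snd z $ i - fst z $ i) * pd i u (snd z)) *
             indicator {w. dist (fst w) (snd w) \<le> dk k} z * v (snd z) \<partial>(\<sigma> \<beta>))))"
  \<comment> \<open>The condition on k puts every x occurring in the \<open>Gam\<close> part within
    \<delta> + \<epsilon> of the support of v, where w is 1, so that w(x) can be inserted.\<close>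
  have step_l: "(\<lambda>l. Lim at_top (Y k l)) \<longlonglongrightarrow> - X - 2 * (\<integral>z. H (dk k) z \<partial>J)" if k: "dk k < \<delta> + \<epsilon>" for k
  proof -
    have "\<forall>\<^sub>F l in sequentially. C1 \<subseteq> \<Omega> l \<and> \<zeta> l < \<delta>"
      using eventually_\<zeta>_less \<delta>_pos C1 by (intro eventually_conj eventually_subset_\<Omega>) auto
    then have "\<forall>\<^sub>F l in sequentially. - X - 2 * (\<integral>z. indicator {z. dist (fst z) (snd z) \<ge> \<zeta> l} z * H (dk k) z \<partial>J) =
       Lim at_top (Y k l)"
    proof eventually_elim
      case (elim l)
      define I where "I = (\<lambda>z::(real^'n) \<times> (real^'n). indicator {z. dist (fst z) (snd z) \<ge> \<zeta> l} z :: real)"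
      define I' where "I' = (\<lambda>z::(real^'n) \<times> (real^'n). indicator {z. dist (fst z) (snd z) > dk k} z :: real)"
      have zk: "\<zeta> l < dk k" using elim dk_ge[of k] by simp
      have inO: "fst z \<in> \<Omega> l \<and> snd z \<in> \<Omega> l \<and> w (fst z) = 1" if "v (snd z) \<noteq> 0" "dist (fst z) (snd z) \<le> \<delta> + \<epsilon>" for z
        using near[OF that] elim by (auto simp: C1_def)
      have inO': "fst z \<in> \<Omega> l \<and> snd z \<in> \<Omega> l" if "v (snd z) \<noteq> 0" "dist (fst z) (snd z) = \<zeta> l" for z
        using inO[of z] that elim \<epsilon> by auto
      have vF: "vconv (\<lambda>z. I z * F z)" unfolding I_def
        by (rule vconv_\<zeta>[OF cF K(1-3)]) (rule inO', auto simp: F_def)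
      have vP: "vconv (\<lambda>z. I z * P z)" unfolding I_def
        by (rule vconv_\<zeta>[OF cP K(1,2,4)]) (rule inO', auto simp: P_def)
      have vP': "vconv (\<lambda>z. I' z * P z)" unfolding I'_def by (rule vconv_dk[OF cP K(1,2,4)])
      have eq1: "indicator (Lam \<Omega> \<zeta> l) z * (u (snd z) - u (fst z)) * v (snd z) = F z - I z * F z" for z
      proof (cases "dist (fst z) (snd z) \<ge> \<zeta> l \<or> v (snd z) = 0")
        case True
        then show ?thesis by (auto simp: I_def F_def Lam_def indicator_def)
      next
        case False
        then have z: "fst z \<in> \<Omega> l" "snd z \<in> \<Omega> l" "w (fst z) = 1" using inO[of z] elim \<epsilon> by auto
        then have "z \<in> Lam \<Omega> \<zeta> l" using False elim by (auto simp: Lam_def case_prod_unfold)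
        then show ?thesis using False z by (simp add: I_def F_def)
      qed
      have eq2: "indicator (Gam \<Omega> \<zeta> l) z * (\<Sum>i\<in>UNIV. (snd z $ i - fst z $ i) * pd i u (snd z)) *
             indicator {w. dist (fst w) (snd w) \<le> dk k} z * v (snd z) = I z * P z - I' z * P z" for z
      proof (cases "dist (fst z) (snd z) < \<zeta> l \<or> dist (fst z) (snd z) > dk k \<or> v (snd z) = 0")
        case True
        then show ?thesis using zk by (auto simp: I_def I'_def P_def Gam_def indicator_def)
      next
        case False
        then have z: "fst z \<in> \<Omega> l" "snd z \<in> \<Omega> l" "w (fst z) = 1" using inO[of z] k by auto
        then have "z \<in> Gam \<Omega> \<zeta> l" using False by (auto simp: Gam_def case_prod_unfold)
        then show ?thesis using False z by (simp add: I_def I'_def P_def D_def)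
      qed
      \<comment> \<open>Because of \<open>\<zeta> l < dk k\<close>, the indicator of the band
        between the two thresholds is \<open>I - I'\<close>.\<close>
      have eq3: "I z * H (dk k) z = I z * F z - (I z * P z - I' z * P z)" for z
        using zk by (auto simp: H_eq I_def I'_def indicator_def)
      have "((\<lambda>\<beta>. \<beta> * (\<integral>z. F z \<partial>\<sigma> \<beta>) - \<beta> * (\<integral>z. I z * F z \<partial>\<sigma> \<beta>) + (\<beta> * (\<integral>z. I z * P z \<partial>\<sigma> \<beta>) - \<beta> * (\<integral>z. I' z * P z \<partial>\<sigma> \<beta>)))
         \<longlongrightarrow> - X - 2 * (\<integral>z. I z * F z \<partial>J) + (2 * (\<integral>z. I z * P z \<partial>J) - 2 * (\<integral>z. I' z * P z \<partial>J))) at_top"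
        using vF vP vP' by (intro tendsto_add tendsto_diff tlim_0 tF) (simp_all add: vconv_def)
      moreover have "\<forall>\<^sub>F \<beta> in at_top. \<beta> * (\<integral>z. F z \<partial>\<sigma> \<beta>) - \<beta> * (\<integral>z. I z * F z \<partial>\<sigma> \<beta>) + (\<beta> * (\<integral>z. I z * P z \<partial>\<sigma> \<beta>) - \<beta> * (\<integral>z. I' z * P z \<partial>\<sigma> \<beta>)) = Y k l \<beta>"
        using eventually_gt_at_top[of 0]
      proof eventually_elim
        case (elim \<beta>)
        then have "integrable (\<sigma> \<beta>) F" "integrable (\<sigma> \<beta>) (\<lambda>z. I z * F z)"
          "integrable (\<sigma> \<beta>) (\<lambda>z. I z * P z)" "integrable (\<sigma> \<beta>) (\<lambda>z. I' z * P z)"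
          using tF vF vP vP' by (auto simp: tlim_def vconv_def)
        then show ?case unfolding Y_def eq1 eq2 by (simp add: algebra_simps)
      qed
      ultimately have "(Y k l \<longlongrightarrow> - X - 2 * (\<integral>z. I z * F z \<partial>J) + (2 * (\<integral>z. I z * P z \<partial>J) - 2 * (\<integral>z. I' z * P z \<partial>J))) at_top"
        by (rule Lim_transform_eventually)
      moreover have "(\<integral>z. I z * H (dk k) z \<partial>J) = (\<integral>z. I z * F z \<partial>J) - ((\<integral>z. I z * P z \<partial>J) - (\<integral>z. I' z * P z \<partial>J))"
        unfolding eq3 using vF vP vP' by (simp add: vconv_def)
      moreover have "- X - 2 * a + (2 * b - 2 * c) = - X - 2 * (a - (b - c))" for a b c :: real by simp
      ultimately have "(Y k l \<longlongrightarrow> - X - 2 * (\<integral>z. I z * H (dk k) z \<partial>J)) at_top" by metis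
      then show ?case by (simp add: I_def tendsto_Lim)
    qed
    moreover have "(\<lambda>l. - X - 2 * (\<integral>z. indicator {z. dist (fst z) (snd z) \<ge> \<zeta> l} z * H (dk k) z \<partial>J)) \<longlonglongrightarrow> - X - 2 * (\<integral>z. H (dk k) z \<partial>J)"
      using iH[of "dk k"] k dk_ge[of k]
      by (intro tendsto_intros J_integral_truncation_tendsto) (auto simp: H_def)
    ultimately show ?thesis by (rule Lim_transform_eventually[rotated])
  qed
  have evk: "\<forall>\<^sub>F k in sequentially. dk k < \<delta> + \<epsilon>" using dk_lim \<epsilon> by (intro order_tendstoD) auto
  then have "\<forall>\<^sub>F k in sequentially. - X - 2 * (\<integral>z. H (dk k) z \<partial>J) = lim (\<lambda>l. Lim at_top (Y k l))"
    by eventually_elim (rule limI[OF step_l, symmetric])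
  moreover have "(\<lambda>k. - X - 2 * (\<integral>z. H (dk k) z \<partial>J)) \<longlonglongrightarrow> - X - 2 * (\<integral>z. H \<delta> z \<partial>J)"
  proof (intro tendsto_intros)
    \<comment> \<open>The bound C is available only up to \<delta> + \<epsilon>. Capping the
      thresholds there gives a sequence that is dominated for every k and eventually agrees with the
      original one.\<close>
    define d where "d = (\<lambda>k. min (dk k) (\<delta> + \<epsilon>))"
    have d: "\<delta> \<le> d k" "d k \<le> \<delta> + \<epsilon>" for k using dk_ge[of k] \<epsilon> by (auto simp: d_def)
    have "(\<lambda>k. \<integral>z. H (d k) z \<partial>J) \<longlonglongrightarrow> (\<integral>z. H \<delta> z \<partial>J)"
    proof (rule integral_dominated_convergence[where w="\<lambda>z. C * (indicator (C1 \<times> C1) z * (dist (fst z) (snd z))\<^sup>2)"])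
      show "H \<delta> \<in> borel_measurable J" "H (d k) \<in> borel_measurable J" for k
        using mH sets_J measurable_cong_sets by blast+
      show "integrable J (\<lambda>z. C * (indicator (C1 \<times> C1) z * (dist (fst z) (snd z))\<^sup>2))"
        by (intro integrable_mult_right integrable_J_quadratic C1)
      show "AE z in J. norm (H (d k) z) \<le> C * (indicator (C1 \<times> C1) z * (dist (fst z) (snd z))\<^sup>2)" for k
        using C[OF d] by (intro AE_I2) (simp only: real_norm_def)
      show "AE z in J. (\<lambda>k. H (d k) z) \<longlonglongrightarrow> H \<delta> z"
      proof (rule AE_I2)
        fix z
        have "\<forall>\<^sub>F k in sequentially. H \<delta> z = H (d k) z"
        proof (cases "dist (fst z) (snd z) \<le> \<delta>")
          case True
          \<comment> \<open>The thresholds never drop below \<delta>. Pairs at distance exactly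
            \<delta>, which may carry mass of \<open>J\<close>, are thus included throughout, as
            they are in the limit.\<close>
          have "dist (fst z) (snd z) \<le> d k" for k using d[of k] True by simp
          then show ?thesis using True by (simp add: H_eq)
        next
          case False
          then have "\<forall>\<^sub>F k in sequentially. dk k < dist (fst z) (snd z)"
            using dk_lim by (intro order_tendstoD) auto
          then show ?thesis
          proof eventually_elim
            case (elim k)
            then have "\<not> dist (fst z) (snd z) \<le> d k" by (auto simp: d_def)
            then show ?case using False by (simp add: H_eq)
          qed
        qed
        then show "(\<lambda>k. H (d k) z) \<longlonglongrightarrow> H \<delta> z" by (rule Lim_transform_eventually[OF tendsto_const])
      qed
    qed
    moreover have "\<forall>\<^sub>F k in sequentially. (\<integral>z. H (d k) z \<partial>J) = (\<integral>z. H (dk k) z \<partial>J)"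
      using evk by eventually_elim (simp add: d_def)
    ultimately show "(\<lambda>k. \<integral>z. H (dk k) z \<partial>J) \<longlonglongrightarrow> (\<integral>z. H \<delta> z \<partial>J)"
      by (rule Lim_transform_eventually)
  qed
  ultimately have "Ec \<sigma> \<Omega> \<zeta> dk u v = - X - 2 * (\<integral>z. H \<delta> z \<partial>J)"
    unfolding Ec_def Y_def by (intro limI) (rule Lim_transform_eventually)
  then show "Ec \<sigma> \<Omega> \<zeta> dk u v = e u v - e w (\<lambda>x. u x * v x) - 2 * (\<integral>z. H \<delta> z \<partial>J)"
    by (simp add: X_def)
qed

end

section \<open>Riesz representation and Lax--Milgram in a space of functions\<close>

lemma quadratic_nonneg_imp_0:
  fixes a b :: real
  assumes "\<And>s. s\<^sup>2 * a + 2 * s * b \<ge> 0" "a \<ge> 0" shows "b = 0"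
proof -
  \<comment> \<open>The denominator a + 1 in place of a, which would give the minimiser, still makes
    the expression negative unless b = 0, and it covers a = 0.\<close>
  have "0 \<le> (- b / (a + 1))\<^sup>2 * a + 2 * (- b / (a + 1)) * b" by (rule assms)
  also have "\<dots> = - (b\<^sup>2 * (a + 2)) / (a + 1)\<^sup>2"
    using assms(2) by (simp add: divide_simps power2_eq_square) (simp add: algebra_simps)
  finally have "b\<^sup>2 * (a + 2) / (a + 1)\<^sup>2 \<le> 0" by simp
  then have "b\<^sup>2 * (a + 2) \<le> 0" using assms(2) by (subst (asm) divide_le_0_iff) auto
  then have "b\<^sup>2 \<le> 0" using assms(2) by (simp add: mult_le_0_iff)
  then show ?thesis by simp
qed

text \<open>Functions that agree almost everywhere are different elements of D, so B is only
  positive semidefinite and limits are determined up to B-null functions.\<close>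

locale semi_hilbert =
  fixes D :: "('a \<Rightarrow> real) set" and B :: "('a \<Rightarrow> real) \<Rightarrow> ('a \<Rightarrow> real) \<Rightarrow> real"
  assumes nonempty: "D \<noteq> {}"
    and comb: "f \<in> D \<Longrightarrow> g \<in> D \<Longrightarrow> (\<lambda>x. a * f x + b * g x) \<in> D"
    and B_comb: "f \<in> D \<Longrightarrow> g \<in> D \<Longrightarrow> h \<in> D \<Longrightarrow> B (\<lambda>x. a * f x + b * g x) h = a * B f h + b * B g h"
    and B_sym: "f \<in> D \<Longrightarrow> g \<in> D \<Longrightarrow> B f g = B g f"
    and B_nonneg: "f \<in> D \<Longrightarrow> B f f \<ge> 0"
    and complete: "\<And>s. (\<And>k. s k \<in> D) \<Longrightarrow>
        (\<And>\<epsilon>. \<epsilon> > 0 \<Longrightarrow> \<exists>N. \<forall>i\<ge>N. \<forall>j\<ge>N. B (\<lambda>x. s i x - s j x) (\<lambda>x. s i x - s j x) < \<epsilon>) \<Longrightarrow>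
        \<exists>u\<in>D. (\<lambda>k. B (\<lambda>x. s k x - u x) (\<lambda>x. s k x - u x)) \<longlonglongrightarrow> 0"
begin

definition bounded_functional :: "(('a \<Rightarrow> real) \<Rightarrow> real) \<Rightarrow> bool" where
  "bounded_functional \<phi> \<longleftrightarrow>
    (\<forall>f\<in>D. \<forall>g\<in>D. \<forall>a b. \<phi> (\<lambda>x. a * f x + b * g x) = a * \<phi> f + b * \<phi> g) \<and>
    (\<exists>c. \<forall>f\<in>D. \<bar>\<phi> f\<bar> \<le> c * sqrt (B f f))"

lemma bounded_functional_comb:
  "bounded_functional \<phi> \<Longrightarrow> f \<in> D \<Longrightarrow> g \<in> D \<Longrightarrow> \<phi> (\<lambda>x. a * f x + b * g x) = a * \<phi> f + b * \<phi> g"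
  by (simp add: bounded_functional_def)

lemma B_comb_right: "f \<in> D \<Longrightarrow> g \<in> D \<Longrightarrow> h \<in> D \<Longrightarrow> B h (\<lambda>x. a * f x + b * g x) = a * B h f + b * B h g"
  using B_comb[of f g h a b] B_sym[of h "\<lambda>x. a * f x + b * g x"] B_sym[of h f] B_sym[of h g] comb by simp

lemma diff_mem: "f \<in> D \<Longrightarrow> g \<in> D \<Longrightarrow> (\<lambda>x. f x - g x) \<in> D"
  using comb[of f g 1 "-1"] by simp

lemma B_diff: "f \<in> D \<Longrightarrow> g \<in> D \<Longrightarrow> h \<in> D \<Longrightarrow> B (\<lambda>x. f x - g x) h = B f h - B g h"
  using B_comb[of f g h 1 "-1"] by simp

lemma B_comb_square:
  assumes "f \<in> D" "g \<in> D"
  shows "B (\<lambda>x. a * f x + b * g x) (\<lambda>x. a * f x + b * g x) = a\<^sup>2 * B f f + 2 * a * b * B f g + b\<^sup>2 * B g g"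
  using assms by (simp add: B_comb B_comb_right comb B_sym[of g f] power2_eq_square algebra_simps)

lemma B_diff_square:
  assumes "f \<in> D" "g \<in> D"
  shows "B (\<lambda>x. f x - g x) (\<lambda>x. f x - g x) = B f f - 2 * B f g + B g g"
  using B_comb_square[OF assms, of 1 "-1"] by simp

lemma cauchy_schwarz:
  assumes "f \<in> D" "g \<in> D" shows "\<bar>B f g\<bar> \<le> sqrt (B f f) * sqrt (B g g)"
proof -
  define p q r where "p = B f f" and "q = B g g" and "r = B f g"
  have pos: "p \<ge> 0" "q \<ge> 0" using assms B_nonneg by (auto simp: p_def q_def)
  have quad: "a\<^sup>2 * p + 2 * a * b * r + b\<^sup>2 * q \<ge> 0" for a b
    using B_nonneg[OF comb[OF assms, of a b]] B_comb_square[OF assms, of a b] by (simp add: p_def q_def r_def)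
  have "r\<^sup>2 \<le> p * q"
  proof (cases "q = 0")
    case True
    have "r = 0"
    proof (rule ccontr)
      assume "r \<noteq> 0"
      \<comment> \<open>With q = 0 the quadratic expression takes the value -1 at these
        arguments.\<close>
      then show False using quad[of 1 "- (p + 1) / (2 * r)"] True by (simp add: field_simps)
    qed
    then show ?thesis using True by simp
  next
    case False
    then have "q > 0" using pos by simp
    have "q\<^sup>2 * p + 2 * q * (- r) * r + (- r)\<^sup>2 * q \<ge> 0" by (rule quad)
    then have "q * (p * q - r\<^sup>2) \<ge> 0" by (simp add: power2_eq_square algebra_simps)
    then show ?thesis using \<open>q > 0\<close> by (simp add: zero_le_mult_iff)
  qed
  then have "sqrt (r\<^sup>2) \<le> sqrt (p * q)" by (rule real_sqrt_le_mono)
  then show ?thesis by (simp add: p_def q_def r_def real_sqrt_mult)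
qed

lemma tendsto_inner:
  assumes "\<And>n. p n \<in> D" "u \<in> D" "(\<lambda>n. B (\<lambda>x. p n x - u x) (\<lambda>x. p n x - u x)) \<longlonglongrightarrow> 0"
    and "bounded_functional \<phi>"
  shows "(\<lambda>n. \<phi> (p n)) \<longlonglongrightarrow> \<phi> u"
proof -
  obtain c where c: "\<And>f. f \<in> D \<Longrightarrow> \<bar>\<phi> f\<bar> \<le> c * sqrt (B f f)"
    using assms(4) unfolding bounded_functional_def by blast
  have "(\<lambda>n. \<phi> (p n) - \<phi> u) \<longlonglongrightarrow> 0"
  proof (rule Lim_null_comparison)
    have "\<phi> (p n) - \<phi> u = \<phi> (\<lambda>x. p n x - u x)" for n
      using bounded_functional_comb[OF assms(4,1,2), of 1 n "-1"] by simp
    then show "\<forall>\<^sub>F n in sequentially. norm (\<phi> (p n) - \<phi> u) \<le> c * sqrt (B (\<lambda>x. p n x - u x) (\<lambda>x. p n x - u x))"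
      using c[OF diff_mem[OF assms(1,2)]] by simp
    have "(\<lambda>n. c * sqrt (B (\<lambda>x. p n x - u x) (\<lambda>x. p n x - u x))) \<longlonglongrightarrow> c * sqrt 0"
      by (intro tendsto_intros assms)
    then show "(\<lambda>n. c * sqrt (B (\<lambda>x. p n x - u x) (\<lambda>x. p n x - u x))) \<longlonglongrightarrow> 0" by simp
  qed
  then show ?thesis by (simp add: LIM_zero_iff)
qed

lemma bounded_functional_inner:
  assumes "u \<in> D" shows "bounded_functional (B u)"
proof -
  have "\<bar>B u f\<bar> \<le> sqrt (B u u) * sqrt (B f f)" if "f \<in> D" for f
    using assms that by (rule cauchy_schwarz)
  then show ?thesis unfolding bounded_functional_def using assms B_comb_right by blast
qed

text \<open>By the parallelogram law, near-minimisers of \<open>\<lambda>f. B f f - 2 * \<phi> f\<close> over a decreasing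
  sequence of convex sets form a Cauchy sequence.\<close>
lemma near_minimizers_converge:
  assumes C: "\<And>n. C n \<subseteq> D" "\<And>n k. n \<le> k \<Longrightarrow> C k \<subseteq> C n"
    "\<And>n f g. f \<in> C n \<Longrightarrow> g \<in> C n \<Longrightarrow> (\<lambda>x. (1/2) * f x + (1/2) * g x) \<in> C n"
    and \<phi>: "bounded_functional \<phi>"
    and upper: "\<And>n. \<exists>f\<in>C n. B f f - 2 * \<phi> f \<le> M"
  obtains p u where "\<And>n. p n \<in> C n" "u \<in> D"
    "(\<lambda>n. B (\<lambda>x. p n x - u x) (\<lambda>x. p n x - u x)) \<longlonglongrightarrow> 0"
    "\<And>f. f \<in> (\<Inter>n. C n) \<Longrightarrow> B u u - 2 * \<phi> u \<le> B f f - 2 * \<phi> f"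
proof -
  define \<J> where "\<J> = (\<lambda>f. B f f - 2 * \<phi> f)"
  obtain c where c: "\<And>f. f \<in> D \<Longrightarrow> \<bar>\<phi> f\<bar> \<le> c * sqrt (B f f)"
    using \<phi> unfolding bounded_functional_def by blast
  have lower: "\<J> f \<ge> - c\<^sup>2" if "f \<in> D" for f
  proof -
    have "0 \<le> (sqrt (B f f) - c)\<^sup>2" by simp
    also have "\<dots> = B f f - 2 * (c * sqrt (B f f)) + c\<^sup>2"
      using B_nonneg[OF that] by (simp add: power2_diff mult_ac)
    also have "\<dots> \<le> \<J> f + c\<^sup>2" using c[OF that] by (simp add: \<J>_def)
    finally show ?thesis by simp
  qed
  have mid: "B (\<lambda>x. f x - g x) (\<lambda>x. f x - g x) =
      2 * \<J> f + 2 * \<J> g - 4 * \<J> (\<lambda>x. (1/2) * f x + (1/2) * g x)" if fg: "f \<in> D" "g \<in> D" for f g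
    unfolding \<J>_def B_diff_square[OF fg] B_comb_square[OF fg] bounded_functional_comb[OF \<phi> fg]
    by (simp add: power2_eq_square algebra_simps)
  define d where "d = (\<lambda>n. Inf (\<J> ` C n))"
  have bdd: "bdd_below (\<J> ` C n)" for n
    by (rule bdd_belowI2[where m="- c\<^sup>2"]) (use lower C(1) in blast)
  have dle: "d n \<le> \<J> f" if "f \<in> C n" for n f
    unfolding d_def using bdd that by (intro cInf_lower) auto
  have ne: "C n \<noteq> {}" for n using upper by blast
  have "\<exists>f\<in>C n. \<J> f < d n + 1 / real (Suc n)" for n
  proof -
    have "d n < d n + 1 / real (Suc n)" by simp
    then show ?thesis unfolding d_def using ne[of n] bdd[of n] cInf_less_iff[of "\<J> ` C n"] by blast
  qed
  then obtain p where p: "\<And>n. p n \<in> C n" "\<And>n. \<J> (p n) < d n + 1 / real (Suc n)" by metis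
  have pD: "p n \<in> D" for n using p C by blast
  have "incseq d"
    unfolding incseq_def d_def using ne bdd C(2) by (intro allI impI cInf_superset_mono) (auto simp: image_mono)
  moreover have "d n \<le> M" for n using upper[of n] dle by (force simp: \<J>_def)
  ultimately obtain L where L: "d \<longlonglongrightarrow> L" "\<And>n. d n \<le> L"
    using incseq_convergent by metis
  have cauchy: "\<exists>N. \<forall>i\<ge>N. \<forall>j\<ge>N. B (\<lambda>x. p i x - p j x) (\<lambda>x. p i x - p j x) < \<epsilon>" if \<epsilon>: "\<epsilon> > 0" for \<epsilon>
  proof -
    have "\<forall>\<^sub>F n in sequentially. d n > L - \<epsilon> / 8"
      using L(1) \<epsilon> by (intro order_tendstoD) auto
    moreover have "\<forall>\<^sub>F n in sequentially. 1 / real (Suc n) < \<epsilon> / 8"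
      using LIMSEQ_Suc[OF lim_1_over_n] \<epsilon> by (intro order_tendstoD) auto
    ultimately obtain N where N: "\<And>n. n \<ge> N \<Longrightarrow> d n > L - \<epsilon> / 8" "\<And>n. n \<ge> N \<Longrightarrow> 1 / real (Suc n) < \<epsilon> / 8"
      by (metis (mono_tags, lifting) eventually_conj eventually_sequentially)
    \<comment> \<open>By \<open>mid\<close> the square is below 4 (L + \<epsilon>/8) - 4 (L -
      \<epsilon>/8), which is \<epsilon>.\<close>
    have "B (\<lambda>x. p i x - p j x) (\<lambda>x. p i x - p j x) < \<epsilon>" if ij: "i \<ge> N" "j \<ge> N" for i j
    proof -
      have "p i \<in> C N" "p j \<in> C N" using p(1) C(2) ij by blast+
      then have "\<J> (\<lambda>x. (1/2) * p i x + (1/2) * p j x) \<ge> d N" by (intro dle C(3))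
      moreover have "d N > L - \<epsilon> / 8" using N by simp
      moreover have "\<J> (p i) < L + \<epsilon> / 8" "\<J> (p j) < L + \<epsilon> / 8"
        using p(2)[of i] p(2)[of j] N(2)[OF ij(1)] N(2)[OF ij(2)] L(2)[of i] L(2)[of j] by linarith+
      ultimately show ?thesis unfolding mid[OF pD pD] by linarith
    qed
    then show ?thesis by blast
  qed
  obtain u where u: "u \<in> D" "(\<lambda>n. B (\<lambda>x. p n x - u x) (\<lambda>x. p n x - u x)) \<longlonglongrightarrow> 0"
    using complete[OF pD cauchy] by blast
  \<comment> \<open>Expanding around u expresses the quadratic functional through a null sequence
    and bounded linear functionals of \<open>p n\<close>, all of which are known to
    converge.\<close>
  have "(\<lambda>n. B (\<lambda>x. p n x - u x) (\<lambda>x. p n x - u x) + 2 * B u (p n) - B u u - 2 * \<phi> (p n)) \<longlonglongrightarrow> 0 + 2 * B u u - B u u - 2 * \<phi> u"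
    by (intro tendsto_intros u tendsto_inner[OF pD u] bounded_functional_inner \<phi>)
  moreover have "B (\<lambda>x. p n x - u x) (\<lambda>x. p n x - u x) + 2 * B u (p n) - B u u - 2 * \<phi> (p n) = \<J> (p n)" for n
    using B_diff_square[OF pD u(1)] B_sym[OF pD u(1)] by (simp add: \<J>_def)
  ultimately have Ju: "(\<lambda>n. \<J> (p n)) \<longlonglongrightarrow> \<J> u" by (simp add: \<J>_def)
  show thesis
  proof (rule that[OF p(1) u])
    fix f assume f: "f \<in> (\<Inter>n. C n)"
    have "\<J> u \<le> \<J> f"
    proof (rule LIMSEQ_le[OF Ju])
      have "(\<lambda>n. \<J> f + 1 / real (Suc n)) \<longlonglongrightarrow> \<J> f + 0"
        by (intro tendsto_intros LIMSEQ_Suc[OF lim_1_over_n])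
      then show "(\<lambda>n. \<J> f + 1 / real (Suc n)) \<longlonglongrightarrow> \<J> f" by simp
      show "\<exists>N. \<forall>n\<ge>N. \<J> (p n) \<le> \<J> f + 1 / real (Suc n)"
      proof (intro exI allI impI)
        fix n
        have "d n \<le> \<J> f" using f by (intro dle) auto
        then show "\<J> (p n) \<le> \<J> f + 1 / real (Suc n)" using p(2)[of n] by linarith
      qed
    qed
    then show "B u u - 2 * \<phi> u \<le> B f f - 2 * \<phi> f" by (simp add: \<J>_def)
  qed
qed

text \<open>The constant sequence of sets D yields a minimiser of
  \<open>B f f - 2 * \<phi> f\<close>; the vanishing of its first variation in direction w is the
  claim.\<close>

theorem riesz_representation:
  assumes \<phi>: "bounded_functional \<phi>"
  obtains u where "u \<in> D" "\<And>w. w \<in> D \<Longrightarrow> B u w = \<phi> w"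
proof -
  obtain f0 where "f0 \<in> D" using nonempty by blast
  then have "\<exists>M. \<forall>n::nat. \<exists>f\<in>D. B f f - 2 * \<phi> f \<le> M" by blast
  then obtain M where M: "\<And>n::nat. \<exists>f\<in>D. B f f - 2 * \<phi> f \<le> M" by blast
  obtain p u where u: "u \<in> D" "\<And>f. f \<in> D \<Longrightarrow> B u u - 2 * \<phi> u \<le> B f f - 2 * \<phi> f"
  proof (rule near_minimizers_converge[of "\<lambda>_. D" \<phi> M])
    show "(\<lambda>x. 1 / 2 * f x + 1 / 2 * g x) \<in> D" if "f \<in> D" "g \<in> D" for f g using that by (rule comb)
  qed (use \<phi> M in auto)
  have "B u w = \<phi> w" if w: "w \<in> D" for w
  proof -
    have "s\<^sup>2 * B w w + 2 * s * (B u w - \<phi> w) \<ge> 0" for s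
    proof -
      have "B u u - 2 * \<phi> u \<le> B (\<lambda>x. 1 * u x + s * w x) (\<lambda>x. 1 * u x + s * w x) - 2 * \<phi> (\<lambda>x. 1 * u x + s * w x)"
        by (intro u comb w)
      then show ?thesis
        unfolding B_comb_square[OF u(1) w] bounded_functional_comb[OF \<phi> u(1) w]
        by (simp add: algebra_simps)
    qed
    from quadratic_nonneg_imp_0[OF this B_nonneg[OF w]] show ?thesis by simp
  qed
  then show thesis using u that by blast
qed

text \<open>Riesz for \<open>B\<close> represents \<open>a\<close> by an operator \<open>T\<close>; Riesz for the equivalent form
  \<open>B (T g) (T h)\<close> then inverts \<open>T\<close>.\<close>
theorem lax_milgram:
  assumes a_left: "\<And>f g h a' b. f \<in> D \<Longrightarrow> g \<in> D \<Longrightarrow> h \<in> D \<Longrightarrow> a (\<lambda>x. a' * f x + b * g x) h = a' * a f h + b * a g h"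
    and a_right: "\<And>f g h a' b. f \<in> D \<Longrightarrow> g \<in> D \<Longrightarrow> h \<in> D \<Longrightarrow> a h (\<lambda>x. a' * f x + b * g x) = a' * a h f + b * a h g"
    and bounded: "\<And>f g. f \<in> D \<Longrightarrow> g \<in> D \<Longrightarrow> \<bar>a f g\<bar> \<le> c * sqrt (B f f) * sqrt (B g g)"
    and coercive: "\<alpha> > 0" "\<And>f. f \<in> D \<Longrightarrow> \<alpha> * B f f \<le> a f f"
    and \<phi>: "bounded_functional \<phi>"
  shows "\<exists>g\<in>D. \<forall>w\<in>D. a g w = \<phi> w"
proof -
  have "\<exists>t\<in>D. \<forall>w\<in>D. B t w = a f w" if f: "f \<in> D" for f
  proof -
    have "bounded_functional (a f)"
      unfolding bounded_functional_def using a_right bounded f by (auto intro!: exI[of _ "c * sqrt (B f f)"])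
    then show ?thesis using riesz_representation[of "a f"] by metis
  qed
  then obtain T where T: "\<And>f. f \<in> D \<Longrightarrow> T f \<in> D" "\<And>f w. f \<in> D \<Longrightarrow> w \<in> D \<Longrightarrow> B (T f) w = a f w"
    by metis
  obtain r where r: "r \<in> D" "\<And>w. w \<in> D \<Longrightarrow> B r w = \<phi> w" using riesz_representation[OF \<phi>] by blast
  have low: "\<alpha>\<^sup>2 * B f f \<le> B (T f) (T f)" if f: "f \<in> D" for f
  proof (cases "B f f = 0")
    case True
    then show ?thesis using B_nonneg[OF T(1)[OF f]] by simp
  next
    case False
    then have pos: "sqrt (B f f) > 0" using B_nonneg[OF f] by simp
    have "\<alpha> * B f f \<le> sqrt (B (T f) (T f)) * sqrt (B f f)"
      using coercive(2)[OF f] cauchy_schwarz[OF T(1)[OF f] f] T(2)[OF f f] by linarith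
    also have "\<alpha> * B f f = \<alpha> * sqrt (B f f) * sqrt (B f f)" using B_nonneg[OF f] by simp
    finally have "\<alpha> * sqrt (B f f) \<le> sqrt (B (T f) (T f))" using pos by simp
    then have "(\<alpha> * sqrt (B f f))\<^sup>2 \<le> (sqrt (B (T f) (T f)))\<^sup>2"
      using coercive(1) pos by (intro power_mono) auto
    then show ?thesis using B_nonneg[OF f] B_nonneg[OF T(1)[OF f]] by (simp add: power_mult_distrib)
  qed
  have up: "B (T f) (T f) \<le> c\<^sup>2 * B f f" if f: "f \<in> D" for f
  proof (cases "B (T f) (T f) = 0")
    case True
    then show ?thesis using B_nonneg[OF f] by simp
  next
    case False
    then have pos: "sqrt (B (T f) (T f)) > 0" using B_nonneg[OF T(1)[OF f]] by simp
    have "B (T f) (T f) \<le> c * sqrt (B f f) * sqrt (B (T f) (T f))"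
      using bounded[OF f T(1)[OF f]] T(2)[OF f T(1)[OF f]] by linarith
    moreover have "B (T f) (T f) = sqrt (B (T f) (T f)) * sqrt (B (T f) (T f))" using B_nonneg[OF T(1)[OF f]] by simp
    ultimately have "sqrt (B (T f) (T f)) * sqrt (B (T f) (T f)) \<le> c * sqrt (B f f) * sqrt (B (T f) (T f))" by simp
    then have "sqrt (B (T f) (T f)) \<le> c * sqrt (B f f)" by (rule mult_right_le_imp_le) (rule pos)
    then have "(sqrt (B (T f) (T f)))\<^sup>2 \<le> (c * sqrt (B f f))\<^sup>2" using pos by (intro power_mono) auto
    then show ?thesis using B_nonneg[OF f] B_nonneg[OF T(1)[OF f]] by (simp add: power_mult_distrib)
  qed
  \<comment> \<open>T comes from a choice and is linear only up to B-null functions, so bilinearity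
    of the new form is read off from \<open>a\<close>. The bounds \<open>low\<close> and
    \<open>up\<close> make the two seminorms equivalent, which carries completeness over.\<close>
  interpret T: semi_hilbert D "\<lambda>f g. B (T f) (T g)"
  proof
    show "D \<noteq> {}" by (rule nonempty)
    show "(\<lambda>x. a * f x + b * g x) \<in> D" if "f \<in> D" "g \<in> D" for f g a b using that by (rule comb)
    show "B (T (\<lambda>x. a' * f x + b * g x)) (T h) = a' * B (T f) (T h) + b * B (T g) (T h)"
      if "f \<in> D" "g \<in> D" "h \<in> D" for f g h a' b
      using that T comb a_left by simp
    show "B (T f) (T g) = B (T g) (T f)" if "f \<in> D" "g \<in> D" for f g using that T B_sym by simp
    show "0 \<le> B (T f) (T f)" if "f \<in> D" for f by (rule B_nonneg[OF T(1)[OF that]])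
    fix s :: "nat \<Rightarrow> 'a \<Rightarrow> real" assume s: "\<And>k. s k \<in> D" and cau: "\<And>\<epsilon>. \<epsilon> > 0 \<Longrightarrow> \<exists>N. \<forall>i\<ge>N. \<forall>j\<ge>N. B (T (\<lambda>x. s i x - s j x)) (T (\<lambda>x. s i x - s j x)) < \<epsilon>"
    have "\<exists>N. \<forall>i\<ge>N. \<forall>j\<ge>N. B (\<lambda>x. s i x - s j x) (\<lambda>x. s i x - s j x) < \<epsilon>" if "\<epsilon> > 0" for \<epsilon>
    proof -
      obtain N where N: "\<And>i j. i \<ge> N \<Longrightarrow> j \<ge> N \<Longrightarrow> B (T (\<lambda>x. s i x - s j x)) (T (\<lambda>x. s i x - s j x)) < \<alpha>\<^sup>2 * \<epsilon>"
        using cau[of "\<alpha>\<^sup>2 * \<epsilon>"] \<open>\<epsilon> > 0\<close> coercive(1) by auto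
      have "B (\<lambda>x. s i x - s j x) (\<lambda>x. s i x - s j x) < \<epsilon>" if "i \<ge> N" "j \<ge> N" for i j
      proof -
        have "\<alpha>\<^sup>2 * B (\<lambda>x. s i x - s j x) (\<lambda>x. s i x - s j x) < \<alpha>\<^sup>2 * \<epsilon>"
          using low[OF diff_mem[OF s s]] N[OF that] by (rule order_le_less_trans)
        then show ?thesis using coercive(1) by simp
      qed
      then show ?thesis by blast
    qed
    from complete[OF s this] obtain u where u: "u \<in> D" "(\<lambda>k. B (\<lambda>x. s k x - u x) (\<lambda>x. s k x - u x)) \<longlonglongrightarrow> 0"
      by blast
    have "(\<lambda>k. B (T (\<lambda>x. s k x - u x)) (T (\<lambda>x. s k x - u x))) \<longlonglongrightarrow> 0"
    proof (rule Lim_null_comparison)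
      show "\<forall>\<^sub>F k in sequentially. norm (B (T (\<lambda>x. s k x - u x)) (T (\<lambda>x. s k x - u x))) \<le> c\<^sup>2 * B (\<lambda>x. s k x - u x) (\<lambda>x. s k x - u x)"
        using up[OF diff_mem[OF s u(1)]] B_nonneg[OF T(1)[OF diff_mem[OF s u(1)]]] by simp
      show "(\<lambda>k. c\<^sup>2 * B (\<lambda>x. s k x - u x) (\<lambda>x. s k x - u x)) \<longlonglongrightarrow> 0"
        using tendsto_mult_left[OF u(2), of "c\<^sup>2"] by simp
    qed
    then show "\<exists>u\<in>D. (\<lambda>k. B (T (\<lambda>x. s k x - u x)) (T (\<lambda>x. s k x - u x))) \<longlonglongrightarrow> 0" using u by blast
  qed
  have rT: "B r (T h) = a h r" if "h \<in> D" for h using that r T B_sym by simp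
  have "T.bounded_functional (\<lambda>h. B r (T h))"
    unfolding T.bounded_functional_def
  proof (intro conjI ballI allI exI)
    show "\<bar>B r (T h)\<bar> \<le> sqrt (B r r) * sqrt (B (T h) (T h))" if "h \<in> D" for h
      using that r T by (intro cauchy_schwarz)
    show "B r (T (\<lambda>x. a * f x + b * g x)) = a * B r (T f) + b * B r (T g)" if "f \<in> D" "g \<in> D" for f g a b
      using that by (simp add: rT comb a_left r)
  qed
  then obtain g where g: "g \<in> D" "\<And>h. h \<in> D \<Longrightarrow> B (T g) (T h) = B r (T h)"
    using T.riesz_representation by metis
  define h where "h = (\<lambda>x. T g x - r x)"
  have hD: "h \<in> D" unfolding h_def using g r T by (intro diff_mem)
  \<comment> \<open>Testing the equation for g with h itself gives \<open>a h h = 0\<close>. By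
    coercivity h is B-null, so B does not distinguish \<open>T g\<close> from r.\<close>
  have "a h h = B (T g) (T h) - B r (T h)"
    using T(2)[OF hD hD] B_sym[OF hD T(1)[OF hD]] B_diff[OF T(1)[OF g(1)] r(1) T(1)[OF hD]] by (simp add: h_def)
  then have "\<alpha> * B h h \<le> 0" using coercive(2)[OF hD] g(2)[OF hD] by simp
  then have hh: "B h h = 0" using coercive(1) B_nonneg[OF hD] by (simp add: mult_le_0_iff)
  have "a g w = \<phi> w" if w: "w \<in> D" for w
  proof -
    have "B h w = 0" using cauchy_schwarz[OF hD w] hh by simp
    then have "B (T g) w = B r w" using B_diff[OF T(1)[OF g(1)] r(1) w] by (simp add: h_def)
    then show ?thesis using T(2)[OF g(1) w] r(2)[OF w] by simp
  qed
  then show ?thesis using g by blast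
qed

text \<open>This takes the place of weak compactness. If the claim failed, the sets on which \<phi>
  is at least \<epsilon> and q is small would contain near-minimisers of the norm that converge
  strongly; the limit would have q = 0 and \<phi> at least \<epsilon>.\<close>

lemma bounded_functional_small:
  fixes q :: "('a \<Rightarrow> real) \<Rightarrow> real"
  assumes \<phi>: "bounded_functional \<phi>"
    and q: "\<And>f. f \<in> D \<Longrightarrow> 0 \<le> q f" "\<And>f. f \<in> D \<Longrightarrow> q f \<le> B f f"
      "\<And>f g a b. f \<in> D \<Longrightarrow> g \<in> D \<Longrightarrow> q (\<lambda>x. a * f x + b * g x) \<le> 2 * a\<^sup>2 * q f + 2 * b\<^sup>2 * q g"
    and null: "\<And>f. f \<in> D \<Longrightarrow> q f = 0 \<Longrightarrow> \<phi> f = 0"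
    and "\<epsilon> > 0"
  shows "\<exists>\<eta>>0. \<forall>f\<in>D. B f f \<le> M \<longrightarrow> q f \<le> \<eta> \<longrightarrow> \<phi> f < \<epsilon>"
proof (rule ccontr)
  assume "\<not> ?thesis"
  then have neg: "\<exists>f\<in>D. B f f \<le> M \<and> q f \<le> \<eta> \<and> \<phi> f \<ge> \<epsilon>" if "\<eta> > 0" for \<eta>
    using that by (meson not_less)
  define C where "C = (\<lambda>n. {f\<in>D. \<phi> f \<ge> \<epsilon> \<and> q f \<le> 1 / real (Suc n)})"
  have zero: "bounded_functional (\<lambda>_. 0)"
    unfolding bounded_functional_def by (auto intro: exI[of _ 0])
  obtain p u where p: "\<And>n. p n \<in> C n" "u \<in> D" "(\<lambda>n. B (\<lambda>x. p n x - u x) (\<lambda>x. p n x - u x)) \<longlonglongrightarrow> 0"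
  proof (rule near_minimizers_converge[of C "\<lambda>_. 0" M])
    show "C k \<subseteq> C n" if "n \<le> k" for n k
    proof -
      have "1 / real (Suc k) \<le> 1 / real (Suc n)" using that by (simp add: frac_le)
      then show ?thesis by (auto simp: C_def)
    qed
    show "(\<lambda>x. 1 / 2 * f x + 1 / 2 * g x) \<in> C n" if fg: "f \<in> C n" "g \<in> C n" for n f g
    proof -
      have D: "f \<in> D" "g \<in> D" using fg by (auto simp: C_def)
      \<comment> \<open>With both coefficients 1/2 the factors 2 a^2 and 2 b^2 become 1/2, so the
        bound on q survives the midpoint.\<close>
      have "q (\<lambda>x. 1 / 2 * f x + 1 / 2 * g x) \<le> 1 / real (Suc n)"
        using q(3)[OF D, of "1/2" "1/2"] fg by (simp add: C_def power2_eq_square)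
      moreover have "\<phi> (\<lambda>x. 1 / 2 * f x + 1 / 2 * g x) \<ge> \<epsilon>"
        using bounded_functional_comb[OF \<phi> D, of "1/2" "1/2"] fg by (simp add: C_def)
      ultimately show ?thesis using comb[OF D, of "1/2" "1/2"] by (simp add: C_def)
    qed
    show "\<exists>f\<in>C n. B f f - 2 * 0 \<le> M" for n
      using neg[of "1 / real (Suc n)"] by (auto simp: C_def)
  qed (use zero in \<open>auto simp: C_def\<close>)
  have pD: "p n \<in> D" for n using p(1)[of n] by (simp add: C_def)
  have "q u \<le> 2 * B (\<lambda>x. p n x - u x) (\<lambda>x. p n x - u x) + 2 * (1 / real (Suc n))" for n
  proof -
    have "q (\<lambda>x. 1 * p n x + (-1) * (p n x - u x)) \<le> 2 * 1\<^sup>2 * q (p n) + 2 * (-1)\<^sup>2 * q (\<lambda>x. p n x - u x)"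
      by (rule q(3)[OF pD diff_mem[OF pD p(2)]])
    moreover have "q (\<lambda>x. p n x - u x) \<le> B (\<lambda>x. p n x - u x) (\<lambda>x. p n x - u x)"
      by (rule q(2)[OF diff_mem[OF pD p(2)]])
    moreover have "q (p n) \<le> 1 / real (Suc n)" using p(1)[of n] by (simp add: C_def)
    ultimately show ?thesis by simp
  qed
  moreover have "(\<lambda>n. 2 * B (\<lambda>x. p n x - u x) (\<lambda>x. p n x - u x) + 2 * (1 / real (Suc n))) \<longlonglongrightarrow> 2 * 0 + 2 * 0"
    by (intro tendsto_intros p LIMSEQ_Suc[OF lim_1_over_n])
  ultimately have "q u \<le> 2 * 0 + 2 * 0" by (intro LIMSEQ_le_const) auto
  then have "\<phi> u = 0" using null[OF p(2)] q(1)[OF p(2)] by simp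
  moreover have "\<phi> u \<ge> \<epsilon>"
    by (rule LIMSEQ_le_const[OF tendsto_inner[OF pD p(2,3) \<phi>]]) (use p(1) in \<open>auto simp: C_def\<close>)
  ultimately show False using \<open>\<epsilon> > 0\<close> by simp
qed

end

section \<open>Square-integrable functions\<close>

lemma L2_mult_integrable:
  assumes "L2 m f" "L2 m g" shows "integrable m (\<lambda>x. f x * g x)"
proof (rule Bochner_Integration.integrable_bound)
  show "integrable m (\<lambda>x. (f x)\<^sup>2 + (g x)\<^sup>2)" using assms by (auto simp: L2_def)
  show "(\<lambda>x. f x * g x) \<in> borel_measurable m" using assms by (auto simp: L2_def)
  have "\<bar>a * b\<bar> \<le> a\<^sup>2 + b\<^sup>2" for a b :: real
  proof -
    have "2 * (\<bar>a\<bar> * \<bar>b\<bar>) \<le> \<bar>a\<bar>\<^sup>2 + \<bar>b\<bar>\<^sup>2" using sum_squares_bound[of "\<bar>a\<bar>" "\<bar>b\<bar>"] by simp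
    moreover have "0 \<le> \<bar>a\<bar> * \<bar>b\<bar>" by simp
    ultimately show ?thesis unfolding abs_mult power2_abs by linarith
  qed
  then show "AE x in m. norm (f x * g x) \<le> norm ((f x)\<^sup>2 + (g x)\<^sup>2)" by auto
qed

lemma L2_comb:
  assumes "L2 m f" "L2 m g" shows "L2 m (\<lambda>x. a * f x + b * g x)"
proof -
  have eq: "(\<lambda>x. (a * f x + b * g x)\<^sup>2) = (\<lambda>x. a\<^sup>2 * (f x)\<^sup>2 + 2 * a * b * (f x * g x) + b\<^sup>2 * (g x)\<^sup>2)"
    by (auto simp: power2_eq_square algebra_simps)
  show ?thesis
    using assms L2_mult_integrable[OF assms] unfolding L2_def eq
    by (intro conjI borel_measurable_add borel_measurable_times Bochner_Integration.integrable_add integrable_mult_right) auto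
qed

lemma L2_diff: "L2 m f \<Longrightarrow> L2 m g \<Longrightarrow> L2 m (\<lambda>x. f x - g x)"
  using L2_comb[of m f g 1 "-1"] by simp

lemma L2_zero: "L2 m (\<lambda>x. 0)"
  by (simp add: L2_def)

lemma ip_commute: "ip m f g = ip m g f"
  by (simp add: ip_def mult.commute)

lemma ip_comb: "L2 m f \<Longrightarrow> L2 m g \<Longrightarrow> L2 m h \<Longrightarrow> ip m (\<lambda>x. a * f x + b * g x) h = a * ip m f h + b * ip m g h"
  using L2_mult_integrable[of m f h] L2_mult_integrable[of m g h] by (simp add: ip_def distrib_right mult.assoc)

lemma ip_comb_right: "L2 m f \<Longrightarrow> L2 m g \<Longrightarrow> L2 m h \<Longrightarrow> ip m h (\<lambda>x. a * f x + b * g x) = a * ip m h f + b * ip m h g"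
  using ip_comb[of m f g h a b] by (simp add: ip_commute[of m h])

lemma ip_diff: "L2 m f \<Longrightarrow> L2 m g \<Longrightarrow> L2 m h \<Longrightarrow> ip m (\<lambda>x. f x - g x) h = ip m f h - ip m g h"
  using ip_comb[of m f g h 1 "-1"] by simp

lemma ip_nonneg: "ip m f f \<ge> 0"
  by (simp add: ip_def)

lemma l2norm_power2: "(l2norm m f)\<^sup>2 = ip m f f"
  by (simp add: l2norm_def ip_def power2_eq_square)

lemma l2norm_nonneg: "l2norm m f \<ge> 0"
  by (simp add: l2norm_def)

lemma l2norm_eq: "l2norm m f = sqrt (ip m f f)"
  by (simp add: l2norm_def ip_def power2_eq_square)

lemma ip_comb_square_le:
  assumes "L2 m f" "L2 m g"
  shows "ip m (\<lambda>x. a * f x + b * g x) (\<lambda>x. a * f x + b * g x) \<le> 2 * a\<^sup>2 * ip m f f + 2 * b\<^sup>2 * ip m g g"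
proof -
  have square: "ip m (\<lambda>x. a * f x + b * g x) (\<lambda>x. a * f x + b * g x) =
      a\<^sup>2 * ip m f f + 2 * a * b * ip m f g + b\<^sup>2 * ip m g g" for b
    using assms by (simp add: ip_comb ip_comb_right L2_comb ip_commute[of m g f] power2_eq_square algebra_simps)
  have "0 \<le> ip m (\<lambda>x. a * f x + (- b) * g x) (\<lambda>x. a * f x + (- b) * g x)" by (rule ip_nonneg)
  then show ?thesis unfolding square by (simp add: mult_ac)
qed

lemma ip_eq_0_imp_AE:
  assumes "L2 m f" "ip m f f = 0" shows "AE x in m. f x = 0"
proof -
  have "AE x in m. (f x)\<^sup>2 = 0"
    using assms by (subst integral_nonneg_eq_0_iff_AE[symmetric]) (auto simp: L2_def ip_def power2_eq_square)
  then show ?thesis by simp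
qed

lemma ip_cauchy_schwarz:
  assumes "L2 m f" "L2 m g" shows "\<bar>ip m f g\<bar> \<le> l2norm m f * l2norm m g"
proof -
  have "a\<^sup>2 * ip m f f + 2 * a * b * ip m f g + b\<^sup>2 * ip m g g \<ge> 0" for a b
  proof -
    have "0 \<le> ip m (\<lambda>x. a * f x + b * g x) (\<lambda>x. a * f x + b * g x)" by (rule ip_nonneg)
    then show ?thesis
      using assms by (simp add: ip_comb ip_comb_right L2_comb ip_commute[of m g f] power2_eq_square algebra_simps)
  qed
  note quad = this
  have "(ip m f g)\<^sup>2 \<le> ip m f f * ip m g g"
  proof (cases "ip m g g = 0")
    case True
    from ip_eq_0_imp_AE[OF assms(2) this] have "ip m f g = 0"
      unfolding ip_def by (intro integral_eq_zero_AE) auto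
    then show ?thesis using True by simp
  next
    case False
    then have pos: "ip m g g > 0" using ip_nonneg[of m g] by simp
    have "(ip m g g)\<^sup>2 * ip m f f + 2 * ip m g g * (- ip m f g) * ip m f g + (- ip m f g)\<^sup>2 * ip m g g \<ge> 0" by (rule quad)
    then have "ip m g g * (ip m f f * ip m g g - (ip m f g)\<^sup>2) \<ge> 0" by (simp add: power2_eq_square algebra_simps)
    then show ?thesis using pos by (simp add: zero_le_mult_iff)
  qed
  then have "sqrt ((ip m f g)\<^sup>2) \<le> sqrt (ip m f f * ip m g g)" by (rule real_sqrt_le_mono)
  then show ?thesis by (simp add: l2norm_eq real_sqrt_mult)
qed

section \<open>Resolvents of a closed form\<close>

locale closed_form =
  fixes m :: "'a measure" and D :: "('a \<Rightarrow> real) set" and E :: "('a \<Rightarrow> real) \<Rightarrow> ('a \<Rightarrow> real) \<Rightarrow> real"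
  assumes D_L2: "f \<in> D \<Longrightarrow> L2 m f"
    and D_nonempty: "D \<noteq> {}"
    and D_comb: "f \<in> D \<Longrightarrow> g \<in> D \<Longrightarrow> (\<lambda>x. a * f x + b * g x) \<in> D"
    and E_AE: "f \<in> D \<Longrightarrow> L2 m g \<Longrightarrow> AE x in m. f x = g x \<Longrightarrow> w \<in> D \<Longrightarrow> E g w = E f w"
    and E_left: "f \<in> D \<Longrightarrow> g \<in> D \<Longrightarrow> h \<in> D \<Longrightarrow> E (\<lambda>x. a * f x + b * g x) h = a * E f h + b * E g h"
    and E_right: "f \<in> D \<Longrightarrow> g \<in> D \<Longrightarrow> h \<in> D \<Longrightarrow> E h (\<lambda>x. a * f x + b * g x) = a * E h f + b * E h g"
    and E_nonneg: "f \<in> D \<Longrightarrow> E f f \<ge> 0"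
    and E_sector: "\<exists>C. \<forall>u\<in>D. \<forall>v\<in>D. \<bar>E u v + ip m u v\<bar> \<le> C * sqrt (E u u + ip m u u) * sqrt (E v v + ip m v v)"
    and E_complete: "\<And>s. (\<And>k. s k \<in> D) \<Longrightarrow>
        (\<And>\<epsilon>. \<epsilon> > 0 \<Longrightarrow> \<exists>N. \<forall>i\<ge>N. \<forall>j\<ge>N. E (\<lambda>x. s i x - s j x) (\<lambda>x. s i x - s j x)
            + ip m (\<lambda>x. s i x - s j x) (\<lambda>x. s i x - s j x) < \<epsilon>) \<Longrightarrow>
        \<exists>u\<in>D. (\<lambda>k. E (\<lambda>x. s k x - u x) (\<lambda>x. s k x - u x)
            + ip m (\<lambda>x. s k x - u x) (\<lambda>x. s k x - u x)) \<longlonglongrightarrow> 0"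
begin

text \<open>The symmetric part of E plus the L2 inner product. Symmetrising does not change the
  diagonal, which is all that completeness and the sector condition refer to.\<close>

definition E1 :: "('a \<Rightarrow> real) \<Rightarrow> ('a \<Rightarrow> real) \<Rightarrow> real" where
  "E1 f g = (E f g + E g f) / 2 + ip m f g"

lemma E1_same: "E1 f f = E f f + ip m f f"
  by (simp add: E1_def)

lemma ip_le_E1: "f \<in> D \<Longrightarrow> ip m f f \<le> E1 f f"
  using E_nonneg by (simp add: E1_same)

sublocale semi_hilbert D E1
proof
  show "D \<noteq> {}" by (rule D_nonempty)
  show "(\<lambda>x. a * f x + b * g x) \<in> D" if "f \<in> D" "g \<in> D" for f g a b using that by (rule D_comb)
  show "E1 (\<lambda>x. a * f x + b * g x) h = a * E1 f h + b * E1 g h" if "f \<in> D" "g \<in> D" "h \<in> D" for f g h a b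
    using that by (simp add: E1_def E_left E_right ip_comb D_L2 algebra_simps add_divide_distrib)
  show "E1 f g = E1 g f" for f g by (simp add: E1_def ip_commute)
  show "0 \<le> E1 f f" if "f \<in> D" for f using E_nonneg[OF that] ip_nonneg[of m f] by (simp add: E1_same)
  show "\<exists>u\<in>D. (\<lambda>k. E1 (\<lambda>x. s k x - u x) (\<lambda>x. s k x - u x)) \<longlonglongrightarrow> 0"
    if "\<And>k. s k \<in> D" "\<And>\<epsilon>. \<epsilon> > 0 \<Longrightarrow> \<exists>N. \<forall>i\<ge>N. \<forall>j\<ge>N. E1 (\<lambda>x. s i x - s j x) (\<lambda>x. s i x - s j x) < \<epsilon>" for s
    using E_complete[of s] that unfolding E1_same .
qed

lemma ip_le_sqrt_E1: "f \<in> D \<Longrightarrow> g \<in> D \<Longrightarrow> \<bar>ip m f g\<bar> \<le> sqrt (E1 f f) * sqrt (E1 g g)"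
proof -
  assume fg: "f \<in> D" "g \<in> D"
  have "\<bar>ip m f g\<bar> \<le> sqrt (ip m f f) * sqrt (ip m g g)"
    using ip_cauchy_schwarz[OF D_L2[OF fg(1)] D_L2[OF fg(2)]] by (simp add: l2norm_eq)
  also have "\<dots> \<le> sqrt (E1 f f) * sqrt (E1 g g)"
    using fg by (intro mult_mono real_sqrt_le_mono ip_le_E1) (auto simp: ip_nonneg B_nonneg)
  finally show ?thesis .
qed

lemma sector: obtains C where "C \<ge> 0" "\<And>f g. f \<in> D \<Longrightarrow> g \<in> D \<Longrightarrow> \<bar>E f g\<bar> \<le> C * sqrt (E1 f f) * sqrt (E1 g g)"
proof -
  obtain C where C: "\<And>u v. u \<in> D \<Longrightarrow> v \<in> D \<Longrightarrow> \<bar>E u v + ip m u v\<bar> \<le> C * sqrt (E1 u u) * sqrt (E1 v v)"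
    using E_sector unfolding E1_same by blast
  have "\<bar>E f g\<bar> \<le> (\<bar>C\<bar> + 1) * sqrt (E1 f f) * sqrt (E1 g g)" if fg: "f \<in> D" "g \<in> D" for f g
  proof -
    have "0 \<le> sqrt (E1 f f) * sqrt (E1 g g)" using fg B_nonneg by simp
    then have "C * (sqrt (E1 f f) * sqrt (E1 g g)) \<le> \<bar>C\<bar> * (sqrt (E1 f f) * sqrt (E1 g g))"
      by (intro mult_right_mono) auto
    then have "\<bar>E f g\<bar> \<le> \<bar>C\<bar> * (sqrt (E1 f f) * sqrt (E1 g g)) + sqrt (E1 f f) * sqrt (E1 g g)"
      using C[OF fg] ip_le_sqrt_E1[OF fg] unfolding mult.assoc by linarith
    then show ?thesis by (simp add: algebra_simps)
  qed
  then show thesis using that[of "\<bar>C\<bar> + 1"] by auto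
qed

lemma bounded_functional_ip: "L2 m u \<Longrightarrow> bounded_functional (ip m u)"
proof -
  assume u: "L2 m u"
  have "\<bar>ip m u f\<bar> \<le> l2norm m u * sqrt (E1 f f)" if "f \<in> D" for f
  proof -
    have "l2norm m f \<le> sqrt (E1 f f)" using that by (simp add: l2norm_eq ip_le_E1)
    then have "l2norm m u * l2norm m f \<le> l2norm m u * sqrt (E1 f f)"
      by (intro mult_left_mono l2norm_nonneg)
    then show ?thesis using ip_cauchy_schwarz[OF u D_L2[OF that]] by linarith
  qed
  then show ?thesis unfolding bounded_functional_def using u D_L2 ip_comb_right by blast
qed

text \<open>Adding \<beta> times the inner product makes the form coercive for \<open>E1\<close>
  with constant \<open>min 1 \<beta>\<close>. The diagonal does not depend on the order of the
  arguments, so the co-resolvent comes from the same theorem for the transposed form.\<close>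

lemma resolvents_exist:
  assumes "\<beta> > 0" "L2 m u"
  shows "\<exists>g\<in>D. \<forall>w\<in>D. E g w + \<beta> * ip m g w = ip m u w"
    and "\<exists>h\<in>D. \<forall>w\<in>D. E w h + \<beta> * ip m w h = ip m w u"
proof -
  obtain C where C: "C \<ge> 0" "\<And>f g. f \<in> D \<Longrightarrow> g \<in> D \<Longrightarrow> \<bar>E f g\<bar> \<le> C * sqrt (E1 f f) * sqrt (E1 g g)"
    using sector by blast
  have bound: "\<bar>E f g + \<beta> * ip m f g\<bar> \<le> (C + \<beta>) * sqrt (E1 f f) * sqrt (E1 g g)" if "f \<in> D" "g \<in> D" for f g
  proof -
    have "\<bar>\<beta> * ip m f g\<bar> \<le> \<beta> * (sqrt (E1 f f) * sqrt (E1 g g))"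
      unfolding abs_mult using assms(1) ip_le_sqrt_E1[OF that] by (intro mult_mono) auto
    then show ?thesis using C(2)[OF that] abs_triangle_ineq[of "E f g" "\<beta> * ip m f g"]
      by (simp add: distrib_right mult.assoc)
  qed
  have coer: "min 1 \<beta> * E1 f f \<le> E f f + \<beta> * ip m f f" if "f \<in> D" for f
  proof -
    have "min 1 \<beta> * E f f \<le> 1 * E f f" "min 1 \<beta> * ip m f f \<le> \<beta> * ip m f f"
      using E_nonneg[OF that] ip_nonneg[of m f] by (intro mult_right_mono; simp)+
    then show ?thesis by (simp add: E1_same distrib_left)
  qed
  have left: "E (\<lambda>x. a * f x + b * g x) h + \<beta> * ip m (\<lambda>x. a * f x + b * g x) h =
      a * (E f h + \<beta> * ip m f h) + b * (E g h + \<beta> * ip m g h)" if "f \<in> D" "g \<in> D" "h \<in> D" for f g h a b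
    using that by (simp add: E_left ip_comb D_L2 algebra_simps)
  have right: "E h (\<lambda>x. a * f x + b * g x) + \<beta> * ip m h (\<lambda>x. a * f x + b * g x) =
      a * (E h f + \<beta> * ip m h f) + b * (E h g + \<beta> * ip m h g)" if "f \<in> D" "g \<in> D" "h \<in> D" for f g h a b
    using that by (simp add: E_right ip_comb_right D_L2 algebra_simps)
  have pos: "min 1 \<beta> > 0" using assms by simp
  have fi: "bounded_functional (ip m u)" using assms(2) by (rule bounded_functional_ip)
  show "\<exists>g\<in>D. \<forall>w\<in>D. E g w + \<beta> * ip m g w = ip m u w"
    by (rule lax_milgram[of "\<lambda>f g. E f g + \<beta> * ip m f g", OF _ _ _ pos _ fi])
       (rule left right bound coer; assumption)+
  have bound': "\<bar>E g f + \<beta> * ip m g f\<bar> \<le> (C + \<beta>) * sqrt (E1 f f) * sqrt (E1 g g)" if "f \<in> D" "g \<in> D" for f g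
    using bound[OF that(2,1)] by (simp add: mult_ac)
  have "\<exists>h\<in>D. \<forall>w\<in>D. E w h + \<beta> * ip m w h = ip m u w"
    by (rule lax_milgram[of "\<lambda>f g. E g f + \<beta> * ip m g f", OF _ _ _ pos _ fi])
       (rule left right bound' coer; assumption)+
  then show "\<exists>h\<in>D. \<forall>w\<in>D. E w h + \<beta> * ip m w h = ip m w u" by (simp only: ip_commute[of m u])
qed

text \<open>With r = \<beta> g - u the quantity becomes \<open>E r v + E u v\<close>, and the
  resolvent equation says that E(r, w) + \<beta> (r, w) = -E(u, w). The choice w = r yields the
  bounds on r, and \<open>bounded_functional_small\<close> turns them into convergence of
  \<open>E r v\<close> to 0.\<close>

lemma approximate_form_limit:
  assumes u: "u \<in> D" and v: "v \<in> D"
    and g: "\<And>\<beta>. \<beta> > 0 \<Longrightarrow> g \<beta> \<in> D" "\<And>\<beta> w. \<beta> > 0 \<Longrightarrow> w \<in> D \<Longrightarrow> E (g \<beta>) w + \<beta> * ip m (g \<beta>) w = ip m u w"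
  shows "((\<lambda>\<beta>. \<beta> * (ip m u v - \<beta> * ip m (g \<beta>) v)) \<longlongrightarrow> E u v) at_top"
proof -
  obtain C where C: "C \<ge> 0" "\<And>f g. f \<in> D \<Longrightarrow> g \<in> D \<Longrightarrow> \<bar>E f g\<bar> \<le> C * sqrt (E1 f f) * sqrt (E1 g g)"
    using sector by blast
  define r where "r = (\<lambda>\<beta> x. \<beta> * g \<beta> x + (-1) * u x)"
  have rD: "r \<beta> \<in> D" if "\<beta> > 0" for \<beta> unfolding r_def using g(1)[OF that] u by (rule D_comb)
  have Er: "E (r \<beta>) w = \<beta> * E (g \<beta>) w - E u w" if "\<beta> > 0" "w \<in> D" for \<beta> w
    unfolding r_def using E_left[OF g(1)[OF that(1)] u that(2), of \<beta> "-1"] by simp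
  have ipr: "ip m (r \<beta>) w = \<beta> * ip m (g \<beta>) w - ip m u w" if "\<beta> > 0" "w \<in> D" for \<beta> w
    unfolding r_def using ip_comb[OF D_L2[OF g(1)[OF that(1)]] D_L2[OF u] D_L2[OF that(2)], of \<beta> "-1"] by simp
  have res: "E (r \<beta>) w + \<beta> * ip m (r \<beta>) w = - E u w" if "\<beta> > 0" "w \<in> D" for \<beta> w
    unfolding Er[OF that] ipr[OF that] g(2)[OF that, symmetric] by (simp add: algebra_simps)
  define k where "k = C * sqrt (E1 u u)"
  have k: "k \<ge> 0" using C B_nonneg[OF u] by (simp add: k_def)
  have bd: "E1 (r \<beta>) (r \<beta>) \<le> k\<^sup>2 \<and> ip m (r \<beta>) (r \<beta>) \<le> k\<^sup>2 / \<beta>" if "\<beta> \<ge> 1" for \<beta>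
  proof -
    have \<beta>: "\<beta> > 0" using that by simp
    define t where "t = sqrt (E1 (r \<beta>) (r \<beta>))"
    have t: "t \<ge> 0" "t\<^sup>2 = E1 (r \<beta>) (r \<beta>)" using B_nonneg[OF rD[OF \<beta>]] by (auto simp: t_def)
    have 1: "E (r \<beta>) (r \<beta>) + \<beta> * ip m (r \<beta>) (r \<beta>) \<le> k * t"
      using res[OF \<beta> rD[OF \<beta>]] C(2)[OF u rD[OF \<beta>]] by (simp add: k_def t_def)
    moreover have "1 * ip m (r \<beta>) (r \<beta>) \<le> \<beta> * ip m (r \<beta>) (r \<beta>)" using that ip_nonneg by (intro mult_right_mono)
    ultimately have "t * t \<le> k * t" using t(2) by (simp add: E1_same power2_eq_square)
    then have tk: "t \<le> k" using t k by (cases "t = 0") auto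
    then have "t\<^sup>2 \<le> k\<^sup>2" using t by (intro power_mono)
    moreover have "\<beta> * ip m (r \<beta>) (r \<beta>) \<le> k * k"
      using 1 E_nonneg[OF rD[OF \<beta>]] mult_left_mono[OF tk k] by linarith
    ultimately show ?thesis using t \<beta> by (simp add: field_simps power2_eq_square)
  qed
  have E_bf: "bounded_functional (\<lambda>f. c * E f v)" for c
  proof -
    have "\<bar>c * E f v\<bar> \<le> (\<bar>c\<bar> * (C * sqrt (E1 v v))) * sqrt (E1 f f)" if "f \<in> D" for f
      using mult_left_mono[OF C(2)[OF that v], of "\<bar>c\<bar>"] by (simp add: abs_mult mult_ac)
    moreover have "c * E (\<lambda>x. a * f x + b * g x) v = a * (c * E f v) + b * (c * E g v)" if "f \<in> D" "g \<in> D" for f g a b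
      using E_left[OF that v] by (simp add: algebra_simps)
    ultimately show ?thesis unfolding bounded_functional_def by blast
  qed
  \<comment> \<open>The estimate for bounded functionals is one-sided; c is later taken to be 1 and
    -1.\<close>
  have small: "\<forall>\<^sub>F \<beta> in at_top. c * E (r \<beta>) v < \<epsilon>" if "\<epsilon> > 0" for c \<epsilon>
  proof -
    have "\<exists>\<eta>>0. \<forall>f\<in>D. E1 f f \<le> k\<^sup>2 \<longrightarrow> ip m f f \<le> \<eta> \<longrightarrow> c * E f v < \<epsilon>"
    proof (rule bounded_functional_small[OF E_bf])
      show "c * E f v = 0" if f: "f \<in> D" "ip m f f = 0" for f
      proof -
        have "AE x in m. f x = 0" using ip_eq_0_imp_AE[OF D_L2] f by blast
        from E_AE[OF f(1) L2_zero this v] have "E (\<lambda>x. 0) v = E f v" .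
        moreover have "E (\<lambda>x. 0) v = 0" using E_left[OF f(1) f(1) v, of 0 0] by simp
        ultimately show ?thesis by simp
      qed
    qed (use that ip_nonneg ip_le_E1 ip_comb_square_le D_L2 in blast)+
    then obtain \<eta> where \<eta>: "\<eta> > 0" "\<And>f. f \<in> D \<Longrightarrow> E1 f f \<le> k\<^sup>2 \<Longrightarrow> ip m f f \<le> \<eta> \<Longrightarrow> c * E f v < \<epsilon>" by blast
    show ?thesis
      using eventually_ge_at_top[of 1] eventually_ge_at_top[of "k\<^sup>2 / \<eta>"]
    proof eventually_elim
      case (elim \<beta>)
      then have "k\<^sup>2 / \<beta> \<le> \<eta>" using \<eta>(1) by (simp add: field_simps)
      then show ?case using bd[OF elim(1)] rD[of \<beta>] elim by (intro \<eta>(2)) auto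
    qed
  qed
  have "((\<lambda>\<beta>. E (r \<beta>) v) \<longlongrightarrow> 0) at_top"
  proof (rule tendstoI)
    fix \<epsilon> :: real assume "\<epsilon> > 0"
    show "\<forall>\<^sub>F \<beta> in at_top. dist (E (r \<beta>) v) 0 < \<epsilon>"
      using small[OF \<open>\<epsilon> > 0\<close>, of 1] small[OF \<open>\<epsilon> > 0\<close>, of "-1"] by eventually_elim simp
  qed
  then have "((\<lambda>\<beta>. E (r \<beta>) v + E u v) \<longlongrightarrow> 0 + E u v) at_top" by (intro tendsto_intros)
  moreover have "\<forall>\<^sub>F \<beta> in at_top. E (r \<beta>) v + E u v = \<beta> * (ip m u v - \<beta> * ip m (g \<beta>) v)"
    using eventually_gt_at_top[of 0]
  proof eventually_elim
    case (elim \<beta>)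
    show ?case using Er[OF elim v] g(2)[OF elim v] by simp
  qed
  ultimately show ?thesis using Lim_transform_eventually by fastforce
qed

end

lemma semi_dirichlet_imp_closed_form:
  assumes "semi_dirichlet m D E" shows "closed_form m D E"
proof -
  note c1 = assms[unfolded semi_dirichlet_def]
  note c2 = conjunct2[OF c1] note c3 = conjunct2[OF c2] note c4 = conjunct2[OF c3]
  note c5 = conjunct2[OF c4] note c6 = conjunct2[OF c5] note c7 = conjunct2[OF c6]
  note c8 = conjunct2[OF c7]
  show ?thesis
  proof
    show "D \<noteq> {}" using conjunct1[OF c3, rule_format, OF L2_zero zero_less_one] by blast
    show "\<exists>C. \<forall>u\<in>D. \<forall>v\<in>D. \<bar>E u v + ip m u v\<bar> \<le> C * sqrt (E u u + ip m u u) * sqrt (E v v + ip m v v)"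
      using conjunct1[OF c7] .
    show "\<exists>u\<in>D. (\<lambda>k. E (\<lambda>x. s k x - u x) (\<lambda>x. s k x - u x)
            + ip m (\<lambda>x. s k x - u x) (\<lambda>x. s k x - u x)) \<longlonglongrightarrow> 0"
      if "\<And>k. s k \<in> D" "\<And>\<epsilon>. \<epsilon> > 0 \<Longrightarrow> \<exists>N. \<forall>i\<ge>N. \<forall>j\<ge>N. E (\<lambda>x. s i x - s j x) (\<lambda>x. s i x - s j x)
            + ip m (\<lambda>x. s i x - s j x) (\<lambda>x. s i x - s j x) < \<epsilon>" for s
      using conjunct1[OF c8, rule_format, of s] that by blast
  qed (use conjunct1[OF c1] conjunct1[OF c2] conjunct1[OF c4] conjunct1[OF c5] conjunct1[OF c6] in blast)+
qed

text \<open>\<open>case2\<close> describes the kernels by implications about solutions of the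
  resolvent equations, so the existence of solutions is what gives access to them. Testing each of
  the two equations with the solution of the other yields the transposition.\<close>

lemma case2_kernel_limits:
  fixes U :: "(real^'n::finite) set"
  assumes "case2 U m E \<sigma> \<sigma>h"
  shows "\<And>\<beta> u v. \<beta> > 0 \<Longrightarrow> u \<in> C0inf U \<Longrightarrow> v \<in> C0inf U \<Longrightarrow>
      (\<integral>z. u (fst z) * v (snd z) \<partial>\<sigma>h \<beta>) = (\<integral>z. v (fst z) * u (snd z) \<partial>\<sigma> \<beta>)"
    and "\<And>u v. u \<in> C0inf U \<Longrightarrow> v \<in> C0inf U \<Longrightarrow>
      ((\<lambda>\<beta>. \<beta> * (ip m u v - (\<integral>z. u (fst z) * v (snd z) \<partial>\<sigma> \<beta>))) \<longlongrightarrow> E u v) at_top"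
proof -
  obtain D where D: "semi_dirichlet m D E" "C0inf U \<subseteq> D" and
    \<sigma>: "\<And>\<beta> u v g. \<beta> > 0 \<Longrightarrow> u \<in> C0inf U \<Longrightarrow> v \<in> C0inf U \<Longrightarrow> g \<in> D \<Longrightarrow> (\<forall>w\<in>D. E g w + \<beta> * ip m g w = ip m u w) \<Longrightarrow>
            (\<integral>z. u (fst z) * v (snd z) \<partial>(\<sigma> \<beta>)) = \<beta> * ip m g v" and
    \<sigma>h: "\<And>\<beta> u v h. \<beta> > 0 \<Longrightarrow> u \<in> C0inf U \<Longrightarrow> v \<in> C0inf U \<Longrightarrow> h \<in> D \<Longrightarrow> (\<forall>w\<in>D. E w h + \<beta> * ip m w h = ip m w u) \<Longrightarrow>
            (\<integral>z. u (fst z) * v (snd z) \<partial>(\<sigma>h \<beta>)) = \<beta> * ip m h v"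
  proof -
    from assms obtain D where D: "semi_dirichlet m D E" "C0inf U \<subseteq> D" and
      R: "\<forall>\<beta>>0. \<forall>u\<in>C0inf U. \<forall>v\<in>C0inf U.
        (\<forall>g. g \<in> D \<and> (\<forall>w\<in>D. E g w + \<beta> * ip m g w = ip m u w) \<longrightarrow>
            (\<integral>z. u (fst z) * v (snd z) \<partial>(\<sigma> \<beta>)) = \<beta> * ip m g v) \<and>
        (\<forall>h. h \<in> D \<and> (\<forall>w\<in>D. E w h + \<beta> * ip m w h = ip m w u) \<longrightarrow>
            (\<integral>z. u (fst z) * v (snd z) \<partial>(\<sigma>h \<beta>)) = \<beta> * ip m h v)"
      unfolding case2_def by (elim exE conjE)
    show thesis by (rule that[OF D]) (use R in simp)+
  qed
  interpret closed_form m D E using D(1) by (rule semi_dirichlet_imp_closed_form)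
  have L: "L2 m u" if "u \<in> C0inf U" for u using that D D_L2 by blast
  show "(\<integral>z. u (fst z) * v (snd z) \<partial>\<sigma>h \<beta>) = (\<integral>z. v (fst z) * u (snd z) \<partial>\<sigma> \<beta>)"
    if \<beta>: "\<beta> > 0" and uv: "u \<in> C0inf U" "v \<in> C0inf U" for \<beta> u v
  proof -
    obtain g where g: "g \<in> D" "\<forall>w\<in>D. E g w + \<beta> * ip m g w = ip m v w" using resolvents_exist(1)[OF \<beta> L[OF uv(2)]] by blast
    obtain h where h: "h \<in> D" "\<forall>w\<in>D. E w h + \<beta> * ip m w h = ip m w u" using resolvents_exist(2)[OF \<beta> L[OF uv(1)]] by blast
    have "ip m v h = ip m g u" using g(2) h g(1) by metis
    then show ?thesis using \<sigma>[OF \<beta> uv(2,1) g] \<sigma>h[OF \<beta> uv h] by (simp add: ip_commute[of m h])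
  qed
  show "((\<lambda>\<beta>. \<beta> * (ip m u v - (\<integral>z. u (fst z) * v (snd z) \<partial>\<sigma> \<beta>))) \<longlongrightarrow> E u v) at_top"
    if uv: "u \<in> C0inf U" "v \<in> C0inf U" for u v
  proof -
    have "\<forall>\<beta>. \<exists>g. \<beta> > 0 \<longrightarrow> g \<in> D \<and> (\<forall>w\<in>D. E g w + \<beta> * ip m g w = ip m u w)"
      using resolvents_exist(1)[OF _ L[OF uv(1)]] by blast
    from choice[OF this] obtain g where g: "\<And>\<beta>. \<beta> > 0 \<Longrightarrow> g \<beta> \<in> D"
      "\<And>\<beta>. \<beta> > 0 \<Longrightarrow> \<forall>w\<in>D. E (g \<beta>) w + \<beta> * ip m (g \<beta>) w = ip m u w" by blast
    have "((\<lambda>\<beta>. \<beta> * (ip m u v - \<beta> * ip m (g \<beta>) v)) \<longlongrightarrow> E u v) at_top"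
      using uv D(2) g by (intro approximate_form_limit) auto
    moreover have "\<forall>\<^sub>F \<beta> in at_top. \<beta> * (ip m u v - \<beta> * ip m (g \<beta>) v) = \<beta> * (ip m u v - (\<integral>z. u (fst z) * v (snd z) \<partial>\<sigma> \<beta>))"
      using eventually_gt_at_top[of 0]
    proof eventually_elim
      case (elim \<beta>)
      then show ?case using \<sigma>[OF elim uv g] by simp
    qed
    ultimately show ?thesis by (rule Lim_transform_eventually)
  qed
qed

section \<open>Completeness of the space of square-integrable functions\<close>

lemma L2_measurable: "L2 m f \<Longrightarrow> f \<in> borel_measurable m"
  by (simp add: L2_def)

lemma nn_integral_square: "L2 m f \<Longrightarrow> (\<integral>\<^sup>+x. ennreal ((f x)\<^sup>2) \<partial>m) = ennreal (ip m f f)"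
  by (simp add: L2_def ip_def nn_integral_eq_integral power2_eq_square)

lemma L2_I_nn_integral:
  assumes "f \<in> borel_measurable m" "(\<integral>\<^sup>+x. ennreal ((f x)\<^sup>2) \<partial>m) \<le> ennreal c"
  shows "L2 m f"
proof -
  have "(\<integral>\<^sup>+x. ennreal ((f x)\<^sup>2) \<partial>m) < \<infinity>"
    using assms(2) by (rule order_le_less_trans) simp
  then have "integrable m (\<lambda>x. (f x)\<^sup>2)"
    using assms(1) by (intro integrableI_nonneg) auto
  then show ?thesis using assms(1) by (simp add: L2_def)
qed

text \<open>The measure may be infinite, so square integrability does not make the terms themselves
  integrable. Instead the squares weighted by 4^k are summable almost everywhere, which bounds
  \<open>\<bar>h k x\<bar>\<close> by a multiple of (1/2)^k.\<close>

lemma AE_summable_of_fast_cauchy: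
  assumes s: "\<And>k. L2 m (h k)" and le: "\<And>k. ip m (h k) (h k) \<le> (1/16) ^ k"
  shows "AE x in m. summable (\<lambda>k. \<bar>h k x\<bar>)"
proof -
  have meas: "(\<lambda>x. ennreal (4 ^ k * (h k x)\<^sup>2)) \<in> borel_measurable m" for k
    using L2_measurable[OF s] by auto
  have "(\<integral>\<^sup>+x. (\<Sum>k. ennreal (4 ^ k * (h k x)\<^sup>2)) \<partial>m) = (\<Sum>k. \<integral>\<^sup>+x. ennreal (4 ^ k * (h k x)\<^sup>2) \<partial>m)"
    using meas by (rule nn_integral_suminf)
  also have "\<dots> \<le> (\<Sum>k. ennreal ((1/4) ^ k))"
  proof (intro suminf_le summableI)
    fix k
    have "(\<integral>\<^sup>+x. ennreal (4 ^ k * (h k x)\<^sup>2) \<partial>m) = (\<integral>\<^sup>+x. ennreal (4 ^ k) * ennreal ((h k x)\<^sup>2) \<partial>m)"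
      by (simp add: ennreal_mult)
    also have "\<dots> = ennreal (4 ^ k) * ennreal (ip m (h k) (h k))"
      using s[of k] by (subst nn_integral_cmult) (auto simp: nn_integral_square L2_def)
    also have "\<dots> = ennreal (4 ^ k * ip m (h k) (h k))"
      by (simp add: ennreal_mult ip_nonneg)
    also have "\<dots> \<le> ennreal ((1/4) ^ k)"
    proof (intro ennreal_leI)
      have "4 ^ k * ip m (h k) (h k) \<le> 4 ^ k * (1/16) ^ k" by (intro mult_left_mono le) simp
      also have "\<dots> = (1/4) ^ k" by (simp flip: power_mult_distrib)
      finally show "4 ^ k * ip m (h k) (h k) \<le> (1/4) ^ k" .
    qed
    finally show "(\<integral>\<^sup>+x. ennreal (4 ^ k * (h k x)\<^sup>2) \<partial>m) \<le> ennreal ((1/4) ^ k)" .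
  qed
  also have "\<dots> = ennreal (\<Sum>k. (1/4) ^ k)"
    by (intro suminf_ennreal2 summable_geometric) auto
  finally have "(\<integral>\<^sup>+x. (\<Sum>k. ennreal (4 ^ k * (h k x)\<^sup>2)) \<partial>m) \<noteq> \<infinity>"
    by (auto simp: top_unique)
  then have "AE x in m. (\<Sum>k. ennreal (4 ^ k * (h k x)\<^sup>2)) \<noteq> \<infinity>"
    using meas by (intro nn_integral_PInf_AE borel_measurable_suminf_order) auto
  then show ?thesis
  proof eventually_elim
    case (elim x)
    then have "summable (\<lambda>k. 4 ^ k * (h k x)\<^sup>2)" by (intro summable_suminf_not_top) auto
    then have "Bseq (\<lambda>k. 4 ^ k * (h k x)\<^sup>2)"
      by (intro convergent_imp_Bseq) (auto dest: summable_LIMSEQ_zero simp: convergent_def)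
    then obtain C where C: "C > 0" "\<And>k. 4 ^ k * (h k x)\<^sup>2 \<le> C"
      unfolding Bseq_def by force
    show ?case
    proof (rule summable_comparison_test')
      show "summable (\<lambda>k. sqrt C * (1/2) ^ k)" by (intro summable_mult summable_geometric) auto
      fix k
      have "(2 ^ k * \<bar>h k x\<bar>)\<^sup>2 \<le> C"
        using C(2)[of k] by (simp add: power_mult_distrib power_mult[symmetric] mult.commute[of _ 2]) (simp add: power_mult)
      then have "2 ^ k * \<bar>h k x\<bar> \<le> sqrt C" by (rule real_le_rsqrt)
      then show "norm \<bar>h k x\<bar> \<le> sqrt C * (1/2) ^ k" by (simp add: field_simps power_one_over)
    qed
  qed
qed

lemma L2_complete:
  assumes s: "\<And>k. L2 m (s k)"
    and cauchy: "\<And>\<epsilon>. \<epsilon> > 0 \<Longrightarrow> \<exists>N. \<forall>i\<ge>N. \<forall>j\<ge>N. ip m (\<lambda>x. s i x - s j x) (\<lambda>x. s i x - s j x) < \<epsilon>"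
  shows "\<exists>u. L2 m u \<and> (\<lambda>k. ip m (\<lambda>x. s k x - u x) (\<lambda>x. s k x - u x)) \<longlonglongrightarrow> 0"
proof -
  have "\<forall>k. \<exists>N. \<forall>i\<ge>N. \<forall>j\<ge>N. ip m (\<lambda>x. s i x - s j x) (\<lambda>x. s i x - s j x) < (1/16) ^ k"
    using cauchy by simp
  from choice[OF this] obtain N where
    N: "\<And>k i j. i \<ge> N k \<Longrightarrow> j \<ge> N k \<Longrightarrow> ip m (\<lambda>x. s i x - s j x) (\<lambda>x. s i x - s j x) < (1/16) ^ k" by blast
  \<comment> \<open>The sum puts both \<open>n k\<close> and \<open>n (Suc k)\<close> beyond
    \<open>N k\<close>, and the summand k makes n unbounded.\<close>
  define n where "n = (\<lambda>k. k + (\<Sum>j\<le>k. N j))"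
  have nN: "n k \<ge> N k" for k using member_le_sum[of k "{..k}" N] by (simp add: n_def trans_le_add2)
  have nS: "n (Suc k) \<ge> N k" for k using member_le_sum[of k "{..Suc k}" N] by (simp add: n_def trans_le_add2)
  have nk: "n k \<ge> k" for k by (simp add: n_def)
  have "AE x in m. summable (\<lambda>k. \<bar>s (n (Suc k)) x - s (n k) x\<bar>)"
    using N[OF nS nN] by (intro AE_summable_of_fast_cauchy L2_diff s less_imp_le)
  then have conv: "AE x in m. (\<lambda>k. s (n k) x) \<longlonglongrightarrow> lim (\<lambda>k. s (n k) x)"
  proof eventually_elim
    case (elim x)
    then have "summable (\<lambda>k. s (n (Suc k)) x - s (n k) x)" by (rule summable_rabs_cancel)
    then have "convergent (\<lambda>k. (\<Sum>i<k. s (n (Suc i)) x - s (n i) x))" by (simp add: summable_iff_convergent)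
    then have "convergent (\<lambda>k. s (n k) x - s (n 0) x)" by (simp add: sum_lessThan_telescope[of "\<lambda>k. s (n k) x"])
    then have "convergent (\<lambda>k. (s (n k) x - s (n 0) x) + s (n 0) x)" by (intro convergent_add convergent_const)
    then show ?case by (simp add: convergent_LIMSEQ_iff)
  qed
  define u where "u = (\<lambda>x. lim (\<lambda>k. s (n k) x))"
  have mu: "u \<in> borel_measurable m" unfolding u_def using s by (intro borel_measurable_lim_metric) (auto simp: L2_def)
  \<comment> \<open>By Fatou's lemma along the subsequence, a Cauchy bound for pairs of indices
    passes to the limit in the second index.\<close>
  have fatou: "(\<integral>\<^sup>+x. ennreal ((s i x - u x)\<^sup>2) \<partial>m) \<le> ennreal \<epsilon>"
    if M: "\<And>i j. i \<ge> M \<Longrightarrow> j \<ge> M \<Longrightarrow> ip m (\<lambda>x. s i x - s j x) (\<lambda>x. s i x - s j x) < \<epsilon>" and i: "i \<ge> M" for M \<epsilon> i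
  proof -
    have "(\<integral>\<^sup>+x. ennreal ((s i x - u x)\<^sup>2) \<partial>m) = (\<integral>\<^sup>+x. liminf (\<lambda>k. ennreal ((s i x - s (n k) x)\<^sup>2)) \<partial>m)"
    proof (rule nn_integral_cong_AE)
      show "AE x in m. ennreal ((s i x - u x)\<^sup>2) = liminf (\<lambda>k. ennreal ((s i x - s (n k) x)\<^sup>2))"
        using conv
      proof eventually_elim
        case (elim x)
        then have "(\<lambda>k. ennreal ((s i x - s (n k) x)\<^sup>2)) \<longlonglongrightarrow> ennreal ((s i x - u x)\<^sup>2)"
          unfolding u_def by (intro tendsto_intros)
        then show ?case by (rule lim_imp_Liminf[OF sequentially_bot, symmetric])
      qed
    qed
    also have "\<dots> \<le> liminf (\<lambda>k. \<integral>\<^sup>+x. ennreal ((s i x - s (n k) x)\<^sup>2) \<partial>m)"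
      using L2_measurable[OF s] by (intro nn_integral_liminf) auto
    also have "\<dots> \<le> ennreal \<epsilon>"
    proof (intro Liminf_le)
      show "\<forall>\<^sub>F k in sequentially. (\<integral>\<^sup>+x. ennreal ((s i x - s (n k) x)\<^sup>2) \<partial>m) \<le> ennreal \<epsilon>"
        using eventually_ge_at_top[of M]
      proof eventually_elim
        case (elim k)
        then have "n k \<ge> M" using nk[of k] by simp
        then show ?case using nn_integral_square[OF L2_diff[OF s s], of i "n k"] M[OF i, of "n k"]
          by (simp add: ennreal_leI)
      qed
    qed simp
    finally show ?thesis .
  qed
  obtain M where M: "\<And>i j. i \<ge> M \<Longrightarrow> j \<ge> M \<Longrightarrow> ip m (\<lambda>x. s i x - s j x) (\<lambda>x. s i x - s j x) < 1"
    using cauchy[of 1] by auto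
  have "L2 m (\<lambda>x. s M x - u x)"
    using fatou[of M 1 M, OF M order_refl] mu L2_measurable[OF s] by (intro L2_I_nn_integral[where c=1]) auto
  from L2_diff[OF s[of M] this] have u: "L2 m u" by simp
  have "(\<lambda>k. ip m (\<lambda>x. s k x - u x) (\<lambda>x. s k x - u x)) \<longlonglongrightarrow> 0"
  proof (rule LIMSEQ_I)
    fix \<epsilon> :: real assume \<epsilon>: "\<epsilon> > 0"
    obtain M where M: "\<And>i j. i \<ge> M \<Longrightarrow> j \<ge> M \<Longrightarrow> ip m (\<lambda>x. s i x - s j x) (\<lambda>x. s i x - s j x) < \<epsilon> / 2"
      using cauchy[of "\<epsilon> / 2"] \<epsilon> by auto
    have "ip m (\<lambda>x. s i x - u x) (\<lambda>x. s i x - u x) \<le> \<epsilon> / 2" if "i \<ge> M" for i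
      using fatou[OF M that] \<epsilon> unfolding nn_integral_square[OF L2_diff[OF s u]] by simp
    then have "norm (ip m (\<lambda>x. s i x - u x) (\<lambda>x. s i x - u x) - 0) < \<epsilon>" if "i \<ge> M" for i
      using that \<epsilon> ip_nonneg[of m "\<lambda>x. s i x - u x"] by fastforce
    then show "\<exists>no. \<forall>i\<ge>no. norm (ip m (\<lambda>x. s i x - u x) (\<lambda>x. s i x - u x) - 0) < \<epsilon>" by blast
  qed
  then show ?thesis using u by blast
qed

lemma semi_hilbert_L2: "semi_hilbert {f. L2 m f} (ip m)"
proof
  show "{f. L2 m f} \<noteq> {}" using L2_zero by blast
  show "\<exists>u\<in>{f. L2 m f}. (\<lambda>k. ip m (\<lambda>x. s k x - u x) (\<lambda>x. s k x - u x)) \<longlonglongrightarrow> 0"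
    if "\<And>k. s k \<in> {f. L2 m f}"
      "\<And>\<epsilon>. \<epsilon> > 0 \<Longrightarrow> \<exists>N. \<forall>i\<ge>N. \<forall>j\<ge>N. ip m (\<lambda>x. s i x - s j x) (\<lambda>x. s i x - s j x) < \<epsilon>" for s
    using L2_complete[of m s] that by simp
qed (auto simp: L2_comb ip_comb ip_nonneg intro: ip_commute)

lemma L2_riesz:
  assumes "\<And>f g a b. L2 m f \<Longrightarrow> L2 m g \<Longrightarrow> \<phi> (\<lambda>x. a * f x + b * g x) = a * \<phi> f + b * \<phi> g"
    "\<And>f. L2 m f \<Longrightarrow> \<bar>\<phi> f\<bar> \<le> c * l2norm m f"
  shows "\<exists>u. L2 m u \<and> (\<forall>w. L2 m w \<longrightarrow> ip m u w = \<phi> w)"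
proof -
  interpret semi_hilbert "{f. L2 m f}" "ip m" by (rule semi_hilbert_L2)
  have "bounded_functional \<phi>"
    unfolding bounded_functional_def using assms by (auto simp: l2norm_eq)
  then obtain u where "u \<in> {f. L2 m f}" "\<And>w. w \<in> {f. L2 m f} \<Longrightarrow> ip m u w = \<phi> w"
    using riesz_representation by blast
  then show ?thesis by blast
qed

section \<open>Resolvents of a contraction semigroup\<close>

lemma ip_cong_AE:
  assumes "AE x in m. f x = f' x" "L2 m f" "L2 m f'" "L2 m g"
  shows "ip m f g = ip m f' g"
  unfolding ip_def
  using assms by (intro integral_cong_AE) (auto simp: L2_def)

locale contraction_semigroup =
  fixes m :: "'a measure" and T :: "real \<Rightarrow> ('a \<Rightarrow> real) \<Rightarrow> ('a \<Rightarrow> real)"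
  assumes T_L2: "t \<ge> 0 \<Longrightarrow> L2 m f \<Longrightarrow> L2 m (T t f)"
    and T_comb: "t \<ge> 0 \<Longrightarrow> L2 m f \<Longrightarrow> L2 m g \<Longrightarrow> AE x in m. T t (\<lambda>y. a * f y + b * g y) x = a * T t f x + b * T t g x"
    and T_AE: "t \<ge> 0 \<Longrightarrow> L2 m f \<Longrightarrow> L2 m g \<Longrightarrow> AE x in m. f x = g x \<Longrightarrow> AE x in m. T t f x = T t g x"
    and T_plus: "s \<ge> 0 \<Longrightarrow> t \<ge> 0 \<Longrightarrow> L2 m f \<Longrightarrow> AE x in m. T (s + t) f x = T s (T t f) x"
    and T_contraction: "t \<ge> 0 \<Longrightarrow> L2 m f \<Longrightarrow> l2norm m (T t f) \<le> l2norm m f"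
    and T_continuous: "L2 m f \<Longrightarrow> ((\<lambda>t. l2norm m (\<lambda>x. T t f x - f x)) \<longlongrightarrow> 0) (at_right 0)"
begin

definition orbit :: "('a \<Rightarrow> real) \<Rightarrow> ('a \<Rightarrow> real) \<Rightarrow> real \<Rightarrow> real" where
  "orbit p w t = ip m (T t p) w"

lemma orbit_le: "t \<ge> 0 \<Longrightarrow> L2 m p \<Longrightarrow> L2 m w \<Longrightarrow> \<bar>orbit p w t\<bar> \<le> l2norm m p * l2norm m w"
  unfolding orbit_def
  using ip_cauchy_schwarz[OF T_L2] T_contraction mult_right_mono[OF _ l2norm_nonneg] order_trans by metis

lemma orbit_comb_left: "t \<ge> 0 \<Longrightarrow> L2 m p \<Longrightarrow> L2 m q \<Longrightarrow> L2 m w \<Longrightarrow>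
    orbit (\<lambda>x. a * p x + b * q x) w t = a * orbit p w t + b * orbit q w t"
  unfolding orbit_def
  using ip_cong_AE[OF T_comb[of t p q a b] T_L2[OF _ L2_comb] L2_comb[OF T_L2 T_L2]] ip_comb[OF T_L2 T_L2]
  by simp

lemma orbit_comb_right: "t \<ge> 0 \<Longrightarrow> L2 m p \<Longrightarrow> L2 m q \<Longrightarrow> L2 m w \<Longrightarrow>
    orbit w (\<lambda>x. a * p x + b * q x) t = a * orbit w p t + b * orbit w q t"
  unfolding orbit_def by (simp add: ip_comb_right T_L2)

lemma orbit_plus: "s \<ge> 0 \<Longrightarrow> t \<ge> 0 \<Longrightarrow> L2 m p \<Longrightarrow> L2 m w \<Longrightarrow> orbit (T s p) w t = orbit p w (t + s)"
  unfolding orbit_def by (rule ip_cong_AE[symmetric, OF T_plus]) (auto intro: T_L2)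

lemma orbit_diff_le:
  assumes "s \<ge> 0" "t \<ge> 0" "L2 m p" "L2 m w"
  shows "\<bar>orbit p w (t + s) - orbit p w t\<bar> \<le> l2norm m (\<lambda>x. T s p x - p x) * l2norm m w"
proof -
  have L: "L2 m (T s p)" using assms by (intro T_L2)
  have "orbit p w (t + s) - orbit p w t = orbit (\<lambda>x. 1 * T s p x + (-1) * p x) w t"
    unfolding orbit_comb_left[OF assms(2) L assms(3,4)] using orbit_plus[OF assms] by simp
  moreover have "\<bar>orbit (\<lambda>x. 1 * T s p x + (-1) * p x) w t\<bar> \<le> l2norm m (\<lambda>x. 1 * T s p x + (-1) * p x) * l2norm m w"
    using assms L by (intro orbit_le L2_comb)
  ultimately show ?thesis by simp
qed

text \<open>By contraction the modulus in \<open>orbit_diff_le\<close> does not depend on t, so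
  strong continuity at time 0 from the right already gives two-sided uniform continuity.\<close>

lemma orbit_continuous:
  assumes "L2 m p" "L2 m w" shows "continuous_on {0..} (orbit p w)"
proof -
  have "\<exists>d>0. \<forall>s\<ge>0. \<forall>t\<ge>0. \<bar>s - t\<bar> < d \<longrightarrow> \<bar>orbit p w s - orbit p w t\<bar> < \<epsilon>" if "\<epsilon> > 0" for \<epsilon>
  proof -
    have "((\<lambda>s. l2norm m (\<lambda>x. T s p x - p x) * l2norm m w) \<longlongrightarrow> 0 * l2norm m w) (at_right 0)"
      by (intro tendsto_mult T_continuous assms tendsto_const)
    then have "\<forall>\<^sub>F s in at_right 0. l2norm m (\<lambda>x. T s p x - p x) * l2norm m w < \<epsilon>"
      using \<open>\<epsilon> > 0\<close> by (intro order_tendstoD) auto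
    then obtain d where d: "d > 0" "\<And>s. 0 < s \<Longrightarrow> s < d \<Longrightarrow> l2norm m (\<lambda>x. T s p x - p x) * l2norm m w < \<epsilon>"
      by (auto simp: eventually_at_right_field)
    have ord: "\<bar>orbit p w s - orbit p w t\<bar> < \<epsilon>" if "t \<ge> 0" "t < s" "s - t < d" for s t
      using orbit_diff_le[of "s - t" t p w] d(2)[of "s - t"] that assms by simp
    have "\<bar>orbit p w s - orbit p w t\<bar> < \<epsilon>" if "s \<ge> 0" "t \<ge> 0" "\<bar>s - t\<bar> < d" for s t
    proof (cases s t rule: linorder_cases)
      case less
      then show ?thesis using ord[of s t] that by (simp add: abs_minus_commute)
    next
      case greater
      then show ?thesis using ord[of t s] that by simp
    qed (use \<open>\<epsilon> > 0\<close> in simp)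
    then show ?thesis using d(1) by blast
  qed
  then show ?thesis unfolding continuous_on_iff dist_real_def by (metis atLeast_iff)
qed

lemma integrable_exp_orbit:
  assumes "\<beta> > 0" "L2 m p" "L2 m w"
  shows "integrable lborel (\<lambda>t. indicator {0..} t * (exp (- \<beta> * t) * orbit p w t))"
    and "\<bar>\<integral>t. indicator {0..} t * (exp (- \<beta> * t) * orbit p w t) \<partial>lborel\<bar> \<le> l2norm m p * l2norm m w / \<beta>"
proof -
  have "(\<integral>\<^sup>+t. ennreal (exp (- \<beta> * t)) * indicator {0..} t \<partial>lborel) = 0 - (- exp (- \<beta> * 0) / \<beta>)"
  proof (rule nn_integral_FTC_atLeast)
    show "((\<lambda>t. - exp (- \<beta> * t) / \<beta>) has_real_derivative exp (- \<beta> * t)) (at t)" for t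
      using assms(1) by (auto intro!: derivative_eq_intros)
    have "((\<lambda>t. exp (- (\<beta> * t))) \<longlongrightarrow> 0) at_top"
      using assms(1)
      by (intro filterlim_compose[OF exp_at_bot] filterlim_compose[OF filterlim_uminus_at_bot_at_top]
          filterlim_tendsto_pos_mult_at_top[OF tendsto_const _ filterlim_ident])
    then have "((\<lambda>t. - exp (- \<beta> * t) / \<beta>) \<longlongrightarrow> - 0 / \<beta>) at_top" by (intro tendsto_intros) (use assms in auto)
    then show "((\<lambda>t. - exp (- \<beta> * t) / \<beta>) \<longlongrightarrow> 0) at_top" by simp
  qed auto
  then have nn: "(\<integral>\<^sup>+t. ennreal (indicator {0..} t * exp (- \<beta> * t)) \<partial>lborel) = ennreal (1 / \<beta>)"
    by (simp add: ennreal_mult' mult.commute ennreal_indicator)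
  have hb: "has_bochner_integral lborel (\<lambda>t. indicator {0..} t * exp (- \<beta> * t)) (1 / \<beta>)"
    using assms(1) nn by (intro has_bochner_integral_nn_integral) auto
  define c where "c = l2norm m p * l2norm m w"
  have c: "c \<ge> 0" by (simp add: c_def l2norm_nonneg)
  have le: "\<bar>indicator {0..} t * (exp (- \<beta> * t) * orbit p w t)\<bar> \<le> c * (indicator {0..} t * exp (- \<beta> * t))" for t
    using orbit_le[OF _ assms(2,3), of t] by (auto simp: abs_mult c_def indicator_def mult.commute)
  have int: "integrable lborel (\<lambda>t. c * (indicator {0..} t * exp (- \<beta> * t)))"
    using hb by (intro integrable_mult_right) (rule integrable.intros)
  show i: "integrable lborel (\<lambda>t. indicator {0..} t * (exp (- \<beta> * t) * orbit p w t))"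
  proof (rule Bochner_Integration.integrable_bound[OF int])
    have "continuous_on {0..} (\<lambda>t. exp (- \<beta> * t) * orbit p w t)"
      using assms by (intro continuous_intros orbit_continuous)
    from borel_measurable_continuous_on_indicator[OF _ this]
    show "(\<lambda>t. indicator {0..} t * (exp (- \<beta> * t) * orbit p w t)) \<in> borel_measurable lborel" by simp
    show "AE t in lborel. norm (indicator {0..} t * (exp (- \<beta> * t) * orbit p w t)) \<le> norm (c * (indicator {0..} t * exp (- \<beta> * t)))"
      using le c by (intro AE_I2) (simp add: abs_mult)
  qed
  have "\<bar>\<integral>t. indicator {0..} t * (exp (- \<beta> * t) * orbit p w t) \<partial>lborel\<bar> \<le> (\<integral>t. c * (indicator {0..} t * exp (- \<beta> * t)) \<partial>lborel)"
    using i int le by (intro integral_abs_bound[THEN order_trans] integral_mono) auto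
  also have "\<dots> = c / \<beta>" using has_bochner_integral_integral_eq[OF hb] by simp
  finally show "\<bar>\<integral>t. indicator {0..} t * (exp (- \<beta> * t) * orbit p w t) \<partial>lborel\<bar> \<le> l2norm m p * l2norm m w / \<beta>"
    by (simp add: c_def)
qed

text \<open>The pairing with w of what will be the resolvent applied to p;
  \<open>resolvent_exists\<close> realises it by a function.\<close>

definition laplace :: "real \<Rightarrow> ('a \<Rightarrow> real) \<Rightarrow> ('a \<Rightarrow> real) \<Rightarrow> real" where
  "laplace \<beta> p w = (\<integral>t. indicator {0..} t * (exp (- \<beta> * t) * orbit p w t) \<partial>lborel)"

text \<open>The part of the Laplace integral that is lost when time is shifted by h.\<close>

definition head :: "real \<Rightarrow> real \<Rightarrow> ('a \<Rightarrow> real) \<Rightarrow> ('a \<Rightarrow> real) \<Rightarrow> real" where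
  "head \<beta> h p w = (\<integral>t. indicator {0..<h} t * (exp (- \<beta> * t) * orbit p w t) \<partial>lborel)"

lemma laplace_le: "\<beta> > 0 \<Longrightarrow> L2 m p \<Longrightarrow> L2 m w \<Longrightarrow> \<bar>laplace \<beta> p w\<bar> \<le> l2norm m p * l2norm m w / \<beta>"
  unfolding laplace_def by (rule integrable_exp_orbit)

lemma laplace_comb_left:
  assumes "\<beta> > 0" "L2 m p" "L2 m q" "L2 m w"
  shows "laplace \<beta> (\<lambda>x. a * p x + b * q x) w = a * laplace \<beta> p w + b * laplace \<beta> q w"
proof -
  have "laplace \<beta> (\<lambda>x. a * p x + b * q x) w =
     (\<integral>t. a * (indicator {0..} t * (exp (- \<beta> * t) * orbit p w t)) + b * (indicator {0..} t * (exp (- \<beta> * t) * orbit q w t)) \<partial>lborel)"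
    unfolding laplace_def
    by (intro Bochner_Integration.integral_cong) (auto simp: indicator_def orbit_comb_left assms algebra_simps)
  then show ?thesis using integrable_exp_orbit(1)[OF assms(1,2,4)] integrable_exp_orbit(1)[OF assms(1,3,4)]
    by (simp add: laplace_def)
qed

lemma laplace_comb_right:
  assumes "\<beta> > 0" "L2 m p" "L2 m q" "L2 m w"
  shows "laplace \<beta> w (\<lambda>x. a * p x + b * q x) = a * laplace \<beta> w p + b * laplace \<beta> w q"
proof -
  have "laplace \<beta> w (\<lambda>x. a * p x + b * q x) =
     (\<integral>t. a * (indicator {0..} t * (exp (- \<beta> * t) * orbit w p t)) + b * (indicator {0..} t * (exp (- \<beta> * t) * orbit w q t)) \<partial>lborel)"
    unfolding laplace_def
    by (intro Bochner_Integration.integral_cong) (auto simp: indicator_def orbit_comb_right assms algebra_simps)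
  then show ?thesis using integrable_exp_orbit(1)[OF assms(1,4,2)] integrable_exp_orbit(1)[OF assms(1,4,3)]
    by (simp add: laplace_def)
qed

lemma integrable_head:
  assumes "\<beta> > 0" "L2 m p" "L2 m w" "h \<ge> 0"
  shows "integrable lborel (\<lambda>t. indicator {0..<h} t * (exp (- \<beta> * t) * orbit p w t))"
proof -
  have "integrable lborel (\<lambda>t. indicator {0..<h} t *\<^sub>R (indicator {0..} t * (exp (- \<beta> * t) * orbit p w t)))"
    by (intro integrable_mult_indicator integrable_exp_orbit assms) auto
  moreover have "(\<lambda>t. indicator {0..<h} t *\<^sub>R (indicator {0..} t * (exp (- \<beta> * t) * orbit p w t))) =
      (\<lambda>t. indicator {0..<h} t * (exp (- \<beta> * t) * orbit p w t))"
    by (auto simp: indicator_def)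
  ultimately show ?thesis by simp
qed

lemma laplace_shift:
  assumes "\<beta> > 0" "L2 m p" "L2 m w" "h \<ge> 0"
  shows "(\<integral>t. indicator {0..} t * (exp (- \<beta> * t) * orbit p w (t + h)) \<partial>lborel) =
    exp (\<beta> * h) * (laplace \<beta> p w - head \<beta> h p w)"
proof -
  define f where "f = (\<lambda>t. exp (\<beta> * h) * (indicator {h..} t * (exp (- \<beta> * t) * orbit p w t)))"
  have "laplace \<beta> p w - head \<beta> h p w =
     (\<integral>t. indicator {0..} t * (exp (- \<beta> * t) * orbit p w t) - indicator {0..<h} t * (exp (- \<beta> * t) * orbit p w t) \<partial>lborel)"
    unfolding laplace_def head_def using integrable_head[OF assms] integrable_exp_orbit(1)[OF assms(1-3)] by simp
  also have "\<dots> = (\<integral>t. indicator {h..} t * (exp (- \<beta> * t) * orbit p w t) \<partial>lborel)"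
    using assms(4) by (intro Bochner_Integration.integral_cong) (auto simp: indicator_def)
  finally have "exp (\<beta> * h) * (laplace \<beta> p w - head \<beta> h p w) = (\<integral>t. f t \<partial>lborel)"
    by (simp add: f_def)
  also have "\<dots> = (\<integral>t. f (h + 1 * t) \<partial>lborel)"
    using lborel_integral_real_affine[of 1 f h] by simp
  also have "\<dots> = (\<integral>t. indicator {0..} t * (exp (- \<beta> * t) * orbit p w (t + h)) \<partial>lborel)"
  proof (intro Bochner_Integration.integral_cong refl)
    fix t
    have "exp (\<beta> * h) * exp (- \<beta> * (h + t)) = exp (- \<beta> * t)"
      by (simp add: exp_add[symmetric] algebra_simps)
    then show "f (h + 1 * t) = indicator {0..} t * (exp (- \<beta> * t) * orbit p w (t + h))"
      by (auto simp: f_def indicator_def mult.assoc[symmetric] add.commute[of h])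
  qed
  finally show ?thesis by simp
qed

lemma laplace_T:
  assumes "\<beta> > 0" "L2 m p" "L2 m w" "h \<ge> 0"
  shows "laplace \<beta> (T h p) w = exp (\<beta> * h) * (laplace \<beta> p w - head \<beta> h p w)"
  unfolding laplace_shift[OF assms, symmetric] unfolding laplace_def
  using orbit_plus[OF assms(4) _ assms(2,3)] by (intro Bochner_Integration.integral_cong) (auto simp: indicator_def)

text \<open>The averages over short times are close to the value at time 0 uniformly in w, relative
  to its norm. Uniformity matters because w will depend on h when estimates on pairings are turned
  into estimates in norm.\<close>

lemma head_approx:
  assumes "\<beta> > 0" "L2 m p" "\<epsilon> > 0"
  shows "\<forall>\<^sub>F h in at_right 0. \<forall>w. L2 m w \<longrightarrow> \<bar>head \<beta> h p w / h - ip m p w\<bar> \<le> \<epsilon> * l2norm m w"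
proof -
  define \<rho> where "\<rho> = (\<lambda>s. l2norm m (\<lambda>x. T s p x - p x) + (1 - exp (- \<beta> * s)) * l2norm m p)"
  have "(\<rho> \<longlongrightarrow> 0 + (1 - exp (- \<beta> * 0)) * l2norm m p) (at_right 0)"
    unfolding \<rho>_def by (intro tendsto_intros T_continuous assms)
  then have "\<forall>\<^sub>F s in at_right 0. \<rho> s < \<epsilon>"
    using assms by (intro order_tendstoD) auto
  then obtain d where d: "d > 0" "\<And>s. 0 < s \<Longrightarrow> s < d \<Longrightarrow> \<rho> s < \<epsilon>"
    by (auto simp: eventually_at_right_field)
  have near: "\<bar>exp (- \<beta> * s) * orbit p w s - ip m p w\<bar> \<le> \<epsilon> * l2norm m w" if s: "0 < s" "s < d" and w: "L2 m w" for s w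
  proof -
    have L: "L2 m (T s p)" using s assms by (intro T_L2) auto
    have "\<bar>orbit p w s - ip m p w\<bar> \<le> l2norm m (\<lambda>x. T s p x - p x) * l2norm m w"
      unfolding orbit_def ip_diff[OF L assms(2) w, symmetric] by (intro ip_cauchy_schwarz L2_diff L assms w)
    moreover have "exp (- \<beta> * s) * \<bar>orbit p w s - ip m p w\<bar> \<le> 1 * \<bar>orbit p w s - ip m p w\<bar>"
      using assms s by (intro mult_right_mono) auto
    moreover have "(1 - exp (- \<beta> * s)) * \<bar>ip m p w\<bar> \<le> (1 - exp (- \<beta> * s)) * (l2norm m p * l2norm m w)"
      using assms s by (intro mult_left_mono ip_cauchy_schwarz w) auto
    moreover have "\<bar>exp (- \<beta> * s) * orbit p w s - ip m p w\<bar> \<le>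
        exp (- \<beta> * s) * \<bar>orbit p w s - ip m p w\<bar> + (1 - exp (- \<beta> * s)) * \<bar>ip m p w\<bar>"
    proof -
      have "exp (- \<beta> * s) * orbit p w s - ip m p w =
         exp (- \<beta> * s) * (orbit p w s - ip m p w) - (1 - exp (- \<beta> * s)) * ip m p w" by (simp add: algebra_simps)
      then have "\<bar>exp (- \<beta> * s) * orbit p w s - ip m p w\<bar> \<le>
          \<bar>exp (- \<beta> * s) * (orbit p w s - ip m p w)\<bar> + \<bar>(1 - exp (- \<beta> * s)) * ip m p w\<bar>"
        by (metis abs_triangle_ineq4)
      also have "\<dots> = exp (- \<beta> * s) * \<bar>orbit p w s - ip m p w\<bar> + (1 - exp (- \<beta> * s)) * \<bar>ip m p w\<bar>"
        using assms s by (simp add: abs_mult)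
      finally show ?thesis .
    qed
    ultimately have "\<bar>exp (- \<beta> * s) * orbit p w s - ip m p w\<bar> \<le> \<rho> s * l2norm m w"
      unfolding \<rho>_def by (simp add: distrib_right)
    also have "\<dots> \<le> \<epsilon> * l2norm m w" using d(2)[OF s] by (intro mult_right_mono l2norm_nonneg) simp
    finally show ?thesis .
  qed
  have "\<bar>head \<beta> h p w / h - ip m p w\<bar> \<le> \<epsilon> * l2norm m w" if h: "0 < h" "h < d" and w: "L2 m w" for h w
  proof -
    have cint: "integrable lborel (\<lambda>t. indicator {0..<h} t * c)"
      "(\<integral>t. indicator {0..<h} t * c \<partial>lborel) = h * c" for c :: real
      using h by auto
    have hint: "integrable lborel (\<lambda>t. indicator {0..<h} t * (exp (- \<beta> * t) * orbit p w t))"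
      using assms w h by (intro integrable_head) auto
    have "\<bar>head \<beta> h p w - h * ip m p w\<bar> =
      \<bar>\<integral>t. indicator {0..<h} t * (exp (- \<beta> * t) * orbit p w t) - indicator {0..<h} t * ip m p w \<partial>lborel\<bar>"
      unfolding head_def Bochner_Integration.integral_diff[OF hint cint(1)] cint(2) ..
    also have "\<dots> \<le> (\<integral>t. indicator {0..<h} t * (\<epsilon> * l2norm m w) \<partial>lborel)"
    proof (intro integral_abs_bound[THEN order_trans] integral_mono_AE)
      \<comment> \<open>\<open>near\<close> concerns positive times; the remaining time 0 is a null
        set.\<close>
      show "AE t in lborel. \<bar>indicator {0..<h} t * (exp (- \<beta> * t) * orbit p w t) - indicator {0..<h} t * ip m p w\<bar>
          \<le> indicator {0..<h} t * (\<epsilon> * l2norm m w)"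
        using AE_lborel_singleton[of 0]
      proof eventually_elim
        case (elim t)
        then show ?case using near[OF _ _ w, of t] h by (auto simp: indicator_def)
      qed
    qed (use hint cint in auto)
    also have "\<dots> = h * (\<epsilon> * l2norm m w)" by (rule cint)
    finally have "\<bar>head \<beta> h p w - h * ip m p w\<bar> / h \<le> h * (\<epsilon> * l2norm m w) / h"
      using h by (intro divide_right_mono) auto
    moreover have "\<bar>head \<beta> h p w - h * ip m p w\<bar> / h = \<bar>head \<beta> h p w / h - ip m p w\<bar>"
    proof -
      have "head \<beta> h p w / h - ip m p w = (head \<beta> h p w - h * ip m p w) / h"
        using h by (simp add: diff_divide_distrib)
      then show ?thesis using h by (simp only: abs_divide abs_of_pos)
    qed
    ultimately show ?thesis using h by simp
  qed
  then show ?thesis using d(1) by (auto simp: eventually_at_right_field)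
qed

lemma exp_difference_quotient: "((\<lambda>h. (exp (\<beta> * h) - 1) / h) \<longlongrightarrow> \<beta>) (at_right (0::real))"
proof -
  have "((\<lambda>h. exp (\<beta> * h)) has_real_derivative \<beta>) (at 0)" by (auto intro!: derivative_eq_intros)
  then have "((\<lambda>h. (exp (\<beta> * h) - 1) / h) \<longlongrightarrow> \<beta>) (at 0)" by (simp add: has_field_derivative_iff)
  then show ?thesis by (rule filterlim_mono) (auto simp: at_le)
qed

text \<open>This is the resolvent identity on the domain of the generator, in weak form. The
  transform of the difference quotient of f is computed twice: by shifting time, and by its
  convergence to the transform of f'.\<close>

lemma laplace_generator:
  assumes "\<beta> > 0" "gen m T f f'" "L2 m w"
  shows "\<beta> * laplace \<beta> f w - laplace \<beta> f' w = ip m f w"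
proof -
  have f: "L2 m f" "L2 m f'" "((\<lambda>t. l2norm m (\<lambda>x. (T t f x - f x) / t - f' x)) \<longlongrightarrow> 0) (at_right 0)"
    using assms(2) by (auto simp: gen_def)
  have "((\<lambda>h. head \<beta> h f w / h) \<longlongrightarrow> ip m f w) (at_right 0)"
  proof (rule tendstoI)
    fix \<epsilon> :: real assume "\<epsilon> > 0"
    then have "\<epsilon> / (l2norm m w + 1) > 0" using l2norm_nonneg[of m w] by simp
    from head_approx[OF assms(1) f(1) this] show "\<forall>\<^sub>F h in at_right 0. dist (head \<beta> h f w / h) (ip m f w) < \<epsilon>"
    proof eventually_elim
      case (elim h)
      have "\<epsilon> / (l2norm m w + 1) * l2norm m w < \<epsilon>"
        using \<open>\<epsilon> > 0\<close> l2norm_nonneg[of m w] by (simp add: field_simps)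
      then show ?case using elim assms(3) unfolding dist_real_def by fastforce
    qed
  qed
  then have "((\<lambda>h. (exp (\<beta> * h) - 1) / h * laplace \<beta> f w - exp (\<beta> * h) * (head \<beta> h f w / h)) \<longlongrightarrow>
      \<beta> * laplace \<beta> f w - exp (\<beta> * 0) * ip m f w) (at_right 0)"
    by (intro tendsto_intros exp_difference_quotient)
  moreover have "((\<lambda>h. (exp (\<beta> * h) - 1) / h * laplace \<beta> f w - exp (\<beta> * h) * (head \<beta> h f w / h)) \<longlongrightarrow> laplace \<beta> f' w) (at_right 0)"
  proof (rule Lim_transform_eventually[where f="\<lambda>h. laplace \<beta> (\<lambda>x. (1 / h) * T h f x + (- 1 / h) * f x) w"])
    show "((\<lambda>h. laplace \<beta> (\<lambda>x. (1 / h) * T h f x + (- 1 / h) * f x) w) \<longlongrightarrow> laplace \<beta> f' w) (at_right 0)"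
    proof (rule LIM_zero_cancel, rule Lim_null_comparison)
      show "((\<lambda>h. l2norm m (\<lambda>x. (T h f x - f x) / h - f' x) * (l2norm m w / \<beta>)) \<longlongrightarrow> 0) (at_right 0)"
        using tendsto_mult_right[OF f(3), of "l2norm m w / \<beta>"] by simp
      show "\<forall>\<^sub>F h in at_right 0. norm (laplace \<beta> (\<lambda>x. (1 / h) * T h f x + (- 1 / h) * f x) w - laplace \<beta> f' w) \<le>
          l2norm m (\<lambda>x. (T h f x - f x) / h - f' x) * (l2norm m w / \<beta>)"
        using eventually_at_right_less[of 0]
      proof eventually_elim
        case (elim h)
        have L: "L2 m (\<lambda>x. (1 / h) * T h f x + (- 1 / h) * f x)" using elim f by (intro L2_comb T_L2) auto
        define q where "q = (\<lambda>x. 1 * ((1 / h) * T h f x + (- 1 / h) * f x) + (-1) * f' x)"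
        have "laplace \<beta> (\<lambda>x. (1 / h) * T h f x + (- 1 / h) * f x) w - laplace \<beta> f' w = laplace \<beta> q w"
          unfolding q_def laplace_comb_left[OF assms(1) L f(2) assms(3)] by simp
        moreover have "\<bar>laplace \<beta> q w\<bar> \<le> l2norm m q * l2norm m w / \<beta>"
          unfolding q_def by (intro laplace_le L2_comb[OF L f(2)] assms)
        moreover have "q = (\<lambda>x. (T h f x - f x) / h - f' x)"
          by (auto simp: q_def diff_divide_distrib)
        ultimately show ?case by simp
      qed
    qed
    show "\<forall>\<^sub>F h in at_right 0. laplace \<beta> (\<lambda>x. (1 / h) * T h f x + (- 1 / h) * f x) w =
        (exp (\<beta> * h) - 1) / h * laplace \<beta> f w - exp (\<beta> * h) * (head \<beta> h f w / h)"
      using eventually_at_right_less[of 0]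
    proof eventually_elim
      case (elim h)
      then have "L2 m (T h f)" using f by (intro T_L2) auto
      from laplace_comb_left[OF assms(1) this f(1) assms(3), of "1 / h" "- 1 / h"]
      show ?case using laplace_T[OF assms(1) f(1) assms(3), of h] elim
        by (simp add: diff_divide_distrib left_diff_distrib right_diff_distrib)
    qed
  qed
  ultimately have "\<beta> * laplace \<beta> f w - exp (\<beta> * 0) * ip m f w = laplace \<beta> f' w"
    by (intro tendsto_unique[OF trivial_limit_at_right_real])
  then show ?thesis by simp
qed

text \<open>Riesz representation produces g from its pairings. Membership in the domain asks for
  convergence of the difference quotients in norm while only pairings are known; the error is
  therefore paired with itself, using estimates uniform in the test function.\<close>

lemma resolvent_exists:
  assumes "\<beta> > 0" "L2 m u"
  shows "\<exists>g. gen m T g (\<lambda>x. \<beta> * g x - u x) \<and> (\<forall>w. L2 m w \<longrightarrow> ip m g w = laplace \<beta> u w)"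
proof -
  have "\<exists>g. L2 m g \<and> (\<forall>w. L2 m w \<longrightarrow> ip m g w = laplace \<beta> u w)"
    using laplace_comb_right[OF assms(1) _ _ assms(2)] laplace_le[OF assms]
    by (intro L2_riesz[where c="l2norm m u / \<beta>"]) (auto simp: mult_ac)
  then obtain g where g: "L2 m g" "\<And>w. L2 m w \<Longrightarrow> ip m g w = laplace \<beta> u w" by blast
  have Tg: "ip m (T h g) w = exp (\<beta> * h) * (ip m g w - head \<beta> h u w)" if h: "h \<ge> 0" and w: "L2 m w" for h w
  proof -
    \<comment> \<open>w' is the adjoint of \<open>T h\<close> applied to w. With it
      \<open>T h\<close> moves inside the Laplace integral, where it becomes a shift of
      time.\<close>
    have "\<exists>w'. L2 m w' \<and> (\<forall>f. L2 m f \<longrightarrow> ip m w' f = orbit f w h)"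
      using orbit_comb_left[OF h _ _ w] orbit_le[OF h _ w]
      by (intro L2_riesz[where c="l2norm m w"]) (auto simp: mult_ac)
    then obtain w' where w': "L2 m w'" "\<And>f. L2 m f \<Longrightarrow> ip m w' f = orbit f w h" by blast
    have "ip m (T h g) w = ip m g w'" using w'(2)[OF g(1)] by (simp add: orbit_def ip_commute)
    also have "\<dots> = laplace \<beta> u w'" by (rule g(2)[OF w'(1)])
    also have "\<dots> = (\<integral>t. indicator {0..} t * (exp (- \<beta> * t) * orbit u w (t + h)) \<partial>lborel)"
      unfolding laplace_def
    proof (intro Bochner_Integration.integral_cong refl)
      fix t :: real
      have "orbit u w' t = orbit u w (t + h)" if t: "t \<ge> 0"
      proof -
        have "orbit u w' t = orbit (T t u) w h"
          using w'(2)[OF T_L2[OF t assms(2)]] by (simp add: orbit_def ip_commute)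
        then show ?thesis using orbit_plus[OF t h assms(2) w] by (simp add: add.commute)
      qed
      then show "indicator {0..} t * (exp (- \<beta> * t) * orbit u w' t) = indicator {0..} t * (exp (- \<beta> * t) * orbit u w (t + h))"
        by (auto simp: indicator_def)
    qed
    also have "\<dots> = exp (\<beta> * h) * (ip m g w - head \<beta> h u w)"
      using laplace_shift[OF assms w h] g(2)[OF w] by simp
    finally show ?thesis .
  qed
  define z where "z = (\<lambda>h x. (T h g x - g x) / h - (\<beta> * g x - u x))"
  have zL: "L2 m (z h)" if "h > 0" for h
  proof -
    have "L2 m (\<lambda>x. 1 * ((1/h) * T h g x + (- 1/h) * g x) + (-1) * (\<beta> * g x + (-1) * u x))"
      using that g assms by (intro L2_comb T_L2) auto
    moreover have "(\<lambda>x. 1 * ((1/h) * T h g x + (- 1/h) * g x) + (-1) * (\<beta> * g x + (-1) * u x)) = z h"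
      by (auto simp: z_def diff_divide_distrib)
    ultimately show ?thesis by simp
  qed
  have zip: "ip m (z h) w = ((exp (\<beta> * h) - 1) / h - \<beta>) * ip m g w - (exp (\<beta> * h) * (head \<beta> h u w / h) - ip m u w)"
    if h: "h > 0" and w: "L2 m w" for h w
  proof -
    have Lg: "L2 m (T h g)" using h g by (intro T_L2) auto
    have "z h = (\<lambda>x. 1 * ((1/h) * T h g x + (- 1/h) * g x) + (-1) * (\<beta> * g x + (-1) * u x))"
      by (auto simp: z_def diff_divide_distrib)
    then have "ip m (z h) w = (1/h) * ip m (T h g) w + (- 1/h) * ip m g w - (\<beta> * ip m g w - ip m u w)"
      using ip_comb[OF L2_comb[OF Lg g(1)] L2_comb[OF g(1) assms(2)] w, of 1 "1/h" "-1/h" "-1" \<beta> "-1"]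
        ip_comb[OF Lg g(1) w, of "1/h" "-1/h"] ip_comb[OF g(1) assms(2) w, of \<beta> "-1"] by simp
    then show ?thesis using Tg[of h w] h w
      by (simp add: diff_divide_distrib left_diff_distrib right_diff_distrib)
  qed
  have "((\<lambda>h. l2norm m (z h)) \<longlongrightarrow> 0) (at_right 0)"
  proof (rule tendstoI)
    fix \<epsilon> :: real assume \<epsilon>: "\<epsilon> > 0"
    define b where "b = (\<lambda>h. \<bar>(exp (\<beta> * h) - 1) / h - \<beta>\<bar> * l2norm m g + (exp (\<beta> * h) * (\<epsilon> / 2) + \<bar>exp (\<beta> * h) - 1\<bar> * l2norm m u))"
    have "(b \<longlongrightarrow> \<bar>\<beta> - \<beta>\<bar> * l2norm m g + (exp (\<beta> * 0) * (\<epsilon> / 2) + \<bar>exp (\<beta> * 0) - 1\<bar> * l2norm m u)) (at_right 0)"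
      unfolding b_def by (intro tendsto_intros exp_difference_quotient)
    then have "\<forall>\<^sub>F h in at_right 0. b h < \<epsilon>" by (rule order_tendstoD) (use \<epsilon> in simp)
    moreover have "\<forall>\<^sub>F h in at_right 0. \<forall>w. L2 m w \<longrightarrow> \<bar>head \<beta> h u w / h - ip m u w\<bar> \<le> \<epsilon> / 2 * l2norm m w"
      using \<epsilon> by (intro head_approx assms) simp
    ultimately show "\<forall>\<^sub>F h in at_right 0. dist (l2norm m (z h)) 0 < \<epsilon>"
      using eventually_at_right_less[of 0]
    proof eventually_elim
      case (elim h)
      \<comment> \<open>The error is its own test function; dividing by its norm turns the bound on
        pairings into a bound on the norm.\<close>
      define w where "w = z h"
      have w: "L2 m w" using zL elim by (simp add: w_def)
      have 1: "\<bar>((exp (\<beta> * h) - 1) / h - \<beta>) * ip m g w\<bar> \<le> \<bar>(exp (\<beta> * h) - 1) / h - \<beta>\<bar> * (l2norm m g * l2norm m w)"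
        unfolding abs_mult by (intro mult_left_mono ip_cauchy_schwarz g w) auto
      have 2: "\<bar>exp (\<beta> * h) * (head \<beta> h u w / h - ip m u w)\<bar> \<le> exp (\<beta> * h) * (\<epsilon> / 2 * l2norm m w)"
        unfolding abs_mult using elim(2) w by (intro mult_mono) auto
      have 3: "\<bar>(exp (\<beta> * h) - 1) * ip m u w\<bar> \<le> \<bar>exp (\<beta> * h) - 1\<bar> * (l2norm m u * l2norm m w)"
        unfolding abs_mult by (intro mult_left_mono ip_cauchy_schwarz assms w) auto
      have "ip m (z h) w = ((exp (\<beta> * h) - 1) / h - \<beta>) * ip m g w - (exp (\<beta> * h) * (head \<beta> h u w / h - ip m u w) + (exp (\<beta> * h) - 1) * ip m u w)"
        unfolding zip[OF elim(3) w] by (simp add: algebra_simps)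
      then have "ip m w w \<le> b h * l2norm m w"
        using 1 2 3 unfolding b_def w_def[symmetric] distrib_right mult.assoc by linarith
      then have "l2norm m w * l2norm m w \<le> b h * l2norm m w" using l2norm_power2[of m w] by (simp add: power2_eq_square)
      then have "l2norm m w < \<epsilon>"
        using elim(1) \<epsilon> l2norm_nonneg[of m w] by (cases "l2norm m w = 0") auto
      then show ?case using l2norm_nonneg[of m w] by (simp add: w_def)
    qed
  qed
  then have "gen m T g (\<lambda>x. \<beta> * g x - u x)"
    using g L2_comb[OF g(1) assms(2), of \<beta> "-1"] by (simp add: gen_def z_def)
  then show ?thesis using g by blast
qed

text \<open>Here Riesz representation is applied in the first argument of \<open>laplace\<close>.
  The defining identity of the adjoint, tested on a pair f, f' of the generator, is then
  \<open>laplace_generator\<close>.\<close>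

lemma coresolvent_exists:
  assumes "\<beta> > 0" "L2 m u"
  shows "\<exists>h. cogen m T h (\<lambda>x. \<beta> * h x - u x) \<and> (\<forall>w. L2 m w \<longrightarrow> ip m h w = laplace \<beta> w u)"
proof -
  have "\<exists>h. L2 m h \<and> (\<forall>w. L2 m w \<longrightarrow> ip m h w = laplace \<beta> w u)"
    using laplace_comb_left[OF assms(1) _ _ assms(2)] laplace_le[OF assms(1) _ assms(2)]
    by (intro L2_riesz[where c="l2norm m u / \<beta>"]) (auto simp: mult_ac)
  then obtain h where h: "L2 m h" "\<And>w. L2 m w \<Longrightarrow> ip m h w = laplace \<beta> w u" by blast
  have "ip m f' h = ip m f (\<lambda>x. \<beta> * h x - u x)" if f: "gen m T f f'" for f f'
  proof -
    have L: "L2 m f" "L2 m f'" using f by (auto simp: gen_def)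
    have "ip m f (\<lambda>x. \<beta> * h x - u x) = \<beta> * ip m f h - ip m f u"
      using ip_comb_right[OF h(1) assms(2) L(1), of \<beta> "-1"] by simp
    also have "\<dots> = laplace \<beta> f' u"
      using laplace_generator[OF assms(1) f assms(2)] h(2)[OF L(1)] by (simp add: ip_commute[of m f h])
    also have "\<dots> = ip m f' h" using h(2)[OF L(2)] by (simp add: ip_commute)
    finally show ?thesis by simp
  qed
  then have "cogen m T h (\<lambda>x. \<beta> * h x - u x)"
    using h L2_comb[OF h(1) assms(2), of \<beta> "-1"] by (simp add: cogen_def)
  then show ?thesis using h by blast
qed

text \<open>Letting the co-generator act on v, the quantity equals -\<beta> times the Laplace
  pairing of u with v', and \<open>laplace_generator\<close> for u shows that this differs from
  \<open>- ip m u v'\<close> by a term of order 1 / \<beta>.\<close>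

lemma laplace_limit:
  assumes u: "gen m T u u'" and v: "cogen m T v v'"
  shows "((\<lambda>\<beta>. \<beta> * (ip m u v - \<beta> * laplace \<beta> u v)) \<longlongrightarrow> - ip m u' v) at_top"
proof -
  have L: "L2 m u" "L2 m u'" "L2 m v" "L2 m v'" using u v by (auto simp: gen_def cogen_def)
  have "((\<lambda>\<beta>. \<beta> * laplace \<beta> u v') \<longlongrightarrow> ip m u v') at_top"
  proof (rule LIM_zero_cancel, rule Lim_null_comparison)
    show "\<forall>\<^sub>F \<beta> in at_top. norm (\<beta> * laplace \<beta> u v' - ip m u v') \<le> l2norm m u' * l2norm m v' / \<beta>"
      using eventually_gt_at_top[of 0]
    proof eventually_elim
      case (elim \<beta>)
      then show ?case using laplace_generator[OF elim u L(4)] laplace_le[OF elim L(2,4)] by (simp add: algebra_simps)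
    qed
    show "((\<lambda>\<beta>. l2norm m u' * l2norm m v' / \<beta>) \<longlongrightarrow> 0) at_top"
      by (intro real_tendsto_divide_at_top[OF tendsto_const] filterlim_ident)
  qed
  then have "((\<lambda>\<beta>. - (\<beta> * laplace \<beta> u v')) \<longlongrightarrow> - ip m u v') at_top" by (intro tendsto_intros)
  moreover have "\<forall>\<^sub>F \<beta> in at_top. - (\<beta> * laplace \<beta> u v') = \<beta> * (ip m u v - \<beta> * laplace \<beta> u v)"
    using eventually_gt_at_top[of 0]
  proof eventually_elim
    case (elim \<beta>)
    obtain g where g: "gen m T g (\<lambda>x. \<beta> * g x - u x)" "\<And>w. L2 m w \<Longrightarrow> ip m g w = laplace \<beta> u w"
      using resolvent_exists[OF elim L(1)] by blast
    then have "L2 m g" by (simp add: gen_def)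
    have "ip m (\<lambda>x. \<beta> * g x - u x) v = ip m g v'" using v g(1) unfolding cogen_def by blast
    then have "\<beta> * laplace \<beta> u v - ip m u v = laplace \<beta> u v'"
      using ip_comb[OF \<open>L2 m g\<close> L(1,3), of \<beta> "-1"] g(2)[OF L(3)] g(2)[OF L(4)] by simp
    then have "ip m u v - \<beta> * laplace \<beta> u v = - laplace \<beta> u v'" by simp
    then show ?case by simp
  qed
  ultimately have "((\<lambda>\<beta>. \<beta> * (ip m u v - \<beta> * laplace \<beta> u v)) \<longlongrightarrow> - ip m u v') at_top"
    by (rule Lim_transform_eventually)
  moreover have "ip m u' v = ip m u v'" using u v unfolding cogen_def by blast
  ultimately show ?thesis by simp
qed

end

lemma sub_markov_sg_imp_contraction_semigroup: "sub_markov_sg m T \<Longrightarrow> contraction_semigroup m T"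
  unfolding sub_markov_sg_def by (elim conjE, unfold_locales) simp_all

text \<open>On products both kernels act as \<beta> times \<open>laplace\<close>, with exchanged
  arguments for the co-kernel, which gives the transposition.\<close>

lemma case1_kernel_limits:
  fixes U :: "(real^'n::finite) set"
  assumes "case1 U m E \<sigma> \<sigma>h"
  shows "\<And>\<beta> u v. \<beta> > 0 \<Longrightarrow> u \<in> C0inf U \<Longrightarrow> v \<in> C0inf U \<Longrightarrow>
      (\<integral>z. u (fst z) * v (snd z) \<partial>\<sigma>h \<beta>) = (\<integral>z. v (fst z) * u (snd z) \<partial>\<sigma> \<beta>)"
    and "\<And>u v. u \<in> C0inf U \<Longrightarrow> v \<in> C0inf U \<Longrightarrow>
      ((\<lambda>\<beta>. \<beta> * (ip m u v - (\<integral>z. u (fst z) * v (snd z) \<partial>\<sigma> \<beta>))) \<longlongrightarrow> E u v) at_top"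
proof -
  obtain T where T: "sub_markov_sg m T" and
    dom: "\<forall>u\<in>C0inf U. (\<exists>g. gen m T u g) \<and> (\<exists>h. cogen m T u h)" and
    E: "\<forall>u\<in>C0inf U. \<forall>v\<in>C0inf U. \<forall>g. gen m T u g \<longrightarrow> E u v = - ip m g v" and
    R: "\<forall>\<beta>>0. \<forall>u\<in>C0inf U. \<forall>v\<in>C0inf U.
        (\<forall>g g'. gen m T g g' \<and> (AE x in m. \<beta> * g x - g' x = u x) \<longrightarrow>
            (\<integral>z. u (fst z) * v (snd z) \<partial>(\<sigma> \<beta>)) = \<beta> * ip m g v) \<and>
        (\<forall>h h'. cogen m T h h' \<and> (AE x in m. \<beta> * h x - h' x = u x) \<longrightarrow>
            (\<integral>z. u (fst z) * v (snd z) \<partial>(\<sigma>h \<beta>)) = \<beta> * ip m h v)"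
    using assms unfolding case1_def by (elim exE conjE)
  interpret contraction_semigroup m T using T by (rule sub_markov_sg_imp_contraction_semigroup)
  have L: "L2 m u" if "u \<in> C0inf U" for u using dom that by (auto simp: gen_def)
  have \<sigma>: "(\<integral>z. u (fst z) * v (snd z) \<partial>\<sigma> \<beta>) = \<beta> * laplace \<beta> u v"
    if \<beta>: "\<beta> > 0" and uv: "u \<in> C0inf U" "v \<in> C0inf U" for \<beta> u v
  proof -
    obtain g where "gen m T g (\<lambda>x. \<beta> * g x - u x)" "ip m g v = laplace \<beta> u v"
      using resolvent_exists[OF \<beta> L[OF uv(1)]] L[OF uv(2)] by blast
    then show ?thesis using R \<beta> uv by force
  qed
  have \<sigma>h: "(\<integral>z. u (fst z) * v (snd z) \<partial>\<sigma>h \<beta>) = \<beta> * laplace \<beta> v u"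
    if \<beta>: "\<beta> > 0" and uv: "u \<in> C0inf U" "v \<in> C0inf U" for \<beta> u v
  proof -
    obtain h where "cogen m T h (\<lambda>x. \<beta> * h x - u x)" "ip m h v = laplace \<beta> v u"
      using coresolvent_exists[OF \<beta> L[OF uv(1)]] L[OF uv(2)] by blast
    then show ?thesis using R \<beta> uv by force
  qed
  show "(\<integral>z. u (fst z) * v (snd z) \<partial>\<sigma>h \<beta>) = (\<integral>z. v (fst z) * u (snd z) \<partial>\<sigma> \<beta>)"
    if "\<beta> > 0" "u \<in> C0inf U" "v \<in> C0inf U" for \<beta> u v
    using \<sigma>[OF that(1,3,2)] \<sigma>h[OF that] by simp
  show "((\<lambda>\<beta>. \<beta> * (ip m u v - (\<integral>z. u (fst z) * v (snd z) \<partial>\<sigma> \<beta>))) \<longlongrightarrow> E u v) at_top"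
    if uv: "u \<in> C0inf U" "v \<in> C0inf U" for u v
  proof -
    obtain u' v' where u': "gen m T u u'" "cogen m T v v'" using dom uv by blast
    have "\<forall>\<^sub>F \<beta> in at_top. \<beta> * (ip m u v - \<beta> * laplace \<beta> u v) = \<beta> * (ip m u v - (\<integral>z. u (fst z) * v (snd z) \<partial>\<sigma> \<beta>))"
      using eventually_gt_at_top[of 0] by eventually_elim (simp add: \<sigma> uv)
    from Lim_transform_eventually[OF laplace_limit[OF u'] this] show ?thesis
      using E uv u'(1) by simp
  qed
qed

section \<open>Transposition and the level sets of the distance\<close>

lemma measurable_swap_borel:
  "prod.swap \<in> measurable (borel :: ('a::topological_space \<times> 'a) measure) borel"
  by (intro borel_measurable_continuous_onI continuous_on_swap)

lemma radon_on_distr_swap: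
  fixes U :: "'a::t2_space set"
  assumes "open U" and M: "radon_on M (U \<times> U - {(x, y). x = y})"
  shows "radon_on (distr M borel prod.swap) (U \<times> U - {(x, y). x = y})"
proof -
  let ?S = "U \<times> U - {(x, y). x = y}"
  have s: "sets M = sets borel" and sp: "space M = UNIV"
    using M sets_eq_imp_space_eq[of M borel] by (auto simp: radon_on_def)
  have meas: "prod.swap \<in> measurable M borel"
    using measurable_swap_borel measurable_cong_sets[OF s refl] by blast
  have "open ?S"
  proof -
    have "{(x::'a, y). x = y} = {z. fst z = snd z}" by auto
    moreover have "closed {z::'a \<times> 'a. fst z = snd z}" by (intro closed_Collect_eq continuous_intros)
    ultimately show ?thesis using assms(1) by (auto intro!: open_Diff open_Times)
  qed
  then have S: "UNIV - ?S \<in> sets borel" by auto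
  have "prod.swap -` (UNIV - ?S) = UNIV - ?S" by auto
  then have "emeasure (distr M borel prod.swap) (UNIV - ?S) = 0"
    using emeasure_distr[OF meas S] M sp by (simp add: radon_on_def)
  moreover have "emeasure (distr M borel prod.swap) C < \<infinity>" if C: "compact C" "C \<subseteq> ?S" for C
  proof -
    have "C \<in> sets borel" using C by (intro borel_closed compact_imp_closed)
    then have "emeasure (distr M borel prod.swap) C = emeasure M (prod.swap -` C)"
      using emeasure_distr[OF meas] sp by simp
    also have "prod.swap -` C = prod.swap ` C" by force
    also have "emeasure M (prod.swap ` C) < \<infinity>"
    proof -
      have "compact (prod.swap ` C)" using C by (intro compact_continuous_image continuous_on_swap)
      moreover have "prod.swap ` C \<subseteq> ?S" using C by auto
      ultimately show ?thesis using M by (simp add: radon_on_def)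
    qed
    finally show ?thesis .
  qed
  ultimately show ?thesis by (simp add: radon_on_def)
qed

text \<open>A pair at distance exactly \<open>\<zeta> l\<close> belongs to \<open>Gam\<close>, but
  moving y towards x by an arbitrarily small amount leaves the set. The continuity of
  \<open>J\<close> on \<open>Gam\<close> thus makes the level set null.\<close>

lemma dist_level_subset_frontier_Gam:
  fixes \<Omega> :: "nat \<Rightarrow> (real^'n::finite) set"
  assumes "\<zeta> l > 0"
  shows "{z. fst z \<in> \<Omega> l \<and> snd z \<in> \<Omega> l \<and> dist (fst z) (snd z) = \<zeta> l} \<subseteq> frontier (Gam \<Omega> \<zeta> l)"
proof
  fix z assume z: "z \<in> {z. fst z \<in> \<Omega> l \<and> snd z \<in> \<Omega> l \<and> dist (fst z) (snd z) = \<zeta> l}"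
  obtain x y where xy: "z = (x, y)" by force
  then have d: "x \<in> \<Omega> l" "y \<in> \<Omega> l" "dist x y = \<zeta> l" using z by auto
  have "z \<in> closure (Gam \<Omega> \<zeta> l)" using d xy closure_subset by (fastforce simp: Gam_def)
  moreover have "z \<notin> interior (Gam \<Omega> \<zeta> l)"
  proof
    assume "z \<in> interior (Gam \<Omega> \<zeta> l)"
    then obtain e where e: "e > 0" "ball z e \<subseteq> Gam \<Omega> \<zeta> l" by (auto simp: mem_interior)
    \<comment> \<open>The displacement \<open>t * \<zeta> l\<close> is at most e / 2, and t at most
      1 keeps y' on the segment from y to x.\<close>
    define t where "t = min 1 (e / (2 * \<zeta> l))"
    have t: "0 < t" "t \<le> 1" "t * \<zeta> l < e"
    proof -
      show "0 < t" "t \<le> 1" using e assms by (auto simp: t_def)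
      have "t * \<zeta> l \<le> e / (2 * \<zeta> l) * \<zeta> l" using assms by (intro mult_right_mono) (auto simp: t_def)
      also have "\<dots> < e" using assms e by simp
      finally show "t * \<zeta> l < e" .
    qed
    define y' where "y' = y + t *\<^sub>R (x - y)"
    have "dist y y' = t * \<zeta> l" using t d by (simp add: y'_def dist_norm)
    then have "dist z (x, y') < e" using t assms by (simp add: xy dist_Pair_Pair)
    then have "(x, y') \<in> Gam \<Omega> \<zeta> l" using e by auto
    then have "dist x y' \<ge> \<zeta> l" by (simp add: Gam_def)
    moreover have "x - y' = (1 - t) *\<^sub>R (x - y)" by (simp add: y'_def algebra_simps)
    then have "dist x y' = (1 - t) * \<zeta> l" using t d by (simp add: dist_norm)
    ultimately have "\<zeta> l \<le> (1 - t) * \<zeta> l" by simp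
    moreover have "t * \<zeta> l > 0" using t assms by simp
    ultimately show False by (simp add: left_diff_distrib)
  qed
  ultimately show "z \<in> frontier (Gam \<Omega> \<zeta> l)" by (simp add: frontier_def)
qed

section \<open>Combination of the formulas for the form and its transpose\<close>

theorem theorem2p4:
  fixes U :: "(real^'n::finite) set"
    and m :: "(real^'n) measure"
    and E :: "(real^'n \<Rightarrow> real) \<Rightarrow> (real^'n \<Rightarrow> real) \<Rightarrow> real"
    and \<sigma> \<sigma>h :: "real \<Rightarrow> ((real^'n) \<times> (real^'n)) measure"
    and J :: "((real^'n) \<times> (real^'n)) measure"
    and K :: "(real^'n) measure"
    and \<Omega> :: "nat \<Rightarrow> (real^'n) set"
    and \<zeta> dk :: "nat \<Rightarrow> real"
    and \<delta> :: real
    and u v chi :: "real^'n \<Rightarrow> real"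
  assumes U_open: "open U"
    and m_radon: "radon_on m U"
    and m_supp: "\<forall>x\<in>U. \<forall>e>0. emeasure m (ball x e) > 0"
    and cases: "case1 U m E \<sigma> \<sigma>h \<or> case2 U m E \<sigma> \<sigma>h"
    and \<sigma>_radon: "\<forall>\<beta>>0. radon_on (\<sigma> \<beta>) (U \<times> U) \<and> radon_on (\<sigma>h \<beta>) (U \<times> U)"
    and J_radon: "radon_on J (U \<times> U - {(x, y). x = y})"
    and K_radon: "radon_on K U"
    and JK: "\<forall>u\<in>C0inf U. \<forall>v\<in>C0inf U.
               (\<exists>c N. open N \<and> supp v \<subseteq> N \<and> (\<forall>x\<in>N. u x = c)) \<longrightarrow>
               E u v = (\<integral>z. 2 * (u (snd z) - u (fst z)) * v (snd z) \<partial>J) + (\<integral>x. u x * v x \<partial>K)"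
    and \<delta>_pos: "\<delta> > 0"
    and Ud_ne: "Udelta U \<delta> \<noteq> {}"
    and \<Omega>_open: "\<forall>l. open (\<Omega> l) \<and> compact (closure (\<Omega> l)) \<and> closure (\<Omega> l) \<subseteq> U"
    and \<Omega>_mono: "incseq \<Omega>"
    and \<Omega>_Un: "(\<Union>l. \<Omega> l) = U"
    and \<zeta>_pos: "\<forall>l. \<zeta> l > 0"
    and \<zeta>_mono: "decseq \<zeta>"
    and \<zeta>_lim: "\<zeta> \<longlonglongrightarrow> 0"
    and \<Gamma>_cont: "\<forall>l. emeasure J (frontier (Gam \<Omega> \<zeta> l)) = 0"
    and dk_ge: "\<forall>k. dk k \<ge> \<delta>"
    and dk_lim: "dk \<longlonglongrightarrow> \<delta>"
    and dk_cont: "\<forall>k. emeasure J {z. dist (fst z) (snd z) = dk k} = 0"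
    and u: "u \<in> C0inf (Udelta U \<delta>)"
    and v: "v \<in> C0inf (Udelta U \<delta>)"
    and chi: "chi \<in> C0inf (Udelta U \<delta>)"
    and chi_one: "\<exists>N. open N \<and> supp u \<union> supp v \<subseteq> N \<and> (\<forall>x\<in>N. chi x = 1)"
  shows "Ec \<sigma> \<Omega> \<zeta> dk u v =
           muc_int \<sigma> \<Omega> \<zeta> u v chi / 2
         + Ldelta \<sigma> \<sigma>h \<Omega> \<zeta> dk u v chi
         + (\<integral>z. (\<Sum>i\<in>UNIV. (snd z $ i - fst z $ i) *
                 (pd i u (snd z) * v (snd z) - pd i u (fst z) * v (fst z))) *
               indicator {w. dist (fst w) (snd w) \<le> \<delta>} z \<partial>J)"
proof -
  have limits:
    "(\<integral>z. f (fst z) * g (snd z) \<partial>\<sigma>h \<beta>) = (\<integral>z. g (fst z) * f (snd z) \<partial>\<sigma> \<beta>)"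
    "((\<lambda>\<beta>. \<beta> * (ip m f g - (\<integral>z. f (fst z) * g (snd z) \<partial>\<sigma> \<beta>))) \<longlongrightarrow> E f g) at_top"
    if "\<beta> > 0" "f \<in> C0inf U" "g \<in> C0inf U" for \<beta> f g
    using cases case1_kernel_limits[of U m E \<sigma> \<sigma>h] case2_kernel_limits[of U m E \<sigma> \<sigma>h] that by blast+
  have disjoint: "E f g = - 2 * (\<integral>z. f (fst z) * g (snd z) \<partial>J)"
    if fg: "f \<in> C0inf U" "g \<in> C0inf U" "supp f \<inter> supp g = {}" for f g
  proof -
    have zero: "f x * g x = 0" for x using fg(3) supp_superset[of f x] supp_superset[of g x] by fastforce
    have "\<exists>c N. open N \<and> supp g \<subseteq> N \<and> (\<forall>x\<in>N. f x = c)"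
      using fg(3) supp_superset[of f]
      by (intro exI[of _ 0] exI[of _ "- supp f"]) (auto simp: supp_def)
    then have "E f g = (\<integral>z. 2 * (f (snd z) - f (fst z)) * g (snd z) \<partial>J) + (\<integral>x. f x * g x \<partial>K)"
      using JK fg by blast
    moreover have "2 * (f (snd z) - f (fst z)) * g (snd z) = - 2 * (f (fst z) * g (snd z))"
      for z :: "(real^'n) \<times> (real^'n)"
      using zero[of "snd z"] by (simp add: left_diff_distrib mult.assoc)
    ultimately show ?thesis by (simp only: zero integral_mult_right_zero integral_zero)
  qed
  \<comment> \<open>Exchanging the arguments of the form exchanges the variables of its jump
    measure.\<close>
  define Jh where "Jh = distr J borel prod.swap"
  have sJ: "sets J = sets borel" using J_radon by (simp add: radon_on_def)
  have spJ: "space J = UNIV" using sets_eq_imp_space_eq[OF sJ] by simp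
  have swap: "prod.swap \<in> measurable J borel"
    using measurable_swap_borel measurable_cong_sets[OF sJ refl] by blast
  have int_Jh: "(\<integral>z. F z \<partial>Jh) = (\<integral>z. F (prod.swap z) \<partial>J)"
    if "F \<in> borel_measurable borel" for F :: "(real^'n) \<times> (real^'n) \<Rightarrow> real"
    unfolding Jh_def using swap that by (rule integral_distr)
  have em_Jh: "emeasure Jh A = emeasure J (prod.swap -` A)" if "A \<in> sets borel" for A
    unfolding Jh_def using emeasure_distr[OF swap that] spJ by simp
  have level_borel: "{z. fst z \<in> \<Omega> l \<and> snd z \<in> \<Omega> l \<and> dist (fst z) (snd z) = \<zeta> l} \<in> sets borel" for l
  proof -
    have "open (\<Omega> l \<times> \<Omega> l)" using \<Omega>_open by (intro open_Times) auto
    moreover have "closed {z::(real^'n) \<times> (real^'n). dist (fst z) (snd z) = \<zeta> l}"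
      by (intro closed_Collect_eq continuous_intros)
    ultimately have "(\<Omega> l \<times> \<Omega> l) \<inter> {z. dist (fst z) (snd z) = \<zeta> l} \<in> sets borel" by auto
    moreover have "(\<Omega> l \<times> \<Omega> l) \<inter> {z. dist (fst z) (snd z) = \<zeta> l} =
      {z. fst z \<in> \<Omega> l \<and> snd z \<in> \<Omega> l \<and> dist (fst z) (snd z) = \<zeta> l}" by auto
    ultimately show ?thesis by simp
  qed
  have level_null: "emeasure J {z. fst z \<in> \<Omega> l \<and> snd z \<in> \<Omega> l \<and> dist (fst z) (snd z) = \<zeta> l} = 0" for l
  proof -
    have "emeasure J {z. fst z \<in> \<Omega> l \<and> snd z \<in> \<Omega> l \<and> dist (fst z) (snd z) = \<zeta> l}
        \<le> emeasure J (frontier (Gam \<Omega> \<zeta> l))"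
      using \<zeta>_pos sJ by (intro emeasure_mono dist_level_subset_frontier_Gam) auto
    then show ?thesis using \<Gamma>_cont by simp
  qed
  interpret A: exhausted_kernels U m \<sigma> J E \<Omega> \<zeta> dk \<delta>
    using U_open \<sigma>_radon J_radon limits(2)[of 1] disjoint \<Omega>_open \<Omega>_mono \<Omega>_Un \<zeta>_pos \<zeta>_lim
      level_null dk_ge dk_lim dk_cont \<delta>_pos
    by unfold_locales auto
  \<comment> \<open>On products the co-kernels are the transposes of the kernels, so their limits
    are those of the form with exchanged arguments. The distance is symmetric, hence its null level
    sets are preserved by swapping.\<close>
  interpret Ah: exhausted_kernels U m \<sigma>h Jh "\<lambda>f g. E g f" \<Omega> \<zeta> dk \<delta>
  proof
    show "radon_on Jh (U \<times> U - {(x, y). x = y})"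
      unfolding Jh_def using U_open J_radon by (rule radon_on_distr_swap)
    show "((\<lambda>\<beta>. \<beta> * (ip m f g - (\<integral>z. f (fst z) * g (snd z) \<partial>\<sigma>h \<beta>))) \<longlongrightarrow> E g f) at_top"
      if fg: "f \<in> C0inf U" "g \<in> C0inf U" for f g
    proof (rule Lim_transform_eventually[OF limits(2)[of 1 g f]])
      show "\<forall>\<^sub>F \<beta> in at_top. \<beta> * (ip m g f - (\<integral>z. g (fst z) * f (snd z) \<partial>\<sigma> \<beta>)) =
          \<beta> * (ip m f g - (\<integral>z. f (fst z) * g (snd z) \<partial>\<sigma>h \<beta>))"
        using eventually_gt_at_top[of 0]
        by eventually_elim (simp add: limits(1)[OF _ fg] ip_commute[of m g f])
    qed (use fg in auto)
    show "E g f = - 2 * (\<integral>z. f (fst z) * g (snd z) \<partial>Jh)"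
      if fg: "f \<in> C0inf U" "g \<in> C0inf U" "supp f \<inter> supp g = {}" for f g
    proof -
      have "(\<lambda>z. f (fst z) * g (snd z)) \<in> borel_measurable borel"
        using fg by (intro borel_measurable_continuous_onI continuous_on_tensor) (auto simp: C0inf_def)
      then have "(\<integral>z. f (fst z) * g (snd z) \<partial>Jh) = (\<integral>z. g (fst z) * f (snd z) \<partial>J)"
        using int_Jh by (simp add: mult.commute)
      then show ?thesis using disjoint[OF fg(2,1)] fg(3) by (simp add: Int_commute)
    qed
    show "emeasure Jh {z. fst z \<in> \<Omega> l \<and> snd z \<in> \<Omega> l \<and> dist (fst z) (snd z) = \<zeta> l} = 0" for l
      using em_Jh[OF level_borel] level_null[of l]
      by (simp add: vimage_def dist_commute conj_ac)
    show "emeasure Jh {z. dist (fst z) (snd z) = dk k} = 0" for k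
    proof -
      have "closed {z::(real^'n) \<times> (real^'n). dist (fst z) (snd z) = dk k}"
        by (intro closed_Collect_eq continuous_intros)
      then have "emeasure Jh {z. dist (fst z) (snd z) = dk k} = emeasure J {z. dist (fst z) (snd z) = dk k}"
        using em_Jh[of "{z. dist (fst z) (snd z) = dk k}"] by (simp add: vimage_def dist_commute)
      then show ?thesis using dk_cont by simp
    qed
  qed (use U_open \<sigma>_radon \<Omega>_open \<Omega>_mono \<Omega>_Un \<zeta>_pos \<zeta>_lim dk_ge dk_lim \<delta>_pos in auto)
  have uU: "u \<in> C0inf U" and vU: "v \<in> C0inf U"
    using u v C0inf_mono[OF Udelta_subset] by blast+
  have S: "compact (supp u \<union> supp v)" "supp u \<union> supp v \<subseteq> Udelta U \<delta>"
    using u v by (auto simp: C0inf_def)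
  obtain \<epsilon> C where \<epsilon>: "\<epsilon> > 0" and C: "compact C" "C \<subseteq> U"
    "\<And>x y. y \<in> supp u \<union> supp v \<Longrightarrow> dist x y \<le> \<delta> + \<epsilon> \<Longrightarrow> x \<in> C"
    using Udelta_neighbourhood[OF U_open S \<delta>_pos] by blast
  obtain w N' where w: "w \<in> C0inf U" "C \<subseteq> N'" "\<And>x. x \<in> N' \<Longrightarrow> w x = 1"
    by (rule smooth_cutoff[OF C(1) U_open C(2)]) (rule that)
  have w1: "w x = 1" if "y \<in> supp u \<union> supp v" "dist x y \<le> \<delta> + \<epsilon>" for x y
    using C(3)[OF that] w by blast
  obtain N where N: "open N" "supp u \<union> supp v \<subseteq> N" "\<And>x. x \<in> N \<Longrightarrow> chi x = 1"
    using chi_one by blast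
  define H where "H = (\<lambda>z. ((u (snd z) - u (fst z)) - (\<Sum>i\<in>UNIV. (snd z $ i - fst z $ i) * pd i u (snd z)) *
     indicator {z. dist (fst z) (snd z) \<le> \<delta>} z) * v (snd z) * w (fst z))"
  define Q where "Q = (\<lambda>z. (u (snd z) - u (fst z)) * (v (snd z) - v (fst z)) * w (fst z) * w (snd z))"
  define I where "I = (\<lambda>z. (\<Sum>i\<in>UNIV. (snd z $ i - fst z $ i) *
                 (pd i u (snd z) * v (snd z) - pd i u (fst z) * v (fst z))) *
               indicator {w. dist (fst w) (snd w) \<le> \<delta>} z)"
  have A: "integrable J H" "Ec \<sigma> \<Omega> \<zeta> dk u v = E u v - E w (\<lambda>x. u x * v x) - 2 * (\<integral>z. H z \<partial>J)"
    unfolding H_def by (rule A.Ec_eq[OF uU vU w(1) \<epsilon> w1]; assumption)+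
  have Ah: "integrable Jh H" "Ec \<sigma>h \<Omega> \<zeta> dk u v = E v u - E (\<lambda>x. u x * v x) w - 2 * (\<integral>z. H z \<partial>Jh)"
    unfolding H_def by (rule Ah.Ec_eq[OF uU vU w(1) \<epsilon> w1]; assumption)+
  have AQ: "integrable J Q" "muc_int \<sigma> \<Omega> \<zeta> u v chi = E u v + E v u - E w (\<lambda>x. u x * v x)
      - E (\<lambda>x. u x * v x) w - 2 * (\<integral>z. Q z \<partial>J)"
    unfolding Q_def by (rule A.muc_int_eq[OF uU vU w(1) \<epsilon> w1 N]; assumption)+
  have H_borel: "H \<in> borel_measurable borel"
    using borel_measurable_integrable[OF A(1)] measurable_cong_sets[OF sJ refl] by blast
  have iHs: "integrable J (\<lambda>z. H (prod.swap z))"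
    using Ah(1) integrable_distr_eq[OF swap H_borel] by (simp add: Jh_def)
  have w_supp: "w y * v y = v y" for y
    using w1[of y y] \<delta>_pos \<epsilon> supp_superset[of v y] by (cases "v y = 0") auto
  have near: "v y * w x = v y" if "dist x y \<le> \<delta>" for x y
    using w1[of y x] that \<epsilon> supp_superset[of v y] by (cases "v y = 0") auto
  \<comment> \<open>Up to distance \<delta> every factor w next to v is 1, and the first-order
    differences of u cancel between Q and the two copies of H, leaving the drift terms. Beyond
    \<delta> these are absent and Q is exactly the sum of the two copies.\<close>
  have sum: "I z = Q z - H z - H (prod.swap z)" for z
  proof -
    obtain x y where z: "z = (x, y)" by force
    define a where "a = (\<Sum>i\<in>UNIV. (y $ i - x $ i) * pd i u y)"
    define b where "b = (\<Sum>i\<in>UNIV. (x $ i - y $ i) * pd i u x)"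
    have Q: "Q z = (u y - u x) * (v y * w x - v x * w y)"
    proof -
      have "Q z = (u y - u x) * ((w y * v y) * w x - (w x * v x) * w y)"
        by (simp add: Q_def z algebra_simps)
      then show ?thesis by (simp only: w_supp)
    qed
    have I: "I z = (a * v y + b * v x) * indicator {w. dist (fst w) (snd w) \<le> \<delta>} z"
    proof -
      have "a * v y + b * v x = (\<Sum>i\<in>UNIV. (y $ i - x $ i) * (pd i u y * v y - pd i u x * v x))"
        unfolding a_def b_def sum_distrib_right sum.distrib[symmetric]
        by (intro sum.cong) (auto simp: algebra_simps)
      then show ?thesis by (simp only: I_def z fst_conv snd_conv)
    qed
    show ?thesis
    proof (cases "dist x y \<le> \<delta>")
      case True
      then have "v y * w x = v y" "v x * w y = v x" using near[of x y] near[of y x] by (auto simp: dist_commute)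
      moreover have "H z = (u y - u x - a) * (v y * w x)" "H (prod.swap z) = (u x - u y - b) * (v x * w y)"
        using True by (auto simp: H_def z a_def b_def dist_commute)
      ultimately have "Q z - H z - H (prod.swap z) = (u y - u x) * (v y - v x) - (u y - u x - a) * v y - (u x - u y - b) * v x"
        by (simp only: Q)
      also have "\<dots> = a * v y + b * v x" by (simp add: algebra_simps)
      finally show ?thesis using True unfolding I by (simp add: z)
    next
      case False
      then show ?thesis unfolding Q I by (simp add: H_def z dist_commute algebra_simps)
    qed
  qed
  have "(\<integral>z. I z \<partial>J) = (\<integral>z. Q z \<partial>J) - (\<integral>z. H z \<partial>J) - (\<integral>z. H z \<partial>Jh)"
    unfolding sum int_Jh[OF H_borel] using AQ(1) A(1) iHs by simp
  \<comment> \<open>The values of \<open>E\<close> in the two forms add up to those in the diffusion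
    measure and cancel.\<close>
  then have total: "Ec \<sigma> \<Omega> \<zeta> dk u v + Ec \<sigma>h \<Omega> \<zeta> dk u v = muc_int \<sigma> \<Omega> \<zeta> u v chi + 2 * (\<integral>z. I z \<partial>J)"
    unfolding A(2) Ah(2) AQ(2) by simp
  have "(\<lambda>x. v x * chi x) = v"
    using N(2,3) supp_superset[of v] by (intro ext) (metis UnCI mult.right_neutral mult_zero_left subsetD)
  then have "Ldelta \<sigma> \<sigma>h \<Omega> \<zeta> dk u v chi = (Ec \<sigma> \<Omega> \<zeta> dk u v - Ec \<sigma>h \<Omega> \<zeta> dk u v) / 2"
    by (simp add: Ldelta_def)
  \<comment> \<open>The form is half the sum plus half the difference of itself and its co-version;
    half the difference is the \<open>Ldelta\<close> term.\<close>
  then show ?thesis using total unfolding I_def by (simp add: field_simps)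
qed

end
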